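(* Let $H$ be a BLS-hole with integral vertex coordinates and canonical ordering $L_1,N_2,L_2,\dots,N_k,L_k,R$, and let $r=(w,h)$ be a rectangle with positive integers $w,h$. For $i\in\{2,\dots,k\}$ let $Q_i$ be the upper vertex of $N_i$ and $QW_i$ the first intersection of the boundary of $H$ with the horizontal ray $\{(p_1,y(Q_i)):p_1>x(Q_i)\}$. If $x(QW_i)-x(Q_i)\ge w$ for all $i\in\{2,\dots,k\}$, then the set of all feasible BL-stable locations for placing $r$ within $H$ can be computed in $O(nv(H))$ time, given $H$ as a doubly-linked list of its vertices in boundary order with pointers to the edges of its canonical ordering and to its falling corner (if one exists).
   Context: A hole is a set $H=J\cup I$ where $J$ is a closed rectilinear arc (a closed Jordan curve that is a finite union of axis-parallel segments) and $I$ its bounded inner region; $nv(H)$ is its number of vertices. Edges are the maximal straight segments of $J$, vertices the points where two edges meet. Clockwise traversal of $J$ labels edges leftward/rightward/upward/downward by traversal direction. For a vertical edge $e$ whose two adjacent horizontal edges both extend to the left of $e$: $e$ is a rightmost edge if the interior of $H$ near $e$ lies to its left, a left notch if to its right. For a vertical edge whose two adjacent horizontal edges both extend to the right: it is a leftmost edge if the interior lies to its right, a right notch if to its left. A horizontal edge whose two adjacent vertical edges extend above it is a top notch if the interior near it lies below it. A falling corner is a vertex whose clockwise-preceding edge is downward and clockwise-succeeding edge rightward. A BLS-hole is a hole with no right notch, no top notch and at most one falling corner. A BLS-hole has a unique rightmost edge $R$; its canonical ordering lists, after $R$ in clockwise order, its leftmost edges $L_1,\dots,L_k$ and its left notches $N_2,\dots,N_k$,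 which appear alternately as $L_1,N_2,L_2,\dots,N_k,L_k$ before returning to $R$. A point $p=(p_1,p_2)$ is a feasible location for $(w,h)$ within $H$ if $[p_1,p_1+w]\times[p_2,p_2+h]\subseteq H$; it is a feasible BL-stable location if moreover there is $\varepsilon>0$ such that for every $t\in(0,\varepsilon)$ neither $(p_1-t,p_2)$ nor $(p_1,p_2-t)$ is a feasible location within $H$. *)

theory Defs
  imports "HOL-Complex_Analysis.Complex_Analysis"
begin

section \<open>Holes\<close>

text \<open>The plane is \<^typ>\<open>complex\<close>: \<^term>\<open>Re p\<close> and \<^term>\<open>Im p\<close> are the coordinates of \<^term>\<open>p\<close>.\<close>

definition closed_rectilinear_arc :: "complex set \<Rightarrow> bool" where
  "closed_rectilinear_arc J \<longleftrightarrow>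
     (\<exists>g. simple_path g \<and> pathfinish g = pathstart g \<and> path_image g = J) \<and>
     (\<exists>\<S>. finite \<S> \<and> J = \<Union>\<S> \<and>
        (\<forall>S\<in>\<S>. \<exists>a b. S = closed_segment a b \<and> (Re a = Re b \<or> Im a = Im b)))"

definition is_hole :: "complex set \<Rightarrow> complex set \<Rightarrow> bool" where
  "is_hole J H \<longleftrightarrow> closed_rectilinear_arc J \<and> H = J \<union> inside J"

definition segment_in :: "complex set \<Rightarrow> complex set \<Rightarrow> bool" where
  "segment_in J S \<longleftrightarrow> S \<subseteq> J \<and> (\<exists>a b. a \<noteq> b \<and> S = closed_segment a b)"

definition edges :: "complex set \<Rightarrow> complex set set" where
  "edges J = {S. segment_in J S \<and> (\<forall>T. segment_in J T \<and> S \<subseteq> T \<longrightarrow> T = S)}"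

definition vertices :: "complex set \<Rightarrow> complex set" where
  "vertices J = {p. \<exists>e\<in>edges J. \<exists>e'\<in>edges J. e \<noteq> e' \<and> p \<in> e \<inter> e'}"

definition nv :: "complex set \<Rightarrow> nat" where
  "nv J = card (vertices J)"

fun polygonal_path :: "complex list \<Rightarrow> real \<Rightarrow> complex" where
  "polygonal_path [] = linepath 0 0"
| "polygonal_path [a] = linepath a a"
| "polygonal_path [a, b] = linepath a b"
| "polygonal_path (a # b # c # ps) = linepath a b +++ polygonal_path (b # c # ps)"

definition clockwise_vertices :: "complex set \<Rightarrow> complex list \<Rightarrow> bool" where
  "clockwise_vertices J vs \<longleftrightarrow>
     distinct vs \<and> set vs = vertices J \<and>
     (let g = polygonal_path (vs @ [hd vs]) in
        simple_path g \<and> path_image g = J \<and> (\<forall>z\<in>inside J. winding_number g z = -1))"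

text \<open>From here on \<open>vs\<close> lists the vertices clockwise, vertices are referred to by their index in
  \<open>vs\<close>, and edge \<open>i\<close> is the edge traversed from vertex \<open>i\<close> to vertex \<open>nxt vs i\<close>. Its adjacent
  edges are edge \<open>prv vs i\<close> and edge \<open>nxt vs i\<close>.\<close>

definition nxt :: "complex list \<Rightarrow> nat \<Rightarrow> nat" where
  "nxt vs i = (i + 1) mod length vs"

definition prv :: "complex list \<Rightarrow> nat \<Rightarrow> nat" where
  "prv vs i = (i + length vs - 1) mod length vs"

definition vertical :: "complex list \<Rightarrow> nat \<Rightarrow> bool" where
  "vertical vs i \<longleftrightarrow> Re (vs ! i) = Re (vs ! nxt vs i)"

definition horizontal :: "complex list \<Rightarrow> nat \<Rightarrow> bool" where
  "horizontal vs i \<longleftrightarrow> Im (vs ! i) = Im (vs ! nxt vs i)"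

definition downward :: "complex list \<Rightarrow> nat \<Rightarrow> bool" where
  "downward vs i \<longleftrightarrow> vertical vs i \<and> Im (vs ! nxt vs i) < Im (vs ! i)"

definition rightward :: "complex list \<Rightarrow> nat \<Rightarrow> bool" where
  "rightward vs i \<longleftrightarrow> horizontal vs i \<and> Re (vs ! i) < Re (vs ! nxt vs i)"

definition adjacent_extend_left :: "complex list \<Rightarrow> nat \<Rightarrow> bool" where
  "adjacent_extend_left vs i \<longleftrightarrow>
     Re (vs ! prv vs i) < Re (vs ! i) \<and> Re (vs ! nxt vs (nxt vs i)) < Re (vs ! nxt vs i)"

definition adjacent_extend_right :: "complex list \<Rightarrow> nat \<Rightarrow> bool" where
  "adjacent_extend_right vs i \<longleftrightarrow>
     Re (vs ! i) < Re (vs ! prv vs i) \<and> Re (vs ! nxt vs i) < Re (vs ! nxt vs (nxt vs i))"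

definition adjacent_extend_above :: "complex list \<Rightarrow> nat \<Rightarrow> bool" where
  "adjacent_extend_above vs i \<longleftrightarrow>
     Im (vs ! i) < Im (vs ! prv vs i) \<and> Im (vs ! nxt vs i) < Im (vs ! nxt vs (nxt vs i))"

text \<open>The interior near edge \<open>i\<close> lies in direction \<open>d\<close> of it: left, right, below for
  \<open>d\<close> equal to \<open>-1\<close>, \<open>1\<close>, \<open>-\<i>\<close>.\<close>

definition interior_towards :: "complex set \<Rightarrow> complex list \<Rightarrow> nat \<Rightarrow> complex \<Rightarrow> bool" where
  "interior_towards J vs i d \<longleftrightarrow>
     (\<forall>z\<in>open_segment (vs ! i) (vs ! nxt vs i).
        \<exists>\<epsilon>>0. \<forall>t\<in>{0<..<\<epsilon>}. z + of_real t * d \<in> inside J)"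

definition rightmost_edge :: "complex set \<Rightarrow> complex list \<Rightarrow> nat \<Rightarrow> bool" where
  "rightmost_edge J vs i \<longleftrightarrow>
     vertical vs i \<and> adjacent_extend_left vs i \<and> interior_towards J vs i (-1)"

definition left_notch :: "complex set \<Rightarrow> complex list \<Rightarrow> nat \<Rightarrow> bool" where
  "left_notch J vs i \<longleftrightarrow>
     vertical vs i \<and> adjacent_extend_left vs i \<and> interior_towards J vs i 1"

definition leftmost_edge :: "complex set \<Rightarrow> complex list \<Rightarrow> nat \<Rightarrow> bool" where
  "leftmost_edge J vs i \<longleftrightarrow>
     vertical vs i \<and> adjacent_extend_right vs i \<and> interior_towards J vs i 1"

definition right_notch :: "complex set \<Rightarrow> complex list \<Rightarrow> nat \<Rightarrow> bool" where
  "right_notch J vs i \<longleftrightarrow>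
     vertical vs i \<and> adjacent_extend_right vs i \<and> interior_towards J vs i (-1)"

definition top_notch :: "complex set \<Rightarrow> complex list \<Rightarrow> nat \<Rightarrow> bool" where
  "top_notch J vs i \<longleftrightarrow>
     horizontal vs i \<and> adjacent_extend_above vs i \<and> interior_towards J vs i (-\<i>)"

definition falling_corner :: "complex list \<Rightarrow> nat \<Rightarrow> bool" where
  "falling_corner vs i \<longleftrightarrow> downward vs (prv vs i) \<and> rightward vs i"

definition BLS_hole :: "complex set \<Rightarrow> complex set \<Rightarrow> complex list \<Rightarrow> bool" where
  "BLS_hole J H vs \<longleftrightarrow>
     is_hole J H \<and> clockwise_vertices J vs \<and>
     (\<forall>i<length vs. \<not> right_notch J vs i \<and> \<not> top_notch J vs i) \<and>
     card {i. i < length vs \<and> falling_corner vs i} \<le> 1"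

definition canonical_list :: "nat \<Rightarrow> (nat \<Rightarrow> nat) \<Rightarrow> (nat \<Rightarrow> nat) \<Rightarrow> nat \<Rightarrow> nat list" where
  "canonical_list k L N R = L 1 # concat (map (\<lambda>i. [N i, L i]) [2..<Suc k]) @ [R]"

definition canonical_ordering ::
  "complex set \<Rightarrow> complex list \<Rightarrow> nat \<Rightarrow> (nat \<Rightarrow> nat) \<Rightarrow> (nat \<Rightarrow> nat) \<Rightarrow> nat \<Rightarrow> bool" where
  "canonical_ordering J vs k L N R \<longleftrightarrow>
     1 \<le> k \<and>
     {i. i < length vs \<and> rightmost_edge J vs i} = {R} \<and>
     (\<forall>i\<in>{1..k}. leftmost_edge J vs (L i)) \<and>
     (\<forall>i\<in>{2..k}. left_notch J vs (N i)) \<and>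
     canonical_list k L N R =
       filter (\<lambda>i. leftmost_edge J vs i \<or> left_notch J vs i)
         (map (\<lambda>j. (R + j) mod length vs) [1..<length vs]) @ [R]"

definition upper_vertex :: "complex list \<Rightarrow> nat \<Rightarrow> complex" where
  "upper_vertex vs i = (if Im (vs ! i) < Im (vs ! nxt vs i) then vs ! nxt vs i else vs ! i)"

definition first_hit_right :: "complex set \<Rightarrow> complex \<Rightarrow> complex" where
  "first_hit_right J q = Complex (Inf {x. Re q < x \<and> Complex x (Im q) \<in> J}) (Im q)"

definition feasible :: "complex set \<Rightarrow> real \<Rightarrow> real \<Rightarrow> complex \<Rightarrow> bool" where
  "feasible H w h p \<longleftrightarrow>
     {z. Re z \<in> {Re p .. Re p + w} \<and> Im z \<in> {Im p .. Im p + h}} \<subseteq> H"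

definition BL_stable :: "complex set \<Rightarrow> real \<Rightarrow> real \<Rightarrow> complex \<Rightarrow> bool" where
  "BL_stable H w h p \<longleftrightarrow>
     feasible H w h p \<and>
     (\<exists>\<epsilon>>0. \<forall>t\<in>{0<..<\<epsilon>}.
        \<not> feasible H w h (Complex (Re p - t) (Im p)) \<and>
        \<not> feasible H w h (Complex (Re p) (Im p - t)))"

section \<open>Unit-cost integer RAM\<close>

text \<open>Algorithms are programs of a structured language over finitely many integer registers and
  an integer-addressed integer memory. Every constant, register access, addition, subtraction,
  memory access, comparison and control step costs one time unit. There is no multiplication.\<close>

datatype aexp =
    Const int
  | Reg string
  | Plus aexp aexp
  | Minus aexp aexp
  | Mem aexp

datatype bexp =
    Less aexp aexp
  | BNot bexp
  | BAnd bexp bexp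

datatype com =
    Skip
  | Assign string aexp
  | Store aexp aexp
  | Seq com com
  | Cond bexp com com
  | While bexp com

type_synonym state = "(string \<Rightarrow> int) \<times> (int \<Rightarrow> int)"

fun aval :: "aexp \<Rightarrow> state \<Rightarrow> int" where
  "aval (Const n) s = n"
| "aval (Reg x) s = fst s x"
| "aval (Plus a b) s = aval a s + aval b s"
| "aval (Minus a b) s = aval a s - aval b s"
| "aval (Mem a) s = snd s (aval a s)"

fun acost :: "aexp \<Rightarrow> nat" where
  "acost (Const n) = 1"
| "acost (Reg x) = 1"
| "acost (Plus a b) = 1 + acost a + acost b"
| "acost (Minus a b) = 1 + acost a + acost b"
| "acost (Mem a) = 1 + acost a"

fun bval :: "bexp \<Rightarrow> state \<Rightarrow> bool" where
  "bval (Less a b) s \<longleftrightarrow> aval a s < aval b s"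
| "bval (BNot b) s \<longleftrightarrow> \<not> bval b s"
| "bval (BAnd b c) s \<longleftrightarrow> bval b s \<and> bval c s"

fun bcost :: "bexp \<Rightarrow> nat" where
  "bcost (Less a b) = 1 + acost a + acost b"
| "bcost (BNot b) = 1 + bcost b"
| "bcost (BAnd b c) = 1 + bcost b + bcost c"

text \<open>\<open>exec c s t s'\<close>: started in \<open>s\<close>, program \<open>c\<close> terminates in \<open>s'\<close> after exactly \<open>t\<close> time
  units.\<close>

inductive exec :: "com \<Rightarrow> state \<Rightarrow> nat \<Rightarrow> state \<Rightarrow> bool" where
  Skip: "exec Skip s 1 s"
| Assign: "exec (Assign x a) s (1 + acost a) ((fst s)(x := aval a s), snd s)"
| Store: "exec (Store a b) s (1 + acost a + acost b) (fst s, (snd s)(aval a s := aval b s))"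
| Seq: "exec c s t s' \<Longrightarrow> exec d s' t' s'' \<Longrightarrow> exec (Seq c d) s (t + t') s''"
| CondTrue: "bval b s \<Longrightarrow> exec c s t s' \<Longrightarrow> exec (Cond b c d) s (1 + bcost b + t) s'"
| CondFalse: "\<not> bval b s \<Longrightarrow> exec d s t s' \<Longrightarrow> exec (Cond b c d) s (1 + bcost b + t) s'"
| WhileFalse: "\<not> bval b s \<Longrightarrow> exec (While b c) s (1 + bcost b) s"
| WhileTrue: "bval b s \<Longrightarrow> exec c s t s' \<Longrightarrow> exec (While b c) s' t' s'' \<Longrightarrow>
    exec (While b c) s (1 + bcost b + t + t') s''"

section \<open>Input and output\<close>

text \<open>Vertex \<open>i\<close> is a record of four cells (x, y, pointer to predecessor, pointer to successor) at
  address \<open>addr i\<close>; an edge is given by a pointer to the vertex at which its clockwise traversal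
  starts. Register \<open>canon\<close> points to an array of the \<open>2 * k\<close> edge pointers of the canonical
  ordering; \<open>corner\<close> points to the falling corner and is the null pointer 0 if there is none. The
  cells from address \<open>free\<close> upwards are free for use. Nothing is assumed about the contents of all
  other cells and registers.\<close>

definition is_input ::
  "complex list \<Rightarrow> nat \<Rightarrow> (nat \<Rightarrow> nat) \<Rightarrow> (nat \<Rightarrow> nat) \<Rightarrow> nat \<Rightarrow> int \<Rightarrow> int \<Rightarrow> state \<Rightarrow> bool" where
  "is_input vs k L N R w h s \<longleftrightarrow>
     (\<exists>addr :: nat \<Rightarrow> int.
        (\<forall>i<length vs.
           0 < addr i \<and> addr i + 4 \<le> fst s ''free'' \<and>
           real_of_int (snd s (addr i)) = Re (vs ! i) \<and>
           real_of_int (snd s (addr i + 1)) = Im (vs ! i) \<and>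
           snd s (addr i + 2) = addr (prv vs i) \<and>
           snd s (addr i + 3) = addr (nxt vs i)) \<and>
        (\<forall>i<length vs. \<forall>j<length vs. i \<noteq> j \<longrightarrow> addr i + 4 \<le> addr j \<or> addr j + 4 \<le> addr i) \<and>
        fst s ''head'' = addr 0 \<and>
        fst s ''k'' = int k \<and>
        0 < fst s ''canon'' \<and> fst s ''canon'' + 2 * int k \<le> fst s ''free'' \<and>
        (\<forall>i<length vs. addr i + 4 \<le> fst s ''canon'' \<or> fst s ''canon'' + 2 * int k \<le> addr i) \<and>
        (\<forall>j<2 * k. snd s (fst s ''canon'' + int j) = addr (canonical_list k L N R ! j)) \<and>
        (\<forall>i<length vs. falling_corner vs i \<longrightarrow> fst s ''corner'' = addr i) \<and>
        ((\<forall>i<length vs. \<not> falling_corner vs i) \<longrightarrow> fst s ''corner'' = 0) \<and>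
        fst s ''w'' = w \<and> fst s ''h'' = h)"

text \<open>The output is the array of coordinate pairs, \<open>num\<close> many, to which register \<open>out\<close> points.\<close>

definition output_points :: "state \<Rightarrow> complex set" where
  "output_points s =
     (\<lambda>j. Complex (of_int (snd s (fst s ''out'' + 2 * j)))
                  (of_int (snd s (fst s ''out'' + 2 * j + 1)))) ` {0..<fst s ''num''}"

end

theory Submission
  imports Defs
begin

text \<open>
  Traverse the boundary clockwise, starting with the rightmost edge. The absence of right and top
  notches, the uniqueness of the rightmost edge and the bound on falling corners say that between
  two consecutive horizontal edges, at least one of which is directed to the right, the boundary
  goes up; the only exception is a drop just before the last horizontal edge. It follows that every
  horizontal edge runs strictly above all earlier ones over the same column, so in every column the
  leftward edges (floors) and rightward edges (ceilings) alternate in the order of traversal.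

  A rectangle whose left side is above a given floor comes to rest at the maximum of the visible
  floor over the \<open>w\<close> columns to its right. The hypothesis on \<open>QW\<close> ensures that, seen from the left of
  a left notch, the floor to the right of the notch does not contribute to this maximum. A stack
  holds the maximum as a piecewise constant function of the left coordinate; a floor edge pushes one
  piece, and a ceiling edge removes the pieces that it covers. The stable locations are the starts
  of removed pieces that fit under the ceiling and are blocked on the left, which happens where the
  maximum drops or the ceiling rises. Each piece is pushed and removed once, so the time is linear.

  The coordinates are integral, so the hole is a union of unit cells. Whether a cell belongs to it
  is read off from the winding number of the boundary, which counts the vertical edges to the left
  of the cell, or the horizontal edges below it, with signs.
\<close>

section \<open>Stacks of pieces\<close>

text \<open>Two facts make a single stack sufficient. Windows that start at or left of the current
  column see only columns from there on, so their maxima can only grow as the window moves right; a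
  new floor therefore overrides exactly an initial part of the stack. Once a ceiling has started at
  \<open>x k\<close>, every later edge over a column from \<open>x k\<close> on is at least as high,
  except the last edge after a falling corner. Hence the ceiling of the left column and one extra
  bound decide whether the whole rectangle fits. The delicate point is blocking on the left. When a
  piece is created, only the part of column \<open>a - 1\<close> below the profile is known; the
  part above is settled when the ceiling of that column arrives. One bit per piece is enough, but
  its meaning depends on the direction of the edge traversed last. Only starts of pieces have to be
  tested: inside a piece the preceding column has the same maximum, so a rectangle that fits under
  the ceiling can slide left.\<close>

text \<open>An entry \<open>(a, m, b)\<close> describes the piece with value \<open>m\<close> from column \<open>a\<close> up to the start of the
  entry below it; \<open>b\<close> records that a rectangle placed at \<open>(a, m)\<close> is blocked on the left.\<close>

type_synonym entry = "int \<times> int \<times> bool"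

text \<open>\<open>g\<close> decides whether the start of a removed piece is reported;
  \<open>q\<close> is the flag contributed at column \<open>X\<close> by the ceiling just traversed.
  A piece that straddles \<open>X\<close> is treated at its old start and lives on with a new start
  at \<open>X\<close>.\<close>

fun sweep :: "(int \<Rightarrow> int \<Rightarrow> bool \<Rightarrow> bool) \<Rightarrow> (int \<Rightarrow> bool) \<Rightarrow> int \<Rightarrow> entry list \<Rightarrow> entry list \<times> (int \<times> int) list" where
  "sweep g q X [] = ([], [])"
| "sweep g q X [(a, m, b)] = ([(a, m, b \<or> q m)], [])"
| "sweep g q X ((a, m, b) # (a', m', b') # r) =
     (if a < X then
        let os = (if g a m b then [(a, m)] else []) in
        if a' \<le> X then (fst (sweep g q X ((a', m', b') # r)), os @ snd (sweep g q X ((a', m', b') # r)))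
        else ((X, m, q m) # (a', m', b') # r, os)
      else ((a, m, b \<or> q m) # (a', m', b') # r, []))"

text \<open>A floor of height \<open>f\<close> has been added that ends just before column
  \<open>e\<close>. What remains of a dominated piece from \<open>e\<close> on has the end of that
  floor as a wall on its left precisely if the floor is strictly higher.\<close>

fun pop :: "int \<Rightarrow> int \<Rightarrow> entry list \<Rightarrow> entry list" where
  "pop e f ((a, m, b) # (a', m', b') # r) =
     (if m \<le> f then
        if a' \<le> e then pop e f ((a', m', b') # r) else (e, m, m < f) # (a', m', b') # r
      else (a, m, b) # (a', m', b') # r)"
| "pop e f S = S"

text \<open>\<open>P\<close> holds in every column of a piece, \<open>F\<close> at its start. The
  last entry is a sentinel at \<open>E\<close> with arbitrary value and flag, so that every genuine
  piece has an entry below it that bounds it on the right.\<close>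

fun pieces :: "int \<Rightarrow> (int \<Rightarrow> int \<Rightarrow> bool) \<Rightarrow> (int \<Rightarrow> int \<Rightarrow> bool \<Rightarrow> bool) \<Rightarrow> entry list \<Rightarrow> bool" where
  "pieces E P F [] \<longleftrightarrow> False"
| "pieces E P F [(a, m, b)] \<longleftrightarrow> a = E"
| "pieces E P F ((a, m, b) # (a', m', b') # r) \<longleftrightarrow>
     a < a' \<and> (\<forall>X. a \<le> X \<and> X < a' \<longrightarrow> P X m) \<and> F a m b \<and> pieces E P F ((a', m', b') # r)"

abbreviation start :: "entry list \<Rightarrow> int" where "start S \<equiv> fst (hd S)"

lemma pieces_start_le: "pieces E P F S \<Longrightarrow> start S \<le> E"
  by (induction E P F S rule: pieces.induct) auto

lemma pieces_mono:
  assumes "pieces E P F S"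
    and "\<And>X m. start S \<le> X \<Longrightarrow> X < E \<Longrightarrow> P X m \<Longrightarrow> P' X m"
    and "\<And>a m b. start S \<le> a \<Longrightarrow> a < E \<Longrightarrow> F a m b \<Longrightarrow> F' a m b"
  shows "pieces E P' F' S"
  using assms
proof (induction E P F S rule: pieces.induct)
  case (3 E P F a m b a' m' b' r)
  have "a' \<le> E" using 3(2) pieces_start_le by fastforce
  moreover have "pieces E P' F' ((a', m', b') # r)"
    by (rule 3(1)) (use 3(2-4) in auto)
  ultimately show ?case using 3(2-4) by auto
qed auto

lemma pieces_Cons:
  assumes "pieces E P F S" "a < start S" "\<And>X. a \<le> X \<Longrightarrow> X < start S \<Longrightarrow> P X m" "F a m b"
  shows "pieces E P F ((a, m, b) # S)"
  using assms by (cases S) auto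

lemma pieces_mem:
  assumes "pieces E P F S" "(a, m, b) \<in> set S" "a < E"
  shows "P a m \<and> F a m b \<and> start S \<le> a"
  using assms by (induction E P F S rule: pieces.induct) fastforce+

lemma pieces_add: "pieces E P F S \<Longrightarrow> pieces E P (\<lambda>a m b. F a m b \<and> P a m) S"
  by (induction E P F S rule: pieces.induct) auto

lemma pieces_entry:
  assumes "pieces E P F S" "start S \<le> X" "X < E"
  shows "\<exists>a m b. (a, m, b) \<in> set S \<and> start S \<le> a \<and> a \<le> X \<and> (\<forall>X'. a \<le> X' \<and> X' \<le> X \<longrightarrow> P X' m) \<and> F a m b"
  using assms
proof (induction E P F S rule: pieces.induct)
  case (3 E P F a m b a' m' b' r)
  show ?case
  proof (cases "X < a'")
    case True
    then show ?thesis using 3(2,3) by (intro exI[of _ a] exI[of _ m] exI[of _ b]) auto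
  next
    case False
    then obtain a1 m1 b1 where "(a1, m1, b1) \<in> set ((a', m', b') # r)" "a' \<le> a1" "a1 \<le> X"
      "\<forall>X'. a1 \<le> X' \<and> X' \<le> X \<longrightarrow> P X' m1" "F a1 m1 b1"
      using 3 by auto
    then show ?thesis using 3(2) by (intro exI[of _ a1] exI[of _ m1] exI[of _ b1]) auto
  qed
qed auto

text \<open>A piece found at \<open>X\<close> after the sweep either started there before or was cut
  there. In the second case its value is also attained in column \<open>X - 1\<close>, from which it
  follows later that the cells to its left are free up to the ceiling.\<close>

definition swept ::
  "(int \<Rightarrow> int \<Rightarrow> bool) \<Rightarrow> (int \<Rightarrow> int \<Rightarrow> bool \<Rightarrow> bool) \<Rightarrow> (int \<Rightarrow> bool) \<Rightarrow> int \<Rightarrow> int \<Rightarrow> int \<Rightarrow> int \<Rightarrow> bool \<Rightarrow> bool" where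
  "swept P F q X a0 a m b \<longleftrightarrow>
     (if a = X then \<exists>b0. b = (b0 \<or> q m) \<and> (F X m b0 \<or> \<not> b0 \<and> P (X - 1) m \<and> a0 < X) else F a m b)"

lemma sweep_pieces:
  assumes "pieces E P F S" "start S \<le> X" "X < E"
  shows "pieces E P (swept P F q X (start S)) (fst (sweep g q X S))" and "start (fst (sweep g q X S)) = X"
proof -
  have "pieces E P (swept P F q X (start S)) (fst (sweep g q X S)) \<and> start (fst (sweep g q X S)) = X"
    using assms
  proof (induction g q X S rule: sweep.induct)
    case (3 g q X a m b a' m' b' r)
    have tail: "pieces E P F ((a', m', b') # r)" and aa': "a < a'"
      and PP: "\<And>X. a \<le> X \<Longrightarrow> X < a' \<Longrightarrow> P X m" and Fa: "F a m b"
      using "3.prems"(1) by auto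
    consider "\<not> a < X" | "a < X" "a' \<le> X" | "a < X" "X < a'" by linarith
    then show ?case
    proof cases
      case 1
      then have X: "X = a" using "3.prems"(2) by simp
      have "pieces E P (swept P F q X a) ((a, m, b \<or> q m) # (a', m', b') # r)"
      proof (rule pieces_Cons)
        show "pieces E P (swept P F q X a) ((a', m', b') # r)"
          by (rule pieces_mono[OF tail]) (use X aa' in \<open>auto simp: swept_def\<close>)
      qed (use X PP Fa aa' in \<open>auto simp: swept_def\<close>)
      then show ?thesis using X by simp
    next
      case 2
      have IH: "pieces E P (swept P F q X a') (fst (sweep g q X ((a', m', b') # r))) \<and> start (fst (sweep g q X ((a', m', b') # r))) = X"
        using "3.IH"(1)[OF 2(1) refl 2(2) tail] "3.prems"(3) 2 by simp
      have "pieces E P (swept P F q X a) (fst (sweep g q X ((a', m', b') # r)))"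
        by (rule pieces_mono[OF conjunct1[OF IH]]) (use 2 in \<open>auto simp: swept_def split: if_splits\<close>)
      then show ?thesis using 2 IH by (simp add: Let_def)
    next
      case 3
      have "pieces E P (swept P F q X a) ((X, m, q m) # (a', m', b') # r)"
      proof (rule pieces_Cons)
        show "pieces E P (swept P F q X a) ((a', m', b') # r)"
          by (rule pieces_mono[OF tail]) (use 3 in \<open>auto simp: swept_def\<close>)
      qed (use 3 PP in \<open>auto simp: swept_def\<close>)
      then show ?thesis using 3 by (simp add: Let_def)
    qed
  qed auto
  then show "pieces E P (swept P F q X (start S)) (fst (sweep g q X S))" "start (fst (sweep g q X S)) = X" by auto
qed

lemma sweep_out:
  assumes "pieces E P F S" "X < E"
  shows "set (snd (sweep g q X S)) = {(a, m). a < X \<and> (\<exists>b. (a, m, b) \<in> set S \<and> g a m b)}"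
  using assms
proof (induction g q X S rule: sweep.induct)
  case (3 g q X a m b a' m' b' r)
  have tail: "pieces E P F ((a', m', b') # r)" and aa': "a < a'" using "3.prems"(1) by auto
  have ge: "a' \<le> a1" if "(a1, m1, b1) \<in> set ((a', m', b') # r)" for a1 m1 b1
  proof (cases "a1 < E")
    case True
    then show ?thesis using pieces_mem[OF tail that] by simp
  next
    case False
    then show ?thesis using pieces_start_le[OF tail] by simp
  qed
  show ?case
  proof (cases "a < X")
    case aX: True
    show ?thesis
    proof (cases "a' \<le> X")
      case True
      have IH: "set (snd (sweep g q X ((a', m', b') # r))) =
          {(a, m). a < X \<and> (\<exists>b. (a, m, b) \<in> set ((a', m', b') # r) \<and> g a m b)}"
        by (rule "3.IH"(1)[OF aX refl True tail "3.prems"(2)])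
      have "snd (sweep g q X ((a, m, b) # (a', m', b') # r)) =
          (if g a m b then [(a, m)] else []) @ snd (sweep g q X ((a', m', b') # r))"
        using aX True by (simp add: Let_def)
      then have "set (snd (sweep g q X ((a, m, b) # (a', m', b') # r))) =
          (if g a m b then {(a, m)} else {}) \<union> set (snd (sweep g q X ((a', m', b') # r)))"
        by simp
      then show ?thesis unfolding IH using aX by auto
    next
      case False
      then have "\<not> a1 < X" if "(a1, m1, b1) \<in> set ((a', m', b') # r)" for a1 m1 b1
        using ge[OF that] by simp
      then show ?thesis using aX False by (auto simp: Let_def)
    qed
  next
    case False
    then have "\<not> a1 < X" if "(a1, m1, b1) \<in> set ((a', m', b') # r)" for a1 m1 b1
      using ge[OF that] aa' by simp
    then show ?thesis using False by auto
  qed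
qed auto

text \<open>The disjunction separates the two ways of stopping: at a piece higher than
  \<open>f\<close>, with all flags kept, or at column \<open>e\<close>, where the flag is rewritten.
  The bound on the removed columns is what allows the new floor to become their window
  maximum.\<close>

lemma pop_pieces:
  assumes "pieces E P F S" "start S \<le> e" "e < E"
  shows "\<exists>a1 m1 b1 r. pop e f S = (a1, m1, b1) # r \<and> start S \<le> a1 \<and> a1 \<le> e \<and> P a1 m1 \<and>
    (\<forall>X. start S \<le> X \<and> X < a1 \<longrightarrow> (\<exists>m. P X m \<and> m \<le> f)) \<and>
    (f < m1 \<and> pieces E P F (pop e f S) \<or>
     a1 = e \<and> m1 \<le> f \<and> pieces E P (\<lambda>a m b. if a = e then b = (m < f) \<and> m \<le> f else a > e \<and> F a m b) (pop e f S))"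
  using assms
proof (induction e f S rule: pop.induct)
  case (1 e f a m b a' m' b' r)
  have tail: "pieces E P F ((a', m', b') # r)" and aa': "a < a'"
    and PP: "\<And>X. a \<le> X \<Longrightarrow> X < a' \<Longrightarrow> P X m" and Fa: "F a m b"
    using 1(2) by auto
  consider "f < m" | "m \<le> f" "a' \<le> e" | "m \<le> f" "e < a'" by linarith
  then show ?case
  proof cases
    case 1
    then show ?thesis using \<open>pieces E P F ((a, m, b) # (a', m', b') # r)\<close> \<open>start ((a, m, b) # (a', m', b') # r) \<le> e\<close> PP aa' by auto
  next
    case 2
    obtain a1 m1 b1 r1 where *: "pop e f ((a', m', b') # r) = (a1, m1, b1) # r1" "a' \<le> a1" "a1 \<le> e" "P a1 m1"
      "\<forall>X. a' \<le> X \<and> X < a1 \<longrightarrow> (\<exists>m. P X m \<and> m \<le> f)"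
      "(f < m1 \<and> pieces E P F (pop e f ((a', m', b') # r)) \<or>
     a1 = e \<and> m1 \<le> f \<and> pieces E P (\<lambda>a m b. if a = e then b = (m < f) \<and> m \<le> f else a > e \<and> F a m b) (pop e f ((a', m', b') # r)))"
      using 1(1)[OF 2 tail] 1(4) 2 by auto
    have "\<exists>m. P X m \<and> m \<le> f" if "a \<le> X" "X < a1" for X
      using that PP[of X] *(5) 2 by (cases "X < a'") auto
    then show ?thesis using * 2 aa' by simp
  next
    case 3
    have "pieces E P (\<lambda>a m b. if a = e then b = (m < f) \<and> m \<le> f else a > e \<and> F a m b) ((e, m, m < f) # (a', m', b') # r)"
    proof (rule pieces_Cons)
      show "pieces E P (\<lambda>a m b. if a = e then b = (m < f) \<and> m \<le> f else a > e \<and> F a m b) ((a', m', b') # r)"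
        by (rule pieces_mono[OF tail]) (use 3 in auto)
    qed (use 3 1(3) PP in auto)
    then show ?thesis using 3 1(3) by (auto intro!: exI[of _ m] PP)
  qed
qed auto


text \<open>\<open>xD\<close> is the column of the falling corner and \<open>yD\<close> the height
  of the ceiling behind it: a rectangle that reaches beyond the corner has to stay below that
  ceiling.\<close>

definition fits :: "int \<Rightarrow> int \<Rightarrow> int \<Rightarrow> int \<Rightarrow> int \<Rightarrow> int \<Rightarrow> int \<Rightarrow> bool \<Rightarrow> bool" where
  "fits w h xD yD c a m b \<longleftrightarrow> b \<and> m + h \<le> c \<and> (a + w \<le> xD \<or> m + h \<le> yD)"

text \<open>The test \<open>c < m + h\<close> says that the ceiling to the left of \<open>X\<close>
  is too low for the rectangle, which is then blocked on the left if the next ceiling is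
  higher.\<close>

abbreviation advance where
  "advance w h xD yD c X S \<equiv> sweep (fits w h xD yD c) (\<lambda>m. c < m + h) X S"

text \<open>Columns before \<open>c\<close> are left out: with \<open>c = x k\<close> the profile
  shows ceilings there, on which nothing can rest.\<close>

definition window_max :: "int \<Rightarrow> (int \<Rightarrow> int) \<Rightarrow> int \<Rightarrow> int \<Rightarrow> int \<Rightarrow> bool" where
  "window_max w t c X m \<longleftrightarrow> (\<forall>X'. max X c \<le> X' \<and> X' < X + w \<longrightarrow> t X' \<le> m) \<and>
     (\<exists>X'. max X c \<le> X' \<and> X' < X + w \<and> t X' = m)"

definition prev_height :: "nat \<Rightarrow> (nat \<Rightarrow> int) \<Rightarrow> nat \<Rightarrow> int" where
  "prev_height m y k = (if k = 0 then y (m - 1) else y (k - 1))"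

definition covers :: "(nat \<Rightarrow> int) \<Rightarrow> nat \<Rightarrow> int \<Rightarrow> bool" where
  "covers x k X \<longleftrightarrow> min (x k) (x (Suc k)) \<le> X \<and> X < max (x k) (x (Suc k))"

section \<open>Boundary chains\<close>

text \<open>The vertical edge \<open>k\<close> lies at \<open>x k\<close> and leads from height \<open>y (k - 1)\<close> to \<open>y k\<close>, the horizontal
  edge \<open>k\<close> lies at height \<open>y k\<close> and leads from \<open>x k\<close> to \<open>x (k + 1)\<close>; vertical edge 0 is the
  rightmost edge, and \<open>H X Y\<close> tells whether the unit cell with lower left corner \<open>(X, Y)\<close> lies in
  the hole. The letters \<open>L\<close> and \<open>R\<close> are the directions of the horizontal edges \<open>k - 1\<close> and \<open>k\<close>. The
  falling corner is at \<open>x (m - 1)\<close>, if there is one; otherwise \<open>xD\<close> is set to \<open>x 0\<close>, so that the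
  bound \<open>y (m - 1)\<close> never takes effect within the hole.\<close>

locale boundary_chain =
  fixes m :: nat and x y :: "nat \<Rightarrow> int" and H :: "int \<Rightarrow> int \<Rightarrow> bool" and w h xD :: int
  assumes m2: "2 \<le> m" and w0: "0 < w" and h0: "0 < h"
    and x_close: "x m = x 0"
    and x_max: "\<And>k. 0 < k \<Longrightarrow> k < m \<Longrightarrow> x k < x 0"
    and x_ne: "\<And>k. k < m \<Longrightarrow> x k \<noteq> x (Suc k)"
    and y_top: "y 0 < y (m - 1)"
    and LR: "\<And>k. 0 < k \<Longrightarrow> k < m \<Longrightarrow> x k < x (k - 1) \<Longrightarrow> x k < x (Suc k) \<Longrightarrow> y (k - 1) < y k"
    and RL: "\<And>k. 0 < k \<Longrightarrow> k < m \<Longrightarrow> x (k - 1) < x k \<Longrightarrow> x (Suc k) < x k \<Longrightarrow> y (k - 1) < y k"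
    and RR: "\<And>k. 0 < k \<Longrightarrow> Suc k < m \<Longrightarrow> x (k - 1) < x k \<Longrightarrow> x k < x (Suc k) \<Longrightarrow> y (k - 1) < y k"
    and xD: "xD = (if y (m - 1) < y (m - 2) then x (m - 1) else x 0)"
    and y_ne: "y (m - 1) \<noteq> y (m - 2)"
    and horizontals_disjoint: "\<And>k l X. k < m \<Longrightarrow> l < m \<Longrightarrow> k \<noteq> l \<Longrightarrow> min (x k) (x (Suc k)) \<le> X \<Longrightarrow> X \<le> max (x k) (x (Suc k)) \<Longrightarrow>
        min (x l) (x (Suc l)) \<le> X \<Longrightarrow> X \<le> max (x l) (x (Suc l)) \<Longrightarrow> y k \<noteq> y l"
    and vertical_horizontal_disjoint: "\<And>k l. k < m \<Longrightarrow> l < m \<Longrightarrow> k \<noteq> l \<Longrightarrow> l \<noteq> Suc k \<Longrightarrow> l \<noteq> 0 \<or> k \<noteq> m - 1 \<Longrightarrow>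
        min (x k) (x (Suc k)) \<le> x l \<Longrightarrow> x l \<le> max (x k) (x (Suc k)) \<Longrightarrow>
        min (prev_height m y l) (y l) \<le> y k \<Longrightarrow> y k \<le> max (prev_height m y l) (y l) \<Longrightarrow> False"
    and QW: "\<And>k l. 0 < k \<Longrightarrow> k < m \<Longrightarrow> x (k - 1) < x k \<Longrightarrow> x (Suc k) < x k \<Longrightarrow> l < m \<Longrightarrow>
        x k < x l \<Longrightarrow> x l < x k + w \<Longrightarrow> min (prev_height m y l) (y l) \<le> y k \<Longrightarrow> y k \<le> max (prev_height m y l) (y l) \<Longrightarrow> False"
    and H_left: "\<And>k X. k < m \<Longrightarrow> x (Suc k) \<le> X \<Longrightarrow> X < x k \<Longrightarrow> H X (y k) \<and> \<not> H X (y k - 1)"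
    and H_right: "\<And>k X. k < m \<Longrightarrow> x k \<le> X \<Longrightarrow> X < x (Suc k) \<Longrightarrow> \<not> H X (y k) \<and> H X (y k - 1)"
    and H_vert: "\<And>k Y. k < m \<Longrightarrow> min (prev_height m y k) (y k) \<le> Y \<Longrightarrow> Y < max (prev_height m y k) (y k) \<Longrightarrow>
        H (x k) Y = (prev_height m y k < y k) \<and> H (x k - 1) Y = (y k < prev_height m y k)"
    and H_same: "\<And>X Y. (\<And>k. k < m \<Longrightarrow> covers x k X \<Longrightarrow> y k \<noteq> Y) \<Longrightarrow> H X Y = H X (Y - 1)"
    and H_bounded: "\<exists>C. \<forall>X Y. H X Y \<longrightarrow> \<bar>Y\<bar> < C"
begin

abbreviation "yp \<equiv> prev_height m y"
abbreviation "cov \<equiv> covers x"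

lemmas yp_def = prev_height_def
lemmas cov_def = covers_def

section \<open>The profile of the traversed boundary\<close>

definition B :: int where "B = Min (y ` {..<m}) - 1"

lemma B_less: "k < m \<Longrightarrow> B < y k"
proof -
  assume "k < m"
  then have "Min (y ` {..<m}) \<le> y k" by (intro Min_le) auto
  then show ?thesis by (simp add: B_def)
qed

text \<open>The height of the last of the first \<open>k\<close> horizontal edges over column \<open>X\<close>, where \<open>B\<close> stands for
  minus infinity. To the right of the rightmost edge the profile is its upper end: no rectangle
  can rest there without violating the bound \<open>y (m - 1)\<close>.\<close>

primrec T :: "nat \<Rightarrow> int \<Rightarrow> int" where
  "T 0 X = (if x 0 \<le> X then y (m - 1) else B)"
| "T (Suc k) X = (if cov k X then y k else T k X)"

definition lft where "lft k \<longleftrightarrow> x (Suc k) < x k"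

lemma not_lft: "k < m \<Longrightarrow> \<not> lft k \<longleftrightarrow> x k < x (Suc k)"
  using x_ne[of k] by (auto simp: lft_def)

lemma cov_lft: "lft k \<Longrightarrow> cov k X \<longleftrightarrow> x (Suc k) \<le> X \<and> X < x k"
  by (auto simp: cov_def lft_def)

lemma cov_rgt: "k < m \<Longrightarrow> \<not> lft k \<Longrightarrow> cov k X \<longleftrightarrow> x k \<le> X \<and> X < x (Suc k)"
  by (auto simp: cov_def lft_def)

lemma x_le: "k \<le> m \<Longrightarrow> x k \<le> x 0"
  using x_max[of k] x_close by (cases "k = 0"; cases "k = m") auto

lemma cov_less: "k < m \<Longrightarrow> cov k X \<Longrightarrow> X < x 0"
  using x_le[of k] x_le[of "Suc k"] by (auto simp: cov_def)

lemma T_right: "k \<le> m \<Longrightarrow> x 0 \<le> X \<Longrightarrow> T k X = y (m - 1)"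
proof (induction k)
  case (Suc k)
  then show ?case using cov_less[of k X] by auto
qed simp

lemma lft_0: "lft 0"
  using x_max[of 1] m2 by (simp add: lft_def)

lemma rgt_last: "\<not> lft (m - 1)"
  using x_max[of "m - 1"] m2 x_close by (simp add: lft_def)

text \<open>When the traversal has reached \<open>x k\<close>, the profile to its left consists of ceilings and is
  monotone; to its right it consists of floors, and its upward jumps are filled by vertical edges.\<close>

definition Inv :: "nat \<Rightarrow> bool" where
  "Inv k \<longleftrightarrow>
    (\<forall>X X'. X \<le> X' \<longrightarrow> X' < x k \<longrightarrow> T k X \<le> T k X') \<and>
    (lft (k - 1) \<longrightarrow> T k (x k - 1) < T k (x k)) \<and>
    (\<forall>X Y. (x k < X \<or> \<not> lft (k - 1) \<and> X = x k) \<longrightarrow> X \<le> x 0 \<longrightarrow> T k (X - 1) \<le> Y \<longrightarrow> Y < T k X \<longrightarrow>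
       (\<exists>l<k. x l = X \<and> min (yp l) (y l) \<le> Y \<and> Y < max (yp l) (y l))) \<and>
    (\<forall>X. x k \<le> X \<longrightarrow> X < x 0 \<longrightarrow> (\<exists>l<k. lft l \<and> cov l X \<and> y l = T k X)) \<and>
    (\<forall>X. X < x k \<longrightarrow> T k X \<noteq> B \<longrightarrow> (\<exists>l<k. \<not> lft l \<and> cov l X \<and> y l = T k X))"

lemma Inv_mono: "Inv k \<Longrightarrow> X \<le> X' \<Longrightarrow> X' < x k \<Longrightarrow> T k X \<le> T k X'"
  and Inv_step: "Inv k \<Longrightarrow> lft (k - 1) \<Longrightarrow> T k (x k - 1) < T k (x k)"
  and Inv_wall: "Inv k \<Longrightarrow> x k < X \<or> \<not> lft (k - 1) \<and> X = x k \<Longrightarrow> X \<le> x 0 \<Longrightarrow> T k (X - 1) \<le> Y \<Longrightarrow> Y < T k X \<Longrightarrow>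
       \<exists>l<k. x l = X \<and> min (yp l) (y l) \<le> Y \<and> Y < max (yp l) (y l)"
  and Inv_floor: "Inv k \<Longrightarrow> x k \<le> X \<Longrightarrow> X < x 0 \<Longrightarrow> \<exists>l<k. lft l \<and> cov l X \<and> y l = T k X"
  and Inv_ceiling: "Inv k \<Longrightarrow> X < x k \<Longrightarrow> T k X \<noteq> B \<Longrightarrow> \<exists>l<k. \<not> lft l \<and> cov l X \<and> y l = T k X"
  unfolding Inv_def by blast+

lemma T_last:
  assumes "0 < k" "k < m"
  shows "lft (k - 1) \<Longrightarrow> T k (x k) = y (k - 1)" and "\<not> lft (k - 1) \<Longrightarrow> T k (x k - 1) = y (k - 1)"
  using assms by (cases k; auto simp: cov_def lft_def not_lft[unfolded lft_def] x_ne)+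

text \<open>A floor beyond the right end of a ceiling that were not lower would lead to an
  intersection: a higher one makes an upward jump of the profile, filled by a vertical edge through
  the end point of the ceiling, and an equally high one contains that end point.\<close>

lemma T_cur_less:
  assumes "Inv k" "0 < k" "k < m" "\<not> lft (k - 1)"
  shows "T k (x k) < y (k - 1)"
proof (rule ccontr)
  assume "\<not> ?thesis"
  then consider "y (k - 1) < T k (x k)" | "T k (x k) = y (k - 1)" by linarith
  then show False
  proof cases
    case 1
    have "T k (x k - 1) = y (k - 1)" using T_last assms by simp
    then obtain l where l: "l < k" "x l = x k" "min (yp l) (y l) \<le> y (k - 1)" "y (k - 1) < max (yp l) (y l)"
      using Inv_wall[OF assms(1), of "x k" "y (k - 1)"] assms x_le[of k] 1 by auto
    have "l \<noteq> k - 1" using l(2) x_ne[of "k - 1"] assms by auto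
    moreover have "x (k - 1) < x k" using assms not_lft[of "k - 1"] by simp
    moreover have "k - 1 < m" "k - 1 \<noteq> m - 1" "l \<noteq> Suc (k - 1)" using l assms by auto
    ultimately show False
      using vertical_horizontal_disjoint[of "k - 1" l] l assms(2,3) by auto
  next
    case 2
    obtain l where l: "l < k" "lft l" "cov l (x k)" "y l = T k (x k)"
      using Inv_floor[OF assms(1), of "x k"] x_max[of k] assms by auto
    have "l \<noteq> k - 1" using l assms by auto
    moreover have "x (k - 1) < x k" using assms not_lft[of "k - 1"] by simp
    moreover have "k - 1 < m" using assms by simp
    ultimately show False using horizontals_disjoint[of "k - 1" l "x k"] l 2 assms by (auto simp: cov_def)
  qed
qed

text \<open>Upward jumps of the floor profile are filled by vertical edges, so it can reach height
  \<open>c\<close> only where a vertical edge meets that height.\<close>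

lemma T_less_along:
  assumes "Inv k" "0 < k" "k < m" "T k a < c" "x k \<le> a" "a \<le> X" "X < e"
    and no: "\<And>l. l < k \<Longrightarrow> a < x l \<Longrightarrow> x l < e \<Longrightarrow> min (yp l) (y l) \<le> c \<Longrightarrow> c \<le> max (yp l) (y l) \<Longrightarrow> False"
  shows "T k X < c"
  using assms(6,7)
proof (induction X rule: int_ge_induct)
  case base
  then show ?case using assms by simp
next
  case (step X)
  show ?case
  proof (rule ccontr)
    assume *: "\<not> T k (X + 1) < c"
    show False
    proof (cases "X + 1 \<le> x 0")
      case True
      \<comment> \<open>The jump leads from at most \<open>c - 1\<close> to at least
        \<open>c\<close>, so the vertical edge contains the unit interval above \<open>c - 1\<close>
        and meets height \<open>c\<close>.\<close>
      obtain l where "l < k" "x l = X + 1" "min (yp l) (y l) \<le> c - 1" "c - 1 < max (yp l) (y l)"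
        using Inv_wall[OF assms(1), of "X + 1" "c - 1"] step True * assms(5) by auto
      then show False using no[of l] step by auto
    next
      case False
      then show False using T_right[of k X] T_right[of k "X + 1"] * step assms by auto
    qed
  qed
qed

lemma below_right:
  assumes "Inv k" "0 < k" "k < m" "\<not> lft k" "y (k - 1) < y k" "X < x k"
  shows "T k X \<le> y k"
proof -
  have "T k X \<le> T k (x k - 1)" using Inv_mono[OF assms(1), of X "x k - 1"] assms(6) by simp
  also have "\<dots> \<le> y (k - 1)"
    using T_last[of k] assms Inv_step[OF assms(1)] by (cases "lft (k - 1)") auto
  finally show ?thesis using assms(5) by simp
qed

lemma turn_up:
  assumes "0 < k" "k < m" "\<not> (lft (k - 1) \<and> lft k)" "k = m - 1 \<Longrightarrow> y (m - 2) < y (m - 1)"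
  shows "y (k - 1) < y k"
proof -
  have "Suc k < m \<or> k = m - 1" "k - 1 < m" using assms by auto
  then show ?thesis
    using assms LR[of k] RL[of k] RR[of k] not_lft[of k] not_lft[of "k - 1"]
    by (auto simp: lft_def numeral_2_eq_2)
qed

text \<open>Monotonicity to the left reduces a leftward edge to column \<open>x k - 1\<close>, and
  \<open>T_less_along\<close> reduces a rightward edge to column \<open>x k\<close>. In that column
  either the turn goes up, or vertical edge \<open>k\<close> descends and a violation would make it
  cross an earlier ceiling or floor.\<close>

lemma T_less_Inv:
  assumes "Inv k" "0 < k" "k < m" "cov k X"
  shows "T k X < y k"
proof (cases "lft k")
  case True
  then have X: "x (Suc k) \<le> X" "X < x k" using assms cov_lft by auto
  have "T k (x k - 1) < y k"
  proof (cases "lft (k - 1)")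
    case L: True
    show ?thesis
    proof (rule ccontr)
      assume *: "\<not> ?thesis"
      have "T k (x k - 1) \<noteq> B" using * B_less[OF assms(3)] by simp
      then obtain l where l: "l < k" "\<not> lft l" "cov l (x k - 1)" "y l = T k (x k - 1)"
        using Inv_ceiling[OF assms(1), of "x k - 1"] by auto
      have "T k (x k - 1) < y (k - 1)"
        using Inv_step[OF assms(1) L] T_last[of k] L assms by simp
      moreover have "l \<noteq> k - 1" "k \<noteq> Suc l" using l L by auto
      ultimately show False
        using vertical_horizontal_disjoint[of l k] l * assms by (auto simp: cov_def yp_def)
    qed
  next
    case False
    then show ?thesis using turn_up[of k] T_last[of k] assms True rgt_last by auto
  qed
  then show ?thesis using Inv_mono[OF assms(1), of X "x k - 1"] X by simp
next
  case False
  then have X: "x k \<le> X" "X < x (Suc k)" using assms cov_rgt by auto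
  have "T k (x k) < y k"
  proof (cases "k = m - 1 \<and> y (m - 1) < y (m - 2)")
    case fall: True
    then have y: "y k < y (k - 1)" using m2 by (auto simp: numeral_2_eq_2)
    have nl: "\<not> lft (k - 1)"
      using LR[of k] False y assms not_lft[of k] by (auto simp: lft_def)
    show ?thesis
    proof (rule ccontr)
      assume *: "\<not> ?thesis"
      obtain l where l: "l < k" "lft l" "cov l (x k)" "y l = T k (x k)"
        using Inv_floor[OF assms(1), of "x k"] x_max[of k] assms by auto
      have "l \<noteq> k - 1" "k \<noteq> Suc l" using l nl by auto
      then show False
        using vertical_horizontal_disjoint[of l k] l * assms T_cur_less[OF assms(1-3) nl] by (auto simp: cov_def yp_def)
    qed
  next
    case nofall: False
    then have "y (k - 1) < y k"
      using turn_up[of k] False assms y_ne by auto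
    then show ?thesis
      using T_last[of k] T_cur_less[OF assms(1-3)] assms by (cases "lft (k - 1)") auto
  qed
  then show ?thesis
  proof (rule T_less_along[OF assms(1-3), where e = "x (Suc k)"])
    fix l assume l: "l < k" "x k < x l" "x l < x (Suc k)" "min (yp l) (y l) \<le> y k" "y k \<le> max (yp l) (y l)"
    have "x l < x 0" using l x_le[of "Suc k"] assms by simp
    then have "l \<noteq> 0" by (intro notI) simp
    then show False using vertical_horizontal_disjoint[of k l] l assms by auto
  qed (use X in auto)
qed

lemma Inv_1: "Inv 1"
proof -
  have x1: "x 1 < x 0" using lft_0 by (simp add: lft_def)
  have T1: "T 1 X = (if x 0 \<le> X then y (m - 1) else if x 1 \<le> X then y 0 else B)" for X
    using x1 by (auto simp: cov_def)
  show ?thesis unfolding Inv_def T1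
    using x1 B_less[of 0] m2 lft_0 y_top by (auto simp: cov_def yp_def split: if_splits)
qed

text \<open>The critical new jump is the one at the right end \<open>x k\<close> of a new floor.
  After a floor it is filled by vertical edge \<open>k\<close>; after a ceiling the turn goes up, so
  the jump is part of one that was there before.\<close>

lemma Inv_Suc:
  assumes "Inv k" "0 < k" "Suc k < m"
  shows "Inv (Suc k)"
proof -
  have km: "k < m" using assms by simp
  note below = T_less_Inv[OF assms(1,2) km]
  have up: "\<not> lft k \<Longrightarrow> y (k - 1) < y k" using turn_up[of k] assms by auto
  have 1: "T (Suc k) X \<le> T (Suc k) X'" if "X \<le> X'" "X' < x (Suc k)" for X X'
  proof (cases "lft k")
    case True
    then show ?thesis using that Inv_mono[OF assms(1), of X X'] by (auto simp: cov_lft) (auto simp: lft_def)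
  next
    case False
    then show ?thesis using that Inv_mono[OF assms(1), of X X'] below_right[OF assms(1,2) km False up, of X]
      by (auto simp: cov_rgt[OF km] not_lft[OF km])
  qed
  have 2: "T (Suc k) (x (Suc k) - 1) < T (Suc k) (x (Suc k))" if "lft k"
  proof -
    have c: "cov k (x (Suc k))" "\<not> cov k (x (Suc k) - 1)" using that by (auto simp: cov_lft) (auto simp: lft_def)
    have "T k (x (Suc k) - 1) \<le> T k (x (Suc k))"
      using Inv_mono[OF assms(1)] that by (simp add: lft_def)
    then show ?thesis using c below[of "x (Suc k)"] by simp
  qed
  have 3: "\<exists>l<Suc k. x l = X \<and> min (yp l) (y l) \<le> Y \<and> Y < max (yp l) (y l)"
    if X: "x (Suc k) < X \<or> \<not> lft k \<and> X = x (Suc k)" "X \<le> x 0" and Y: "T (Suc k) (X - 1) \<le> Y" "Y < T (Suc k) X" for X Y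
  proof -
    have old: ?thesis if "x k < X \<or> \<not> lft (k - 1) \<and> X = x k" "T k (X - 1) \<le> Y" "Y < T k X"
      using Inv_wall[OF assms(1) that(1) X(2) that(2,3)] less_Suc_eq by auto
    show ?thesis
    proof (cases "lft k")
      case True
      consider "x k < X" | "X = x k" | "X < x k" by linarith
      then show ?thesis
      proof cases
        case 1
        then show ?thesis using old Y True by (auto simp: cov_lft)
      next
        case 2
        have TY: "y k \<le> Y" "Y < T k (x k)" using Y 2 True by (auto simp: cov_lft) (auto simp: lft_def)
        show ?thesis
        proof (cases "lft (k - 1)")
          case L: True
          then have "T k (x k) = y (k - 1)" using T_last assms by auto
          then show ?thesis using TY 2 assms by (intro exI[of _ k]) (auto simp: yp_def)
        next
          case False
          then have "T k (x k - 1) = y (k - 1)" "y (k - 1) < y k" using T_last[of k] turn_up[of k] assms by auto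
          then show ?thesis using old TY 2 False by auto
        qed
      next
        case 3
        then have "cov k X" "cov k (X - 1)" using X True by (auto simp: cov_lft)
        then show ?thesis using Y by auto
      qed
    next
      case False
      have "x k < X" "\<not> cov k X" using X False not_lft[OF km] by (auto simp: cov_rgt[OF km])
      moreover have "T k (X - 1) \<le> T (Suc k) (X - 1)" using below[of "X - 1"] by auto
      ultimately show ?thesis using old Y by auto
    qed
  qed
  have 4: "\<exists>l<Suc k. lft l \<and> cov l X \<and> y l = T (Suc k) X" if "x (Suc k) \<le> X" "X < x 0" for X
  proof (cases "cov k X")
    case True
    then have "lft k" using that cov_rgt[OF km] by force
    then show ?thesis using True by (intro exI[of _ k]) auto
  next
    case False
    have "x k \<le> X" using that False cov_lft[of k X] not_lft[OF km] by force
    then show ?thesis using Inv_floor[OF assms(1) _ that(2)] False less_Suc_eq by auto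
  qed
  have 5: "\<exists>l<Suc k. \<not> lft l \<and> cov l X \<and> y l = T (Suc k) X" if "X < x (Suc k)" "T (Suc k) X \<noteq> B" for X
  proof (cases "cov k X")
    case True
    then have "\<not> lft k" using that cov_lft[of k X] by force
    then show ?thesis using True by (intro exI[of _ k]) auto
  next
    case False
    have "X < x k" using that False cov_rgt[OF km, of X] by (cases "lft k") (force simp: lft_def)+
    moreover have "T k X \<noteq> B" using that False by simp
    ultimately obtain l where "l < k" "\<not> lft l" "cov l X" "y l = T k X"
      using Inv_ceiling[OF assms(1)] by blast
    then show ?thesis using False by (intro exI[of _ l]) auto
  qed
  show ?thesis unfolding Inv_def using 1 2 3 4 5 by simp
qed

lemma Inv: "0 < k \<Longrightarrow> k < m \<Longrightarrow> Inv k"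
proof (induction k)
  case (Suc k)
  then show ?case using Inv_1 Inv_Suc[of k] by (cases "k = 0") auto
qed simp

lemma T_less: "k < m \<Longrightarrow> cov k X \<Longrightarrow> T k X < y k"
  using T_less_Inv[OF Inv] B_less[of 0] cov_less[of 0 X] by (cases "k = 0") auto

lemma T_incr: "k \<le> l \<Longrightarrow> l \<le> m \<Longrightarrow> T k X \<le> T l X"
proof (induction l rule: dec_induct)
  case (step l)
  then show ?case using T_less[of l X] by auto
qed simp

lemma earlier_le: "k < l \<Longrightarrow> l \<le> m \<Longrightarrow> cov k X \<Longrightarrow> y k \<le> T l X"
  using T_incr[of "Suc k" l X] by auto

lemma later_gt: "k < l \<Longrightarrow> l < m \<Longrightarrow> cov k X \<Longrightarrow> cov l X \<Longrightarrow> y k < y l"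
  using earlier_le[of k l X] T_less[of l X] by auto

section \<open>Cells of one column\<close>

lemma H_up:
  assumes "a \<le> b" "\<And>k. k < m \<Longrightarrow> cov k X \<Longrightarrow> a < y k \<Longrightarrow> y k \<le> b \<Longrightarrow> False"
  shows "H X a = H X b"
  using assms
proof (induction b rule: int_ge_induct)
  case (step b)
  have "H X (b + 1) = H X (b + 1 - 1)"
    by (rule H_same) (use step in force)
  moreover have "H X a = H X b" by (rule step.IH) (use step.prems in force)
  ultimately show ?case by simp
qed simp

text \<open>Over a column, edges are ordered by height as they are by traversal. Hence no edge
  separates row \<open>Y\<close> from the row just below ceiling \<open>k\<close>, and that row
  belongs to the hole.\<close>

lemma H_between_right:
  assumes "k < m" "\<not> lft k" "cov k X" "T k X \<le> Y" "Y < y k"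
  shows "H X Y"
proof -
  have "H X Y = H X (y k - 1)"
  proof (rule H_up)
    fix l assume l: "l < m" "cov l X" "Y < y l" "y l \<le> y k - 1"
    show False
      using earlier_le[of l k X] later_gt[of k l X] l assms by (cases l k rule: linorder_cases) auto
  qed (use assms in auto)
  then show ?thesis using H_right[of k X] assms cov_rgt by auto
qed

lemma H_between_left:
  assumes "k < m" "lft k" "cov k X" "T k X \<le> Y" "Y < y k"
  shows "\<not> H X Y"
proof -
  have "H X Y = H X (y k - 1)"
  proof (rule H_up)
    fix l assume l: "l < m" "cov l X" "Y < y l" "y l \<le> y k - 1"
    show False
      using earlier_le[of l k X] later_gt[of k l X] l assms by (cases l k rule: linorder_cases) auto
  qed (use assms in auto)
  then show ?thesis using H_left[of k X] assms cov_lft by auto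
qed

text \<open>Above the last edge of the column membership no longer changes, so a cell there would
  contradict boundedness.\<close>

lemma H_above: "T m X \<le> Y \<Longrightarrow> X < x 0 \<Longrightarrow> \<not> H X Y"
proof -
  assume *: "T m X \<le> Y" "X < x 0"
  obtain C where C: "\<And>X Y. H X Y \<Longrightarrow> \<bar>Y\<bar> < C" using H_bounded by blast
  have "H X Y = H X (max Y C)"
    by (rule H_up) (use * earlier_le[of _ m X] in force)+
  then show ?thesis using C[of X "max Y C"] by auto
qed

lemma H_outside: "x 0 \<le> X \<Longrightarrow> \<not> H X Y"
proof -
  assume *: "x 0 \<le> X"
  obtain C where C: "\<And>X Y. H X Y \<Longrightarrow> \<bar>Y\<bar> < C" using H_bounded by blast
  have "H X Y = H X (max Y C)"
    by (rule H_up) (use * cov_less[of _ X] in force)+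
  then show ?thesis using C[of X "max Y C"] by auto
qed

text \<open>The profile at \<open>x k\<close> never drops below \<open>y k\<close> again. A leftward
  edge \<open>l\<close> exceeds it by monotonicity of the profile left of \<open>x l\<close>; a
  rightward edge either covers \<open>x k\<close> itself or starts to the right of it after an
  upward turn.\<close>

lemma later_ge:
  assumes "0 < k" "k < l" "l < m" "\<not> lft k" "cov l X" "x k \<le> X" "l = m - 1 \<Longrightarrow> y (m - 2) < y (m - 1)"
  shows "y k \<le> y l"
proof -
  have I: "Inv l" using Inv assms by simp
  have "cov k (x k)" using assms cov_rgt[of k] not_lft[of k] by auto
  then have Tk: "y k \<le> T l (x k)" using earlier_le assms by simp
  have TX: "T l X < y l" using T_less assms by simp
  show ?thesis
  proof (cases "lft l")
    case True
    then have "X < x l" using assms cov_lft by auto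
    then show ?thesis using Inv_mono[OF I assms(6)] Tk TX by simp
  next
    case False
    show ?thesis
    proof (cases "x k < x l")
      case True
      have "y (l - 1) < y l" using turn_up[of l] False assms by auto
      then show ?thesis using below_right[OF I _ assms(3) False _ True] Tk assms by simp
    next
      case F: False
      then have "cov l (x k)" using False assms cov_rgt[of l] by auto
      then show ?thesis using T_less[of l "x k"] Tk assms by simp
    qed
  qed
qed

text \<open>Below the height of ceiling \<open>k\<close>, the region to its right is free down to
  the floor, apart from what the last edge cuts off after a fall. This is why \<open>fits\<close>
  consults only one ceiling and the falling corner.\<close>

lemma H_under:
  assumes "0 < k" "k < m" "\<not> lft k" "x k \<le> X" "X < x 0" "T k X \<le> Y" "Y < y k"
  shows "H X Y \<longleftrightarrow> X < xD \<or> Y < y (m - 1)"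
proof -
  obtain l where l: "l < k" "lft l" "cov l X" "y l = T k X"
    using Inv_floor[OF Inv[OF assms(1,2)] assms(4,5)] by blast
  have base: "H X (T k X)" using H_left[of l X] l assms cov_lft by auto
  \<comment> \<open>Earlier edges lie at or below the profile and later ones at or above
    \<open>y k\<close>, by \<open>later_ge\<close>; only the last edge after a fall can lie
    between.\<close>
  have edge: "j = m - 1 \<and> y (m - 1) < y (m - 2)" if "j < m" "cov j X" "T k X < y j" "y j < y k" for j
  proof (rule ccontr)
    assume "\<not> ?thesis"
    then have "j = m - 1 \<Longrightarrow> y (m - 2) < y (m - 1)" using y_ne by auto
    moreover have "k < j" using earlier_le[of j k X] that assms by (cases j k rule: linorder_cases) auto
    ultimately show False using later_ge[of k j X] that assms by auto
  qed
  show ?thesis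
  proof (cases "X < xD \<or> Y < y (m - 1)")
    case True
    have "H X (T k X) = H X Y"
    proof (rule H_up)
      fix j assume j: "j < m" "cov j X" "T k X < y j" "y j \<le> Y"
      have "j = m - 1" and f: "y (m - 1) < y (m - 2)" using edge[of j] j assms by auto
      then have "x (m - 1) \<le> X" using j cov_rgt[of "m - 1"] rgt_last m2 by auto
      then show False using True f j xD \<open>j = m - 1\<close> by auto
    qed fact
    then show ?thesis using base True by simp
  next
    case False
    then have f: "y (m - 1) < y (m - 2)" and X: "x (m - 1) \<le> X" using xD assms by (auto split: if_splits)
    have c: "cov (m - 1) X" using X assms x_close m2 rgt_last cov_rgt[of "m - 1" X] by auto
    have "H X (y (m - 1)) = H X Y"
    proof (rule H_up)
      fix j assume j: "j < m" "cov j X" "y (m - 1) < y j" "y j \<le> Y"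
      have "j < m - 1" using j by (cases "j = m - 1") auto
      then show False using later_gt[of j "m - 1" X] j c m2 by auto
    qed (use False in auto)
    then show ?thesis using H_right[of "m - 1" X] X assms x_close m2 False by auto
  qed
qed


section \<open>The stack invariant\<close>

definition blocked where "blocked a c \<longleftrightarrow> (\<exists>Y. c \<le> Y \<and> Y < c + h \<and> \<not> H (a - 1) Y)"

definition stable where
  "stable X Y \<longleftrightarrow> (\<forall>X' Y'. X \<le> X' \<and> X' < X + w \<and> Y \<le> Y' \<and> Y' < Y + h \<longrightarrow> H X' Y') \<and> blocked X Y \<and>
     (\<exists>X'. X \<le> X' \<and> X' < X + w \<and> \<not> H X' (Y - 1))"

abbreviation P where "P k \<equiv> window_max w (T k) (x k)"

definition clear where "clear k a c \<longleftrightarrow> (\<forall>Y. c \<le> Y \<and> Y < c + h \<and> Y \<le> T k (a - 1) \<longrightarrow> H (a - 1) Y)"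

text \<open>The flag of a piece starting to the right of \<open>x k\<close> accounts only for the cells of column \<open>a - 1\<close>
  below the profile: what lies above is decided when the ceiling of that column is known. At
  \<open>x k\<close> itself, after a ceiling, the flag is also set if the ceiling on the left is too low.\<close>

definition flag_inv where
  "flag_inv k a c b \<longleftrightarrow> (a < x 0 \<longrightarrow>
     (if x k < a then (b \<longrightarrow> blocked a c) \<and> (\<not> b \<longrightarrow> clear k a c)
      else if lft (k - 1) then \<not> b
      else (b \<longrightarrow> blocked a c \<or> T k (a - 1) < c + h) \<and> (\<not> b \<longrightarrow> c + h \<le> T k (a - 1) \<and> \<not> blocked a c)))"

text \<open>After a floor, the stack starts at the first column whose window contains column
  \<open>x k\<close>. After a ceiling, everything left of \<open>x k\<close> has been swept
  away.\<close>

definition stack_inv where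
  "stack_inv k S \<longleftrightarrow> pieces (x 0 + 1) (P k) (flag_inv k) S \<and> start S = (if lft (k - 1) then x k - w + 1 else x k)"

text \<open>After a leftmost edge the stack is swept to \<open>x k\<close> under the fictitious
  ceiling \<open>y (k - 1)\<close>; this reports nothing and flags the piece at \<open>x k\<close>,
  where the leftmost edge is a wall. At a left notch the stack already starts at \<open>x k\<close>,
  so nothing has to be popped.\<close>

definition steps :: "nat \<Rightarrow> entry list \<Rightarrow> entry list \<times> (int \<times> int) list" where
  "steps k S = (if x k < x (Suc k) then
      (let (S1, o1) = (if x k < x (k - 1) then advance w h xD (y (m - 1)) (y (k - 1)) (x k) S else (S, []));
           (S2, o2) = advance w h xD (y (m - 1)) (y k) (x (Suc k)) S1
       in (S2, o1 @ o2))
    else ((x (Suc k) - w + 1, y k, False) # (if x k < x (k - 1) then pop (x k) (y k) S else S), []))"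

text \<open>This replaces \<open>flag_inv\<close> when the height \<open>y k\<close> of the next
  ceiling is known: at \<open>x k\<close> a set flag has to be justified only for rectangles that
  fit under that ceiling.\<close>

definition ceiling_flag where
  "ceiling_flag k a c b \<longleftrightarrow> (a < x 0 \<longrightarrow>
     (if x k < a then (b \<longrightarrow> blocked a c) \<and> (\<not> b \<longrightarrow> clear k a c)
      else (b \<longrightarrow> c + h \<le> y k \<longrightarrow> blocked a c) \<and> (\<not> b \<longrightarrow> \<not> blocked a c)))"

definition ceiling_inv where
  "ceiling_inv k S \<longleftrightarrow> pieces (x 0 + 1) (P k) (ceiling_flag k) S \<and> start S = x k"

text \<open>Up to column \<open>c\<close> all windows have the same visible left end, so they are
  nested.\<close>

lemma window_max_mono:
  assumes "window_max w t c X a" "window_max w t c X' a'" "X \<le> X'" "X' \<le> c" shows "a \<le> a'"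
  using assms unfolding window_max_def by fastforce

text \<open>The middle piece collects the windows that reach column \<open>x 0\<close>, where the
  profile equals \<open>y (m - 1)\<close>.\<close>

lemma stack_inv_1: "stack_inv 1 [(x 1 - w + 1, y 0, False), (x 0 - w + 1, y (m - 1), False), (x 0 + 1, y (m - 1), False)]"
proof -
  have x1: "x 1 < x 0" using lft_0 by (simp add: lft_def)
  have T1: "T 1 X = (if x 0 \<le> X then y (m - 1) else if x 1 \<le> X then y 0 else B)" for X
    using x1 by (auto simp: cov_def)
  have "P 1 X (y 0)" if "x 1 - w + 1 \<le> X" "X < x 0 - w + 1" for X
    unfolding window_max_def T1 using that x1 w0 by (auto intro!: exI[of _ "max X (x 1)"])
  moreover have "P 1 X (y (m - 1))" if "x 0 - w + 1 \<le> X" "X < x 0 + 1" for X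
    unfolding window_max_def T1 using that x1 w0 y_top by (auto intro!: exI[of _ "x 0"])
  moreover have "flag_inv 1 (x 1 - w + 1) (y 0) False" using w0 lft_0 by (simp add: flag_inv_def)
  moreover have "flag_inv 1 (x 0 - w + 1) (y (m - 1)) False"
    unfolding flag_inv_def clear_def T1 using w0 lft_0 y_top by auto
  ultimately show ?thesis unfolding stack_inv_def using x1 w0 lft_0 by auto
qed

text \<open>The three parts treat the windows that miss the new floor, those it dominates, and those
  in which an earlier floor is higher.\<close>

lemma P_left:
  assumes "0 < k" "k < m" "lft k"
  shows "x k \<le> X \<Longrightarrow> P (Suc k) X c = P k X c"
    and "\<lbrakk>X < x k; x (Suc k) - w < X; x k < X + w \<Longrightarrow> \<exists>c. P k X c \<and> c \<le> y k\<rbrakk> \<Longrightarrow> P (Suc k) X (y k)"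
    and "\<lbrakk>P k X c; X < x k; x (Suc k) - w < X; y k < c\<rbrakk> \<Longrightarrow> P (Suc k) X c"
proof -
  have T: "T (Suc k) X' = (if x (Suc k) \<le> X' \<and> X' < x k then y k else T k X')" for X'
    using cov_lft[OF assms(3)] by simp
  have lt: "x (Suc k) < x k" using assms(3) by (simp add: lft_def)
  {
    assume "x k \<le> X"
    then show "P (Suc k) X c = P k X c" unfolding window_max_def T using lt
      by (intro conj_cong all_cong1 imp_cong ex_cong1) auto
  next
    assume X: "X < x k" "x (Suc k) - w < X" and ex: "x k < X + w \<Longrightarrow> \<exists>c. P k X c \<and> c \<le> y k"
    have "T k X' \<le> y k" if "x k \<le> X'" "X' < X + w" for X'
      using ex that X unfolding window_max_def by force
    then show "P (Suc k) X (y k)" unfolding window_max_def T using X lt w0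
      by (auto intro!: exI[of _ "max X (x (Suc k))"])
  next
    assume X: "P k X c" "X < x k" "x (Suc k) - w < X" "y k < c"
    then obtain X' where "x k \<le> X'" "X' < X + w" "T k X' = c" unfolding window_max_def by auto
    then show "P (Suc k) X c" using X lt unfolding window_max_def T
      by (auto intro!: exI[of _ X'] simp: less_imp_le)
  }
qed

lemma flag_inv_cong:
  assumes "x k < a" "x (Suc k) < a" "\<not> cov k (a - 1)" shows "flag_inv k a c b \<Longrightarrow> flag_inv (Suc k) a c b"
  using assms unfolding flag_inv_def clear_def by auto

text \<open>After another floor the new one pops what it dominates. After a ceiling the vertical
  edge is a left notch, whose floor must dominate every window starting to its left; this is the
  place where the width hypothesis is used.\<close>

lemma stack_inv_left:
  assumes stack_inv: "stack_inv k S" and k: "0 < k" "k < m" and l: "lft k"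
  shows "stack_inv (Suc k) (fst (steps k S))"
proof -
  have lt: "x (Suc k) < x k" using l by (simp add: lft_def)
  have pc: "pieces (x 0 + 1) (P k) (flag_inv k) S" using stack_inv by (simp add: stack_inv_def)
  have xk: "x k < x 0" using x_max k by simp
  have up: "flag_inv (Suc k) a c b" if "x k < a" "flag_inv k a c b" for a c b
    using flag_inv_cong[of k a c b] that lt l by (auto simp: cov_lft)
  have new: "flag_inv (Suc k) (x (Suc k) - w + 1) (y k) False"
    using w0 l by (simp add: flag_inv_def)
  have km1: "k - 1 < m" using k by simp
  show ?thesis
  proof (cases "lft (k - 1)")
    case True
    have st: "start S = x k - w + 1" using stack_inv True by (simp add: stack_inv_def)
    have stp: "fst (steps k S) = (x (Suc k) - w + 1, y k, False) # pop (x k) (y k) S"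
      using lt True k by (simp add: steps_def lft_def)
    obtain a1 m1 b1 r where S1: "pop (x k) (y k) S = (a1, m1, b1) # r" "start S \<le> a1" "a1 \<le> x k" "P k a1 m1"
      and popped: "\<forall>X. start S \<le> X \<and> X < a1 \<longrightarrow> (\<exists>m. P k X m \<and> m \<le> y k)"
      and alt: "(y k < m1 \<and> pieces (x 0 + 1) (P k) (flag_inv k) (pop (x k) (y k) S) \<or>
         a1 = x k \<and> m1 \<le> y k \<and> pieces (x 0 + 1) (P k) (\<lambda>a c b. if a = x k then b = (c < y k) \<and> c \<le> y k else a > x k \<and> flag_inv k a c b) (pop (x k) (y k) S))"
      using pop_pieces[OF pc, of "x k" "y k"] st xk w0 by auto
    have "pieces (x 0 + 1) (P (Suc k)) (flag_inv (Suc k)) (pop (x k) (y k) S)"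
      using alt
    proof
      assume A: "y k < m1 \<and> pieces (x 0 + 1) (P k) (flag_inv k) (pop (x k) (y k) S)"
      \<comment> \<open>Window maxima do not decrease up to \<open>x k\<close>, so the height of the
        first surviving piece bounds all of them from below.\<close>
      have big: "y k < c" if "a1 \<le> X" "X < x k" "P k X c" for X c
        using window_max_mono[OF S1(4) that(3,1)] that A by auto
      have big': "y k < c" if "a1 \<le> a" "a \<le> x k" "P k a c" for a c
        using window_max_mono[OF S1(4) that(3,1)] that A by auto
      have pcx: "pieces (x 0 + 1) (P k) (\<lambda>a c b. flag_inv k a c b \<and> P k a c) (pop (x k) (y k) S)"
        using A by (intro pieces_add) simp
      show ?thesis
      proof (rule pieces_mono[OF pcx])
        fix X c assume "start (pop (x k) (y k) S) \<le> X" "P k X c"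
        then show "P (Suc k) X c"
          using P_left(1)[OF k l, of X c] P_left(3)[OF k l, of X c] big[of X c] S1(1,2) st lt
          by (cases "x k \<le> X") auto
      next
        fix a c b assume a: "start (pop (x k) (y k) S) \<le> a" "a < x 0 + 1" "flag_inv k a c b \<and> P k a c"
        show "flag_inv (Suc k) a c b"
        proof (cases "x k < a")
          case True
          then show ?thesis using up a by simp
        next
          case False
          then have "y k < c" using big'[of a c] a S1(1) by simp
          moreover have "\<not> b" using a False \<open>lft (k - 1)\<close> xk by (auto simp: flag_inv_def)
          \<comment> \<open>If column \<open>a - 1\<close> lies under the new floor, its profile is
            now \<open>y k < c\<close>, and \<open>clear\<close> holds vacuously.\<close>
          ultimately show ?thesis using False l unfolding flag_inv_def clear_def by (auto simp: cov_lft)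
        qed
      qed
    next
      assume A: "a1 = x k \<and> m1 \<le> y k \<and> pieces (x 0 + 1) (P k) (\<lambda>a c b. if a = x k then b = (c < y k) \<and> c \<le> y k else a > x k \<and> flag_inv k a c b) (pop (x k) (y k) S)"
      have pcx: "pieces (x 0 + 1) (P k) (\<lambda>a c b. (if a = x k then b = (c < y k) \<and> c \<le> y k else a > x k \<and> flag_inv k a c b) \<and> P k a c) (pop (x k) (y k) S)"
        using A by (intro pieces_add) simp
      show ?thesis
      proof (rule pieces_mono[OF pcx])
        fix X c assume "start (pop (x k) (y k) S) \<le> X" "P k X c"
        then show "P (Suc k) X c" using P_left(1)[OF k l, of X c] S1(1) A by auto
      next
        fix a c b assume a: "(if a = x k then b = (c < y k) \<and> c \<le> y k else a > x k \<and> flag_inv k a c b) \<and> P k a c"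
        show "flag_inv (Suc k) a c b"
        proof (cases "a = x k")
          case False
          then show ?thesis using up a by simp
        next
          case eq: True
          have cv: "cov k (x k - 1)" using lt l by (simp add: cov_lft)
          have H1: "H (x k - 1) (y k)" using H_left[of k "x k - 1"] k lt by simp
          have "T k (x k) \<le> c" using a eq w0 unfolding window_max_def by auto
          then have "T k (x k - 1) \<le> c" using Inv_step[OF Inv[OF k] True] by simp
          \<comment> \<open>In column \<open>x k - 1\<close> height \<open>c\<close> lies above the
            old profile and below the new floor, hence outside the hole.\<close>
          then have "blocked a c" if "c < y k"
            using H_between_left[of k "x k - 1" c] k l cv that eq h0 by (auto simp: blocked_def)
          moreover have "clear (Suc k) a c" if "\<not> c < y k"
          proof -
            have "c = y k" using a that eq by auto
            moreover have "T (Suc k) (a - 1) = y k" using cv eq by simp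
            ultimately show ?thesis using H1 eq unfolding clear_def by (metis order_antisym)
          qed
          ultimately show ?thesis using a eq lt unfolding flag_inv_def by simp
        qed
      qed
    qed
    then have "pieces (x 0 + 1) (P (Suc k)) (flag_inv (Suc k)) (fst (steps k S))"
      unfolding stp
    proof (rule pieces_Cons)
      show "x (Suc k) - w + 1 < start (pop (x k) (y k) S)" using S1 st lt by simp
    next
      fix X assume X: "x (Suc k) - w + 1 \<le> X" "X < start (pop (x k) (y k) S)"
      then show "P (Suc k) X (y k)"
        using P_left(2)[OF k l, of X] popped S1 st by auto
    qed (rule new)
    then show ?thesis using stp l by (simp add: stack_inv_def)
  next
    case False
    have st: "start S = x k" using stack_inv False by (simp add: stack_inv_def)
    have xx: "x (k - 1) < x k" using False not_lft[OF km1] k by simp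
    have stp: "fst (steps k S) = (x (Suc k) - w + 1, y k, False) # S"
      using lt xx by (simp add: steps_def)
    have yy: "y (k - 1) < y k" using RL[OF k xx lt] .
    have Tl: "T k (x k - 1) = y (k - 1)" using T_last k False by simp
    \<comment> \<open>The profile is below \<open>y k\<close> at \<open>x k\<close> and, by
      \<open>QW\<close>, no vertical edge meets height \<open>y k\<close> within the next
      \<open>w\<close> columns.\<close>
    have low: "T k X < y k" if "x k \<le> X" "X < x k + w" for X
    proof (rule T_less_along[OF Inv[OF k] k, where a = "x k" and e = "x k + w"])
      show "T k (x k) < y k" using T_cur_less[OF Inv[OF k] k False] yy by simp
    next
      fix l assume "l < k" "x k < x l" "x l < x k + w" "min (yp l) (y l) \<le> y k" "y k \<le> max (yp l) (y l)"
      then show False using QW[OF k xx lt, of l] k by simp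
    qed (use that in auto)
    have pcx: "pieces (x 0 + 1) (P k) (\<lambda>a c b. flag_inv k a c b \<and> P k a c) S"
      using pc by (rule pieces_add)
    have "pieces (x 0 + 1) (P (Suc k)) (flag_inv (Suc k)) S"
    proof (rule pieces_mono[OF pcx])
      fix X c assume "start S \<le> X" "P k X c"
      then show "P (Suc k) X c" using P_left(1)[OF k l, of X c] st by auto
    next
      fix a c b assume a: "start S \<le> a" "flag_inv k a c b \<and> P k a c"
      show "flag_inv (Suc k) a c b"
      proof (cases "a = x k")
        case False
        then show ?thesis using up a st by simp
      next
        case eq: True
        obtain X' where "x k \<le> X'" "X' < x k + w" "T k X' = c" using a eq unfolding window_max_def by auto
        then have cy: "c < y k" using low by blast
        have fl: "b \<longrightarrow> blocked a c \<or> T k (a - 1) < c + h" "\<not> b \<longrightarrow> c + h \<le> T k (a - 1) \<and> \<not> blocked a c"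
          using a eq False xk unfolding flag_inv_def by auto
        \<comment> \<open>Such a rectangle extends above the ceiling on its left and starts below
          the top of the notch, so the side of the notch is in its way.\<close>
        have "blocked a c" if "y (k - 1) < c + h"
        proof -
          have "\<not> H (x k - 1) (max c (y (k - 1)))"
            using H_vert[of k "max c (y (k - 1))"] k yy cy by (auto simp: yp_def)
          then show ?thesis using that eq h0 unfolding blocked_def
            by (intro exI[of _ "max c (y (k - 1))"]) auto
        qed
        then show ?thesis using fl eq lt Tl unfolding flag_inv_def clear_def blocked_def by auto
      qed
    qed
    then have "pieces (x 0 + 1) (P (Suc k)) (flag_inv (Suc k)) (fst (steps k S))"
      unfolding stp
    proof (rule pieces_Cons)
      show "x (Suc k) - w + 1 < start S" using st lt w0 by simp
    next
      fix X assume X: "x (Suc k) - w + 1 \<le> X" "X < start S"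
      have "\<exists>c. P k X c \<and> c \<le> y k" if "x k < X + w"
      proof -
        let ?W = "{X'. x k \<le> X' \<and> X' < X + w}"
        have fin: "finite ?W" by (rule finite_subset[of _ "{x k..X + w}"]) auto
        have ne: "?W \<noteq> {}" using that by auto
        have "P k X (Max (T k ` ?W))"
        proof -
          have "Max (T k ` ?W) \<in> T k ` ?W" using fin ne by (intro Max_in) auto
          moreover have "T k X' \<le> Max (T k ` ?W)" if "X' \<in> ?W" for X' using fin that by (intro Max_ge) auto
          ultimately show ?thesis unfolding window_max_def using X st by (auto simp: max_def)
        qed
        moreover have "Max (T k ` ?W) \<le> y k"
          using fin ne low X st by (auto simp: less_imp_le)
        ultimately show ?thesis by blast
      qed
      then show "P (Suc k) X (y k)" using P_left(2)[OF k l, of X] X st by auto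
    qed (rule new)
    then show ?thesis using stp l by (simp add: stack_inv_def)
  qed
qed


end

section \<open>Ceilings and the reported locations\<close>

context boundary_chain
begin

lemma H_low: "Y < B \<Longrightarrow> \<not> H X Y"
proof -
  assume *: "Y < B"
  obtain C where C: "\<And>X Y. H X Y \<Longrightarrow> \<bar>Y\<bar> < C" using H_bounded by blast
  have "H X (min Y (- C)) = H X Y"
    by (rule H_up) (use * B_less in force)+
  then show ?thesis using C[of X "min Y (- C)"] by auto
qed

text \<open>All windows in the swept range contain column \<open>x k\<close> with its floor at
  \<open>y (k - 1)\<close>. Their maxima are at least this height, so nothing fits under the
  fictitious ceiling, and the piece at \<open>x k\<close> gets its flag.\<close>

lemma ceiling_inv_after_left:
  assumes stack_inv: "stack_inv k S" and k: "0 < k" "k < m" and l: "lft (k - 1)" "\<not> lft k"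
  shows "ceiling_inv k (fst (advance w h xD (y (m - 1)) (y (k - 1)) (x k) S))"
    and "snd (advance w h xD (y (m - 1)) (y (k - 1)) (x k) S) = []"
proof -
  have pc: "pieces (x 0 + 1) (P k) (flag_inv k) S" using stack_inv by (simp add: stack_inv_def)
  have st: "start S = x k - w + 1" using stack_inv l by (simp add: stack_inv_def)
  have xk: "x k < x 0" using x_max k by simp
  have Tk: "T k (x k) = y (k - 1)" using T_last k l by simp
  have yy: "y (k - 1) < y k"
    using LR[of k] k l not_lft[of k] by (simp add: lft_def)
  let ?A = "advance w h xD (y (m - 1)) (y (k - 1)) (x k) S"
  have lo: "y (k - 1) \<le> c" if "P k a c" "x k - w + 1 \<le> a" "a \<le> x k" for a c
    using that Tk w0 unfolding window_max_def by auto
  let ?G = "swept (P k) (flag_inv k) (\<lambda>c. y (k - 1) < c + h) (x k) (start S)"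
  have A: "pieces (x 0 + 1) (P k) ?G (fst ?A)" "start (fst ?A) = x k"
    using sweep_pieces[OF pc, where X = "x k" and q = "\<lambda>c. y (k - 1) < c + h" and g = "fits w h xD (y (m - 1)) (y (k - 1))"] st xk w0
    by simp_all
  show "ceiling_inv k (fst ?A)" unfolding ceiling_inv_def
  proof (intro conjI A(2), rule pieces_mono[OF pieces_add[OF A(1)]])
    fix a c b
    assume a: "start (fst ?A) \<le> a" and G: "?G a c b \<and> P k a c"
    then have F: "(if a = x k then \<exists>b0. b = (b0 \<or> y (k - 1) < c + h) else flag_inv k a c b) \<and> P k a c"
      by (auto simp: swept_def split: if_splits)
    show "ceiling_flag k a c b"
    proof (cases "a = x k")
      case False
      then show ?thesis using F a A(2) unfolding flag_inv_def ceiling_flag_def by auto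
    next
      case True
      have c: "y (k - 1) \<le> c" using lo[of a c] F True w0 by simp
      then have b using F True h0 by auto
      moreover have "blocked a c" if "c + h \<le> y k"
      proof -
        have "\<not> H (x k - 1) c" using H_vert[of k c] k yy c that h0 by (auto simp: yp_def)
        then show ?thesis using True h0 by (auto simp: blocked_def)
      qed
      ultimately show ?thesis using True by (simp add: ceiling_flag_def)
    qed
  qed auto
  have "\<not> (a < x k \<and> (\<exists>b. (a, c, b) \<in> set S \<and> fits w h xD (y (m - 1)) (y (k - 1)) a c b))" for a c
  proof
    assume "a < x k \<and> (\<exists>b. (a, c, b) \<in> set S \<and> fits w h xD (y (m - 1)) (y (k - 1)) a c b)"
    then obtain b where ab: "a < x k" "(a, c, b) \<in> set S" "fits w h xD (y (m - 1)) (y (k - 1)) a c b" by blast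
    have "P k a c" "start S \<le> a" using pieces_mem[OF pc ab(2)] ab xk by auto
    then show False using lo[of a c] st ab h0 by (auto simp: fits_def)
  qed
  moreover have "set (snd ?A) = {(a, c). a < x k \<and> (\<exists>b. (a, c, b) \<in> set S \<and> fits w h xD (y (m - 1)) (y (k - 1)) a c b)}"
    using sweep_out[OF pc, of "x k"] xk by simp
  ultimately have "set (snd ?A) = {}" by auto
  then show "snd ?A = []" by simp
qed

text \<open>A flag set because the ceiling on the left was too low is now justified: a rectangle
  that fits under \<open>y k\<close> but not under \<open>y (k - 1)\<close> meets the vertical edge
  between the two ceilings.\<close>

lemma ceiling_inv_after_right:
  assumes stack_inv: "stack_inv k S" and k: "0 < k" "k < m" and l: "\<not> lft (k - 1)" "\<not> lft k"
  shows "ceiling_inv k S"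
proof -
  have pc: "pieces (x 0 + 1) (P k) (flag_inv k) S" using stack_inv by (simp add: stack_inv_def)
  have st: "start S = x k" using stack_inv l by (simp add: stack_inv_def)
  have Tk: "T k (x k - 1) = y (k - 1)" using T_last k l by simp
  show ?thesis unfolding ceiling_inv_def
  proof (intro conjI st, rule pieces_mono[OF pc])
    fix a c b
    assume a: "start S \<le> a" and F: "flag_inv k a c b"
    have "blocked a c" if "a = x k" "y (k - 1) < c + h" "c + h \<le> y k"
    proof -
      have "\<not> H (x k - 1) (max c (y (k - 1)))"
        using H_vert[of k "max c (y (k - 1))"] k that h0 by (auto simp: yp_def)
      then show ?thesis using that h0 unfolding blocked_def
        by (intro exI[of _ "max c (y (k - 1))"]) auto
    qed
    then show "ceiling_flag k a c b"
      using F a st l Tk unfolding flag_inv_def ceiling_flag_def by auto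
  qed auto
qed

text \<open>If the profile rose above row \<open>Y\<close>, a vertical edge would fill the jump.
  Exactly one of the two cells next to it in that row is in the hole, which contradicts the free
  row.\<close>

lemma window_floor:
  assumes k: "0 < k" "k < m" and X: "x k \<le> X" "X + w \<le> x 0" "T k X \<le> Y"
    and H: "\<And>X'. X \<le> X' \<Longrightarrow> X' < X + w \<Longrightarrow> H X' Y"
    and X': "X \<le> X'" "X' < X + w"
  shows "T k X' \<le> Y"
  using X'
proof (induction X' rule: int_ge_induct)
  case base
  then show ?case using X by simp
next
  case (step X')
  show ?case
  proof (rule ccontr)
    assume "\<not> ?thesis"
    then obtain l where l: "l < k" "x l = X' + 1" "min (yp l) (y l) \<le> Y" "Y < max (yp l) (y l)"
      using Inv_wall[OF Inv[OF k], of "X' + 1" Y] step X by auto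
    then have "H (X' + 1) Y = (yp l < y l)" "H X' Y = (y l < yp l)"
      using H_vert[of l Y] k by auto
    then show False using H[of X'] H[of "X' + 1"] step by auto
  qed
qed

text \<open>A reported start is free by \<open>H_under\<close> and rests on the floor that attains
  the window maximum. Conversely, a stable location has the value of its piece, since otherwise it
  could sink, and is the start of that piece, since otherwise it could slide left.\<close>

lemma stack_inv_right:
  assumes ceiling_inv: "ceiling_inv k S" and k: "0 < k" "k < m" and l: "\<not> lft k"
  shows "stack_inv (Suc k) (fst (advance w h xD (y (m - 1)) (y k) (x (Suc k)) S))"
    and "set (snd (advance w h xD (y (m - 1)) (y k) (x (Suc k)) S)) = {(X, Y). stable X Y \<and> cov k X \<and> T k X \<le> Y \<and> Y < y k}"
proof -
  have pc: "pieces (x 0 + 1) (P k) (ceiling_flag k) S" using ceiling_inv unfolding ceiling_inv_def by simp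
  have st: "start S = x k" using ceiling_inv by (simp add: ceiling_inv_def)
  have lt: "x k < x (Suc k)" using l k not_lft by simp
  have le: "x (Suc k) \<le> x 0" using x_le[of "Suc k"] k by simp
  let ?X = "x (Suc k)"
  let ?A = "advance w h xD (y (m - 1)) (y k) ?X S"
  have TS: "T (Suc k) X = (if x k \<le> X \<and> X < ?X then y k else T k X)" for X
    using cov_rgt[OF k(2) l] by simp
  have btw: "H X Y" if "x k \<le> X" "X < ?X" "T k X \<le> Y" "Y < y k" for X Y
    using H_between_right[OF k(2) l] that cov_rgt[OF k(2) l] by simp
  have low: "T k X \<le> c" if "P k X c" "x k \<le> X" for X c
    using that w0 unfolding window_max_def by auto
  let ?G = "swept (P k) (ceiling_flag k) (\<lambda>c. y k < c + h) ?X (start S)"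
  have A: "pieces (x 0 + 1) (P k) ?G (fst ?A)" "start (fst ?A) = ?X"
    using sweep_pieces[OF pc, where X = ?X and q = "\<lambda>c. y k < c + h" and g = "fits w h xD (y (m - 1)) (y k)"] st lt le
    by simp_all
  have "pieces (x 0 + 1) (P (Suc k)) (flag_inv (Suc k)) (fst ?A)"
  proof (rule pieces_mono[OF A(1)])
    fix X c assume "start (fst ?A) \<le> X" "P k X c"
    moreover have "P (Suc k) X c = P k X c" if "?X \<le> X"
      unfolding window_max_def TS using lt that by (intro conj_cong all_cong1 imp_cong ex_cong1) auto
    ultimately show "P (Suc k) X c" using A(2) by simp
  next
    fix a c b
    assume a: "start (fst ?A) \<le> a" and G: "?G a c b"
    show "flag_inv (Suc k) a c b"
    proof (cases "a = ?X")
      case False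
      then have "?X < a" using a A(2) by simp
      then have "clear (Suc k) a c = clear k a c" unfolding clear_def TS by simp
      then show ?thesis using G False \<open>?X < a\<close> lt unfolding ceiling_flag_def flag_inv_def swept_def by simp
    next
      case True
      obtain b0 where b: "b = (b0 \<or> y k < c + h)" and b0: "ceiling_flag k ?X c b0 \<or> \<not> b0 \<and> P k (?X - 1) c"
        using G True by (auto simp: swept_def)
      have T1: "T (Suc k) (?X - 1) = y k" using lt by (simp add: TS del: T.simps)
      have "\<not> blocked ?X c" if "\<not> b" "?X < x 0"
      proof -
        have ch: "c + h \<le> y k" "\<not> b0" using b that by auto
        have "H (?X - 1) Y" if Y: "c \<le> Y" "Y < c + h" for Y
        proof (cases "T k (?X - 1) \<le> Y")
          case True
          then show ?thesis using btw[of "?X - 1" Y] lt Y ch by simp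
        next
          case nle: False
          \<comment> \<open>Hence the piece was not cut here but had this start before, so its unset
            flag says that the part of the column below the profile is clear.\<close>
          then have "\<not> P k (?X - 1) c" using low[of "?X - 1" c] lt Y by auto
          then have "clear k ?X c" using b0 ch \<open>?X < x 0\<close> lt unfolding ceiling_flag_def by auto
          then show ?thesis using nle Y unfolding clear_def by simp
        qed
        then show ?thesis by (auto simp: blocked_def)
      qed
      moreover have "blocked ?X c" if "b0" "?X < x 0"
        using b0 that lt unfolding ceiling_flag_def by auto
      ultimately show ?thesis using True b l T1 unfolding flag_inv_def by (auto simp del: T.simps)
    qed
  qed
  then show "stack_inv (Suc k) (fst ?A)" using A(2) l by (simp add: stack_inv_def)
  have out: "set (snd ?A) = {(a, c). a < ?X \<and> (\<exists>b. (a, c, b) \<in> set S \<and> fits w h xD (y (m - 1)) (y k) a c b)}"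
    using sweep_out[OF pc, of ?X] le by simp
  have "stable a c \<and> cov k a \<and> T k a \<le> c \<and> c < y k"
    if "a < ?X" "(a, c, b) \<in> set S" "fits w h xD (y (m - 1)) (y k) a c b" for a c b
  proof -
    have Pa: "P k a c" "ceiling_flag k a c b" "x k \<le> a" using pieces_mem[OF pc that(2)] that(1) le st by auto
    have fit: b "c + h \<le> y k" "a + w \<le> xD \<or> c + h \<le> y (m - 1)" using that(3) by (auto simp: fits_def)
    have win: "T k X' \<le> c" if "a \<le> X'" "X' < a + w" for X' using Pa that unfolding window_max_def by auto
    \<comment> \<open>A window containing column \<open>x 0\<close> has value at least
      \<open>y (m - 1)\<close>. Then \<open>m + h <= yD\<close> fails in \<open>fits\<close>, and
      the other alternative fails because \<open>xD <= x 0\<close>.\<close>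
    have aw: "a + w \<le> x 0"
    proof (rule ccontr)
      assume n: "\<not> ?thesis"
      have "T k (x 0) = y (m - 1)" using T_right k by simp
      then have "y (m - 1) \<le> c" using win[of "x 0"] n that(1) le by simp
      moreover have "xD \<le> x 0" using xD x_le[of "m - 1"] by auto
      ultimately show False using fit n h0 by auto
    qed
    have "H X' Y'" if "a \<le> X'" "X' < a + w" "c \<le> Y'" "Y' < c + h" for X' Y'
      using H_under[OF k l, of X' Y'] that Pa aw win[of X'] fit by auto
    moreover obtain X' where X': "a \<le> X'" "X' < a + w" "T k X' = c" using Pa unfolding window_max_def by auto
    then obtain j where "j < k" "lft j" "cov j X'" "y j = c"
      using Inv_floor[OF Inv[OF k], of X'] Pa aw by auto
    then have "\<not> H X' (c - 1)" using H_left[of j X'] cov_lft k by auto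
    moreover have "blocked a c" using Pa fit that(1) le unfolding ceiling_flag_def by (auto split: if_splits)
    ultimately have "stable a c" using X' unfolding stable_def by blast
    then show ?thesis using Pa that(1) low[of a c] fit h0 cov_rgt[OF k(2) l] by auto
  qed
  moreover have "\<exists>b. (X, Y, b) \<in> set S \<and> fits w h xD (y (m - 1)) (y k) X Y b"
    if "stable X Y" "cov k X" "T k X \<le> Y" "Y < y k" for X Y
  proof -
    have X: "x k \<le> X" "X < ?X" using that(2) cov_rgt[OF k(2) l] by auto
    have cells: "H X' Y'" if "X \<le> X'" "X' < X + w" "Y \<le> Y'" "Y' < Y + h" for X' Y'
      using \<open>stable X Y\<close> that unfolding stable_def by blast
    have aw: "X + w \<le> x 0"
      using cells[of "X + w - 1" Y] H_outside[of "X + w - 1" Y] w0 h0 by fastforce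
    have win: "T k X' \<le> Y" if "X \<le> X'" "X' < X + w" for X'
      using window_floor[OF k X(1) aw \<open>T k X \<le> Y\<close> _ that] cells h0 by auto
    obtain a c b where e: "(a, c, b) \<in> set S" "a \<le> X" "\<forall>X'. a \<le> X' \<and> X' \<le> X \<longrightarrow> P k X' c" "ceiling_flag k a c b" "x k \<le> a"
      using pieces_entry[OF pc, of X] st X le by auto
    have PX: "P k X c" using e by blast
    have cY: "c \<le> Y" using PX X win unfolding window_max_def by auto
    \<comment> \<open>If the maximum were below \<open>Y\<close>, all cells of row
      \<open>Y - 1\<close> under the rectangle would be free by \<open>H_under\<close>.\<close>
    have "c = Y"
    proof (rule ccontr)
      assume "c \<noteq> Y"
      obtain X' where X': "X \<le> X'" "X' < X + w" "\<not> H X' (Y - 1)"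
        using \<open>stable X Y\<close> unfolding stable_def by blast
      have "T k X' \<le> c" using PX X' X unfolding window_max_def by auto
      then have "H X' (Y - 1)"
        using H_under[OF k l, of X' "Y - 1"] H_under[OF k l, of X' Y] cells[of X' Y] X' X aw h0 cY \<open>c \<noteq> Y\<close> \<open>Y < y k\<close> by auto
      then show False using X' by simp
    qed
    have top: "Y + h \<le> y k"
    proof (rule ccontr)
      assume "\<not> ?thesis"
      then show False using cells[of X "y k"] H_right[of k X] X k w0 that(4) by auto
    qed
    have "X + w \<le> xD \<or> Y + h \<le> y (m - 1)"
    proof (rule ccontr)
      assume n: "\<not> ?thesis"
      have "H (X + w - 1) (Y + h - 1)" using cells w0 h0 by simp
      moreover have "T k (X + w - 1) \<le> Y" using win w0 by simp
      ultimately show False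
        using H_under[OF k l, of "X + w - 1" "Y + h - 1"] n top aw w0 h0 X by auto
    qed
    moreover have bk: "blocked X Y" using that(1) by (simp add: stable_def)
    have aX: "a = X"
    proof (rule ccontr)
      assume "a \<noteq> X"
      then have "P k (X - 1) c" "x k \<le> X - 1" using e by auto
      then have "H (X - 1) Y'" if "Y \<le> Y'" "Y' < Y + h" for Y'
        using btw[of "X - 1" Y'] low[of "X - 1" c] that X top \<open>c = Y\<close> by auto
      then show False using bk by (auto simp: blocked_def)
    qed
    have b
    proof (rule ccontr)
      assume "\<not> b"
      then have Xk: "x k < X" and cl: "clear k X Y" using e aX \<open>c = Y\<close> bk X le unfolding ceiling_flag_def by (auto split: if_splits)
      have "H (X - 1) Y'" if "Y \<le> Y'" "Y' < Y + h" for Y'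
        using btw[of "X - 1" Y'] cl that X Xk top unfolding clear_def by (cases "T k (X - 1) \<le> Y'") auto
      then show False using bk by (auto simp: blocked_def)
    qed
    ultimately show ?thesis using e aX \<open>c = Y\<close> top by (auto simp: fits_def)
  qed
  moreover have "X < ?X" if "cov k X" for X using that cov_rgt[OF k(2) l] by simp
  ultimately have "(X, Y) \<in> set (snd ?A) \<longleftrightarrow> stable X Y \<and> cov k X \<and> T k X \<le> Y \<and> Y < y k" for X Y
    unfolding out mem_Collect_eq prod.case by metis
  then show "set (snd ?A) = {(X, Y). stable X Y \<and> cov k X \<and> T k X \<le> Y \<and> Y < y k}"
    by auto
qed

text \<open>Step \<open>k\<close> reports the stable locations in the band between the old and the
  new profile. Under a new floor this band lies outside the hole and contains none.\<close>

lemma steps_correct: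
  assumes stack_inv: "stack_inv k S" and k: "0 < k" "k < m"
    and O: "os = {(X, Y). stable X Y \<and> Y < T k X}"
  shows "stack_inv (Suc k) (fst (steps k S))" and "os \<union> set (snd (steps k S)) = {(X, Y). stable X Y \<and> Y < T (Suc k) X}"
proof -
  have Ts: "Y < T (Suc k) X \<longleftrightarrow> Y < T k X \<or> cov k X \<and> T k X \<le> Y \<and> Y < y k" for X Y
    using T_less[of k X] k by auto
  have st: "H X Y" if "stable X Y" for X Y using that w0 h0 unfolding stable_def by auto
  have "stack_inv (Suc k) (fst (steps k S)) \<and> os \<union> set (snd (steps k S)) = {(X, Y). stable X Y \<and> Y < T (Suc k) X}"
  proof (cases "lft k")
    case True
    then have "snd (steps k S) = []" by (simp add: steps_def lft_def)
    moreover have "\<not> stable X Y" if "cov k X" "T k X \<le> Y" "Y < y k" for X Y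
      using H_between_left[OF k(2) True that] st by blast
    ultimately show ?thesis using stack_inv_left[OF stack_inv k True] O Ts by auto
  next
    case False
    then have lt: "x k < x (Suc k)" using not_lft k by simp
    show ?thesis
    proof (cases "lft (k - 1)")
      case True
      then have "x k < x (k - 1)" using k by (simp add: lft_def)
      then have "steps k S = advance w h xD (y (m - 1)) (y k) (x (Suc k)) (fst (advance w h xD (y (m - 1)) (y (k - 1)) (x k) S))"
        using lt ceiling_inv_after_left[OF stack_inv k True False] by (simp add: steps_def split_beta)
      then show ?thesis
        using stack_inv_right[OF ceiling_inv_after_left(1)[OF stack_inv k True False] k False] O Ts by auto
    next
      case F: False
      then have "\<not> x k < x (k - 1)" using k by (simp add: lft_def)
      then have "steps k S = advance w h xD (y (m - 1)) (y k) (x (Suc k)) S"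
        using lt by (simp add: steps_def split_beta)
      then show ?thesis
        using stack_inv_right[OF ceiling_inv_after_right[OF stack_inv k F False] k False] O Ts by auto
    qed
  qed
  then show "stack_inv (Suc k) (fst (steps k S))" "os \<union> set (snd (steps k S)) = {(X, Y). stable X Y \<and> Y < T (Suc k) X}" by auto
qed

primrec run :: "nat \<Rightarrow> entry list \<times> (int \<times> int) list" where
  "run 0 = ([(x 1 - w + 1, y 0, False), (x 0 - w + 1, y (m - 1), False), (x 0 + 1, y (m - 1), False)], [])"
| "run (Suc j) = (fst (steps (Suc j) (fst (run j))), snd (run j) @ snd (steps (Suc j) (fst (run j))))"

lemma run_inv: "j < m \<Longrightarrow> stack_inv (Suc j) (fst (run j)) \<and> set (snd (run j)) = {(X, Y). stable X Y \<and> Y < T (Suc j) X}"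
proof (induction j)
  case 0
  \<comment> \<open>Cells under the first floor, below \<open>B\<close> or beyond the rightmost edge
    are all outside the hole.\<close>
  have "\<not> (stable X Y \<and> Y < T (Suc 0) X)" for X Y
  proof
    assume *: "stable X Y \<and> Y < T (Suc 0) X"
    then have H: "H X Y" using w0 h0 unfolding stable_def by auto
    show False
      using H_outside[of X Y] H_low[of Y X] H_between_left[of 0 X Y] lft_0 H * m2 cov_less[of 0 X]
      by (cases "x 0 \<le> X"; cases "Y < B") (auto split: if_splits)
  qed
  then show ?case using stack_inv_1 by auto
next
  case (Suc j)
  then have IH: "stack_inv (Suc j) (fst (run j))" "set (snd (run j)) = {(X, Y). stable X Y \<and> Y < T (Suc j) X}" by auto
  show ?case using steps_correct[OF IH(1) _ _ IH(2)] Suc.prems by (simp del: T.simps)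
qed

theorem run_correct: "set (snd (run (m - 1))) = {(X, Y). stable X Y}"
proof -
  have "Y < T m X" if "stable X Y" for X Y
  proof -
    have "H X Y" using that w0 h0 unfolding stable_def by auto
    then show ?thesis using H_above[of X Y] H_outside[of X Y] by force
  qed
  then show ?thesis using run_inv[of "m - 1"] m2 by auto
qed

end

section \<open>Polygonal paths\<close>

lemma pathstart_polygonal [simp]: "ps \<noteq> [] \<Longrightarrow> pathstart (polygonal_path ps) = hd ps"
  by (induction ps rule: polygonal_path.induct) auto

lemma pathfinish_polygonal [simp]: "ps \<noteq> [] \<Longrightarrow> pathfinish (polygonal_path ps) = last ps"
  by (induction ps rule: polygonal_path.induct) auto

lemma path_polygonal [simp]: "path (polygonal_path ps)"
proof -
  have "path (\<lambda>_. a)" for a :: complex by (simp add: path_def)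
  then show ?thesis by (induction ps rule: polygonal_path.induct) auto
qed

lemma path_image_polygonal:
  "2 \<le> length ps \<Longrightarrow> path_image (polygonal_path ps) = (\<Union>i<length ps - 1. closed_segment (ps ! i) (ps ! Suc i))"
proof (induction ps rule: polygonal_path.induct)
  case (3 a b)
  then show ?case by (simp add: lessThan_Suc)
next
  case (4 a b c ps)
  have "path_image (polygonal_path (a # b # c # ps)) =
      closed_segment a b \<union> (\<Union>i<length (b # c # ps) - 1. closed_segment ((b # c # ps) ! i) ((b # c # ps) ! Suc i))"
    using 4 by (simp add: path_image_join)
  also have "\<dots> = (\<Union>i\<in>insert 0 (Suc ` {..<length (b # c # ps) - 1}).
      closed_segment ((a # b # c # ps) ! i) ((a # b # c # ps) ! Suc i))"
    by simp
  also have "insert 0 (Suc ` {..<length (b # c # ps) - 1}) = {..<length (a # b # c # ps) - 1}"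
    by (auto simp: less_Suc_eq_0_disj image_iff)
  finally show ?case .
qed auto

lemma winding_number_polygonal:
  assumes "2 \<le> length ps" "z \<notin> path_image (polygonal_path ps)"
  shows "winding_number (polygonal_path ps) z =
    (\<Sum>i<length ps - 1. winding_number (linepath (ps ! i) (ps ! Suc i)) z)"
  using assms
proof (induction ps rule: polygonal_path.induct)
  case (4 a b c ps)
  have z: "z \<notin> closed_segment a b" "z \<notin> path_image (polygonal_path (b # c # ps))"
    using 4(3) by (auto simp: path_image_join)
  have "winding_number (polygonal_path (a # b # c # ps)) z =
      winding_number (linepath a b) z + winding_number (polygonal_path (b # c # ps)) z"
    using z by (simp add: winding_number_join)
  also have "\<dots> = winding_number (linepath a b) z +
      (\<Sum>i<length (b # c # ps) - 1. winding_number (linepath ((b # c # ps) ! i) ((b # c # ps) ! Suc i)) z)"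
    using 4(1) z by simp
  also have "\<dots> = (\<Sum>i<Suc (length (b # c # ps) - 1). winding_number (linepath ((a # b # c # ps) ! i) ((a # b # c # ps) ! Suc i)) z)"
    by (subst sum.lessThan_Suc_shift) simp
  finally show ?case by simp
qed auto

text \<open>The first segment of an arc meets the rest only in the point where they are joined; the
  remaining pairs are covered by induction on the rest.\<close>

lemma arc_polygonal_meet:
  assumes "arc (polygonal_path ps)" "distinct ps" "i < j" "Suc j < length ps"
    and "z \<in> closed_segment (ps ! i) (ps ! Suc i)" "z \<in> closed_segment (ps ! j) (ps ! Suc j)"
  shows "j = Suc i \<and> z = ps ! j"
  using assms
proof (induction ps arbitrary: i j rule: polygonal_path.induct)
  case (4 a b c ps)
  have j: "j = Suc (j - 1)" "Suc (j - 1) < length (b # c # ps)" using 4(4,5) by auto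
  have arc: "arc (polygonal_path (b # c # ps))"
    and int: "closed_segment a b \<inter> path_image (polygonal_path (b # c # ps)) \<subseteq> {b}"
    using 4(2) by (simp_all add: arc_join_eq)
  have zj: "z \<in> closed_segment ((b # c # ps) ! (j - 1)) ((b # c # ps) ! Suc (j - 1))"
    using 4(7) j by (metis nth_Cons_Suc)
  show ?case
  proof (cases i)
    case 0
    have "z \<in> path_image (polygonal_path (b # c # ps))"
      using zj j by (subst path_image_polygonal) auto
    then have zb: "z = b" using int 4(6) 0 by auto
    have "j - 1 = 0"
    proof (rule ccontr)
      assume "j - 1 \<noteq> 0"
      then have "j - 1 = Suc 0 \<and> z = (b # c # ps) ! (j - 1)"
        using 4(1)[OF arc _ _ j(2) _ zj, of 0] 4(3) zb by auto
      then show False using zb 4(3) by auto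
    qed
    then show ?thesis using zb 0 j by simp
  next
    case (Suc i')
    then have "j - 1 = Suc i' \<and> z = (b # c # ps) ! (j - 1)"
      using 4(1)[OF arc _ _ j(2) _ zj, of i'] 4(3,4,6) by auto
    then show ?thesis using Suc j by (metis nth_Cons_Suc)
  qed
qed auto

lemma not_simple_path_const: "\<not> simple_path (\<lambda>_. a)"
proof
  assume "simple_path (\<lambda>_. a)"
  then have *: "\<forall>x\<in>{0..1}. \<forall>y\<in>{0..1}. a = a \<longrightarrow> x = y \<or> x = 0 \<and> y = 1 \<or> x = 1 \<and> y = (0::real)"
    unfolding simple_path_def loop_free_def by blast
  \<comment> \<open>Both parameters are interior, because a simple path may identify the two ends of
    its interval.\<close>
  show False using bspec[OF bspec[OF *, of "1/4"], of "1/2"] by simp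
qed

lemma not_simple_path_point: "\<not> simple_path (linepath a a)"
  using not_simple_path_const[of a] by (simp add: linepath_def algebra_simps)

text \<open>Shorter lists give a constant path or a segment that is traversed back and
  forth.\<close>

lemma simple_polygon_length:
  assumes "simple_path (polygonal_path (vs @ [hd vs]))" "distinct vs"
  shows "3 \<le> length vs"
proof (rule ccontr)
  assume "\<not> ?thesis"
  then consider "vs = []" | a where "vs = [a]" | a b where "vs = [a, b]"
    by (cases vs rule: polygonal_path.cases) auto
  then show False
  proof cases
    case 1
    then show ?thesis using assms not_simple_path_point[of "hd [] :: complex"] by (simp del: linepath_refl)
  next
    case 2
    then show ?thesis using assms not_simple_path_point[of a] by (simp del: linepath_refl)
  next
    case (3 a b)
    then have "simple_path (linepath a b +++ linepath b a)" using assms by simp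
    then have "closed_segment a b \<inter> closed_segment b a \<subseteq> {a, b}"
      by (simp add: simple_path_join_loop_eq)
    then have "finite (closed_segment a b)"
      using finite_subset[of "closed_segment a b" "{a, b}"] by (simp add: closed_segment_commute)
    then show ?thesis using assms 3 by simp
  qed
qed

text \<open>Removing the first edge from a simple closed polygon leaves an arc, to which
  \<open>arc_polygonal_meet\<close> applies. The first edge itself meets this arc only in its two
  end points.\<close>

lemma simple_polygon_meet:
  assumes sp: "simple_path (polygonal_path (vs @ [hd vs]))" and d: "distinct vs"
    and n: "n = length vs" and ij: "i < j" "j < n"
    and z: "z \<in> closed_segment (vs ! i) (vs ! (Suc i mod n))" "z \<in> closed_segment (vs ! j) (vs ! (Suc j mod n))"
  shows "j = Suc i \<and> z = vs ! j \<or> i = 0 \<and> Suc j = n \<and> z = vs ! 0"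
proof -
  have n3: "3 \<le> n" using simple_polygon_length[OF sp d] n by simp
  obtain a b c rs where vs: "vs = a # b # c # rs"
    using n3 n by (cases vs rule: polygonal_path.cases) auto
  let ?r = "b # c # rs @ [a]"
  have "simple_path (linepath a b +++ polygonal_path ?r)" using sp vs by simp
  then have arc: "arc (polygonal_path ?r)" and int: "closed_segment a b \<inter> path_image (polygonal_path ?r) \<subseteq> {a, b}"
    by (simp_all add: simple_path_join_loop_eq)
  have dr: "distinct ?r" using d vs by auto
  have nth: "?r ! (k - 1) = vs ! k" "?r ! Suc (k - 1) = vs ! (Suc k mod n)" if "0 < k" "k < n" for k
  proof -
    have r: "?r = tl vs @ [a]" using vs by simp
    show "?r ! (k - 1) = vs ! k"
    proof -
      have "k - 1 < length (tl vs)" using that n by auto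
      then show ?thesis unfolding r using that by (simp add: nth_append nth_tl)
    qed
    have "Suc (k - 1) = k" using that by simp
    moreover have "(tl vs @ [a]) ! k = vs ! (Suc k mod n)"
    proof (cases "Suc k = n")
      case True
      have "k = length (tl vs)" using True n by simp
      then have "(tl vs @ [a]) ! k = a" by (metis nth_append_length)
      then show ?thesis using True vs by simp
    next
      case False
      then have "k < length (tl vs)" using that n by simp
      then show ?thesis using that n False by (simp add: nth_append nth_tl)
    qed
    ultimately show "?r ! Suc (k - 1) = vs ! (Suc k mod n)" unfolding r by simp
  qed
  have lr: "length ?r = n" using vs n by simp
  have zj: "z \<in> closed_segment (?r ! (j - 1)) (?r ! Suc (j - 1))"
  proof -
    have "0 < j" using ij by simp
    show ?thesis unfolding nth[OF \<open>0 < j\<close> ij(2)] by (rule z(2))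
  qed
  show ?thesis
  proof (cases "i = 0")
    case False
    have "j - 1 = Suc (i - 1) \<and> z = ?r ! (j - 1)"
    proof (rule arc_polygonal_meet[OF arc dr _ _ _ zj])
      show "i - 1 < j - 1" using False ij by simp
      show "Suc (j - 1) < length ?r" unfolding lr using ij by simp
      have i: "0 < i" "i < n" using False ij by auto
      show "z \<in> closed_segment (?r ! (i - 1)) (?r ! Suc (i - 1))" unfolding nth[OF i] by (rule z)
    qed
    then show ?thesis using False ij nth[of j] by auto
  next
    case True
    have zr: "z \<in> path_image (polygonal_path ?r)"
    proof -
      have "2 \<le> length ?r" "j - 1 < length ?r - 1" unfolding lr using ij n3 by auto
      then show ?thesis unfolding path_image_polygonal[OF \<open>2 \<le> length ?r\<close>] using zj by blast
    qed
    have "z \<in> closed_segment a b" using z(1) True vs n n3 by simp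
    then have "z = a \<or> z = b" using int zr by auto
    then show ?thesis
    proof
      assume za: "z = a"
      have "Suc j = n"
      proof (rule ccontr)
        assume "Suc j \<noteq> n"
        then have jn: "j - 1 < n - 1 - 1" "0 < n - 1" "n - 1 < n" using ij True by auto
        have "vs ! (Suc (n - 1) mod n) = a" using jn vs by simp
        then have zl: "z \<in> closed_segment (?r ! (n - 1 - 1)) (?r ! Suc (n - 1 - 1))"
          unfolding nth[OF jn(2,3)] using za by simp
        have "Suc (n - 1 - 1) < length ?r" unfolding lr using jn by simp
        then have "n - 1 - 1 = Suc (j - 1) \<and> z = ?r ! (n - 1 - 1)"
          using arc_polygonal_meet[OF arc dr jn(1) _ zj zl] by blast
        then have "z = vs ! (n - 1)" unfolding nth(1)[OF jn(2,3)] by simp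
        then have "vs ! (n - 1) = vs ! 0" using za vs by simp
        moreover have "vs \<noteq> []" using vs by simp
        ultimately show False using d n n3 nth_eq_iff_index_eq[of vs "n - 1" 0] by auto
      qed
      then show ?thesis using True za vs by simp
    next
      assume zb: "z = b"
      have "j = Suc 0"
      proof (rule ccontr)
        assume "j \<noteq> Suc 0"
        then have j1: "0 < j - 1" using ij True by auto
        have jl: "Suc (j - 1) < length ?r" unfolding lr using ij j1 by simp
        have "z \<in> closed_segment (?r ! 0) (?r ! Suc 0)" using zb by simp
        then have "j - 1 = Suc 0 \<and> z = ?r ! (j - 1)"
          using arc_polygonal_meet[OF arc dr j1 jl _ zj] by blast
        then have "z = ?r ! Suc 0" by metis
        then have "b = c" using zb by simp
        then show False using d vs by simp
      qed
      then show ?thesis using True zb vs by simp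
    qed
  qed
qed

text \<open>The closed path along the triangle stays in a convex set that avoids \<open>z\<close>,
  so it has winding number zero.\<close>

lemma triangle_winding_number:
  assumes "convex S" "a \<in> S" "b \<in> S" "c \<in> S" "z \<notin> S"
  shows "winding_number (linepath a b) z + winding_number (linepath b c) z = winding_number (linepath a c) z"
proof -
  have seg: "closed_segment p q \<subseteq> S" if "p \<in> S" "q \<in> S" for p q
    using assms(1) that by (simp add: closed_segment_subset)
  let ?g = "linepath a b +++ linepath b c +++ linepath c a"
  have "winding_number ?g z = 0"
  proof (rule winding_number_zero_outside[of _ S])
    show "path_image ?g \<subseteq> S" using assms seg by (simp add: path_image_join)
  qed (use assms in auto)
  moreover have nz: "z \<notin> closed_segment p q" if "p \<in> S" "q \<in> S" for p q
    using seg[OF that] assms(5) by blast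
  have "winding_number ?g z = winding_number (linepath a b) z + winding_number (linepath b c) z + winding_number (linepath c a) z"
    using nz assms by (simp add: winding_number_join path_image_join)
  moreover have "winding_number (linepath c a) z = - winding_number (linepath a c) z"
    using winding_number_reversepath[of "linepath a c" z] nz assms by simp
  ultimately show ?thesis by simp
qed

lemma rectangle_winding_number:
  assumes "a < b" "c < d" "Re z \<noteq> a" "Re z \<noteq> b" "Im z \<noteq> c" "Im z \<noteq> d"
  shows "winding_number (linepath (Complex a c) (Complex b c)) z + winding_number (linepath (Complex b c) (Complex b d)) z
    + winding_number (linepath (Complex b d) (Complex a d)) z + winding_number (linepath (Complex a d) (Complex a c)) z
    = (if a < Re z \<and> Re z < b \<and> c < Im z \<and> Im z < d then 1 else 0)"
proof -
  have nz: "z \<notin> closed_segment (Complex p q) (Complex p' q')"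
    if "p = p' \<and> p \<in> {a, b} \<or> q = q' \<and> q \<in> {c, d}" for p q p' q'
    using that assms by (auto simp: closed_segment_same_Re closed_segment_same_Im)
  have "winding_number (rectpath (Complex a c) (Complex b d)) z =
     winding_number (linepath (Complex a c) (Complex b c)) z + winding_number (linepath (Complex b c) (Complex b d)) z
    + winding_number (linepath (Complex b d) (Complex a d)) z + winding_number (linepath (Complex a d) (Complex a c)) z"
    using nz by (simp add: rectpath_def Let_def winding_number_join path_image_join)
  moreover have "winding_number (rectpath (Complex a c) (Complex b d)) z =
     (if a < Re z \<and> Re z < b \<and> c < Im z \<and> Im z < d then 1 else 0)"
  proof (cases "a < Re z \<and> Re z < b \<and> c < Im z \<and> Im z < d")
    case True
    then show ?thesis using winding_number_rectpath[of z "Complex a c" "Complex b d"] assms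
      by (simp add: in_box_complex_iff)
  next
    case False
    then show ?thesis using winding_number_rectpath_outside[of "Complex a c" "Complex b d" z] assms
      by (auto simp: in_cbox_complex_iff)
  qed
  ultimately show ?thesis by simp
qed

text \<open>Here \<open>p i\<close> is the projection of \<open>q i\<close> to a line avoiding the point: each edge closes up to a
  quadrilateral with its projection, and the connecting segments and projected edges cancel.\<close>

lemma telescoping_winding_sum:
  fixes L :: "'a \<Rightarrow> 'a \<Rightarrow> complex" and q p :: "nat \<Rightarrow> 'a"
  assumes "\<And>i. i < n \<Longrightarrow> L (q i) (q (Suc i)) + L (q (Suc i)) (p (Suc i)) - L (p i) (p (Suc i)) - L (q i) (p i) = r i"
    and "\<And>i. L (p 0) (p i) + L (p i) (p (Suc i)) = L (p 0) (p (Suc i))"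
    and "q n = q 0" "p n = p 0"
  shows "(\<Sum>i<n. L (q i) (q (Suc i))) = (\<Sum>i<n. r i)"
proof -
  have L0: "L (p 0) (p 0) = 0" using assms(2)[of 0] by simp
  define G where "G i = L (q i) (p i) - L (p 0) (p i)" for i
  have "L (q i) (q (Suc i)) = r i - (G (Suc i) - G i)" if "i < n" for i
    unfolding assms(1)[OF that, symmetric] G_def assms(2)[of i, symmetric] by simp
  then have "(\<Sum>i<n. L (q i) (q (Suc i))) = (\<Sum>i<n. r i) - (\<Sum>i<n. G (Suc i) - G i)"
    by (simp add: sum_subtractf)
  also have "(\<Sum>i<n. G (Suc i) - G i) = 0"
    by (subst sum_lessThan_telescope) (simp add: G_def assms(3,4))
  finally show ?thesis by simp
qed

text \<open>A slanted segment meets an axis-parallel one in at most one point, so finitely many of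
  these cannot cover it. This carries rectilinearity over from an arbitrary finite cover of the
  curve to its edges.\<close>

lemma axis_parallel_segment:
  assumes fin: "finite \<S>" and sub: "closed_segment a b \<subseteq> \<Union>\<S>"
    and ax: "\<And>S. S \<in> \<S> \<Longrightarrow> \<exists>a b. S = closed_segment a b \<and> (Re a = Re b \<or> Im a = Im b)"
  shows "Re a = Re b \<or> Im a = Im b"
proof (rule ccontr)
  assume n: "\<not> ?thesis"
  have "finite (S \<inter> closed_segment a b)" if S: "S \<in> \<S>" for S
  proof -
    have inj: "z = z'" if "z \<in> closed_segment a b" "z' \<in> closed_segment a b" "Re z = Re z' \<or> Im z = Im z'" for z z'
    proof -
      note zz = that
      obtain u u' where u: "z = (1 - u) *\<^sub>R a + u *\<^sub>R b" "z' = (1 - u') *\<^sub>R a + u' *\<^sub>R b"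
        using zz(1,2) by (auto simp: in_segment)
      have "(u - u') * (Re b - Re a) = Re z - Re z'" "(u - u') * (Im b - Im a) = Im z - Im z'"
        unfolding u by (simp_all add: algebra_simps)
      then have "u = u'" using zz(3) n by auto
      then show ?thesis using u by simp
    qed
    obtain c d where cd: "S = closed_segment c d" "Re c = Re d \<or> Im c = Im d" using ax[OF S] by blast
    have "Re z = Re z' \<or> Im z = Im z'" if "z \<in> S" "z' \<in> S" for z z'
      using that cd by (auto simp: closed_segment_same_Re closed_segment_same_Im)
    then have "z = z'" if "z \<in> S \<inter> closed_segment a b" "z' \<in> S \<inter> closed_segment a b" for z z'
      using inj that by blast
    then show ?thesis
      by (metis finite.simps finite_subset insertI1 subsetI)
  qed
  then have "finite (\<Union>S\<in>\<S>. S \<inter> closed_segment a b)" using fin by blast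
  moreover have "closed_segment a b = (\<Union>S\<in>\<S>. S \<inter> closed_segment a b)" using sub by blast
  ultimately have "finite (closed_segment a b)" by simp
  then show False using n by simp
qed

lemma collinear_Re: "collinear {z. Re z = c}" and collinear_Im: "collinear {z. Im z = c}"
proof -
  have "z - z' = (Im z - Im z') *\<^sub>R \<i>" if "Re z = c" "Re z' = c" for z z'
    using that by (simp add: complex_eq_iff)
  then show "collinear {z. Re z = c}" unfolding collinear_def by blast
  have "z - z' = (Re z - Re z') *\<^sub>R 1" if "Im z = c" "Im z' = c" for z z'
    using that by (simp add: complex_eq_iff)
  then show "collinear {z. Im z = c}" unfolding collinear_def by blast
qed

text \<open>Here \<open>f\<close> is a coordinate. Two edges through \<open>b\<close> would lie on
  the same line, so their union would again be a segment in \<open>J\<close>, and both would equal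
  it by maximality.\<close>

lemma no_vertex_on_straight_part:
  fixes f :: "complex \<Rightarrow> real"
  assumes f: "linear f" and col: "collinear {z. f z = f b}"
    and \<epsilon>: "0 < \<epsilon>" "J \<inter> ball b \<epsilon> \<subseteq> {z. f z = f b}"
  shows "b \<notin> vertices J"
proof
  assume "b \<in> vertices J"
  then obtain e e' where e: "e \<in> edges J" "e' \<in> edges J" "e \<noteq> e'" "b \<in> e" "b \<in> e'"
    unfolding vertices_def by blast
  have line: "e \<subseteq> {z. f z = f b} \<and> compact e \<and> connected e \<and> e \<subseteq> J \<and> (\<exists>p q. p \<noteq> q \<and> e = closed_segment p q)"
    if ee: "e \<in> edges J" "b \<in> e" for e
  proof -
    obtain p q where pq: "p \<noteq> q" "e = closed_segment p q" and eJ: "e \<subseteq> J"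
      using ee unfolding edges_def segment_in_def by auto
    have "f r = f b" if r: "r \<in> e" for r
    proof (cases "r = b")
      case False
      \<comment> \<open>With this factor the point at \<open>t\<close> on the way from
        \<open>b\<close> to \<open>r\<close> stays in the ball; as \<open>f\<close> is linear, its
        value at \<open>r\<close> follows from the value there.\<close>
      define t where "t = min 1 (\<epsilon> / (2 * norm (r - b)))"
      have t: "0 < t" "t \<le> 1" "t * norm (r - b) < \<epsilon>"
      proof -
        show "0 < t" "t \<le> 1" using False \<epsilon> by (auto simp: t_def)
        have "t * norm (r - b) \<le> \<epsilon> / (2 * norm (r - b)) * norm (r - b)"
          by (rule mult_right_mono) (auto simp: t_def)
        also have "\<dots> = \<epsilon> / 2" using False by simp
        finally show "t * norm (r - b) < \<epsilon>" using \<epsilon> by simp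
      qed
      let ?s = "b + t *\<^sub>R (r - b)"
      have "?s \<in> closed_segment b r" unfolding in_segment
        using t by (intro exI[of _ t]) (auto simp: algebra_simps)
      then have "?s \<in> e" using \<open>b \<in> e\<close> r pq by (metis closed_segment_subset convex_closed_segment subsetD)
      moreover have "?s \<in> ball b \<epsilon>" using t by (simp add: dist_norm)
      ultimately have "f ?s = f b" using eJ \<epsilon> by blast
      then have "t * (f r - f b) = 0"
        using f by (simp add: linear_add linear_cmul linear_diff)
      then show ?thesis using t by simp
    qed simp
    then show ?thesis using pq eJ by auto
  qed
  let ?T = "e \<union> e'"
  have T: "compact ?T" "collinear ?T" "connected ?T" "?T \<subseteq> J" "?T \<noteq> {}"
  proof -
    show "compact ?T" "?T \<subseteq> J" "?T \<noteq> {}" using line e by (blast intro: compact_Un)+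
    show "collinear ?T" using line e by (intro collinear_subset[OF col]) blast
    show "connected ?T" using line e by (intro connected_Un) auto
  qed
  then have "convex ?T" using convex_connected_collinear by blast
  then obtain c d where cd: "?T = closed_segment c d"
    using compact_convex_collinear_segment[of ?T] T by blast
  have "c \<noteq> d"
  proof
    assume "c = d"
    obtain p q where "p \<noteq> q" "e = closed_segment p q" using line e by blast
    then have "p \<in> ?T" "q \<in> ?T" "p \<noteq> q" by auto
    then show False using cd \<open>c = d\<close> by auto
  qed
  then have "segment_in J ?T" using T(4) cd unfolding segment_in_def by blast
  then have "?T = e" "?T = e'" using e unfolding edges_def by blast+
  then show False using e(3) by simp
qed

definition seg :: "complex list \<Rightarrow> nat \<Rightarrow> complex set" where
  "seg vs i = closed_segment (vs ! i) (vs ! nxt vs i)"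

lemma clockwiseD:
  assumes "clockwise_vertices J vs"
  shows "distinct vs" "set vs = vertices J" "simple_path (polygonal_path (vs @ [hd vs]))"
    "path_image (polygonal_path (vs @ [hd vs])) = J" "3 \<le> length vs"
    "\<And>z. z \<in> inside J \<Longrightarrow> winding_number (polygonal_path (vs @ [hd vs])) z = -1"
  using assms simple_polygon_length unfolding clockwise_vertices_def by (auto simp: Let_def)

lemma nth_snoc_nxt:
  assumes "i < length vs"
  shows "(vs @ [hd vs]) ! i = vs ! i" "(vs @ [hd vs]) ! Suc i = vs ! nxt vs i"
proof -
  show "(vs @ [hd vs]) ! i = vs ! i" using assms by (simp add: nth_append)
  show "(vs @ [hd vs]) ! Suc i = vs ! nxt vs i"
  proof (cases "Suc i = length vs")
    case True
    then have "nxt vs i = 0" by (simp add: nxt_def)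
    moreover have "vs \<noteq> []" using assms by auto
    ultimately show ?thesis using True by (simp add: nth_append hd_conv_nth)
  next
    case False
    then have "nxt vs i = Suc i" using assms by (simp add: nxt_def)
    then show ?thesis using False assms by (simp add: nth_append)
  qed
qed

lemma boundary_segs:
  assumes "clockwise_vertices J vs" shows "J = (\<Union>i<length vs. seg vs i)"
proof -
  have "J = path_image (polygonal_path (vs @ [hd vs]))" using clockwiseD(4)[OF assms] by simp
  also have "\<dots> = (\<Union>i<length (vs @ [hd vs]) - 1. closed_segment ((vs @ [hd vs]) ! i) ((vs @ [hd vs]) ! Suc i))"
    using clockwiseD(5)[OF assms] by (intro path_image_polygonal) simp
  also have "\<dots> = (\<Union>i<length vs. seg vs i)"
    using nth_snoc_nxt by (simp add: seg_def)
  finally show ?thesis .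
qed

lemma nxt_eq_iff: "i < length vs \<Longrightarrow> nxt vs i = (if Suc i = length vs then 0 else Suc i)"
  by (auto simp: nxt_def)

lemma segs_meet:
  assumes cv: "clockwise_vertices J vs" and ij: "i < length vs" "j < length vs" "i \<noteq> j"
    and z: "z \<in> seg vs i" "z \<in> seg vs j"
  shows "j = nxt vs i \<and> z = vs ! j \<or> i = nxt vs j \<and> z = vs ! i"
proof -
  have *: "j = nxt vs i \<and> z = vs ! j \<or> i = nxt vs j \<and> z = vs ! i"
    if "i < j" "j < length vs" "z \<in> seg vs i" "z \<in> seg vs j" for i j
    using simple_polygon_meet[OF clockwiseD(3,1)[OF cv] refl that(1,2), of z] that
    by (auto simp: seg_def nxt_def)
  show ?thesis
  proof (cases "i < j")
    case True
    then show ?thesis using *[of i j] ij z by blast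
  next
    case False
    then show ?thesis using *[of j i] ij z by (metis linorder_neqE_nat)
  qed
qed

text \<open>All edges other than the two adjacent ones are closed sets avoiding the common vertex.
  Near it the curve would be straight if the two edges were aligned.\<close>

lemma not_straight:
  fixes f :: "complex \<Rightarrow> real"
  assumes cv: "clockwise_vertices J vs" and i: "i < length vs"
    and f: "linear f" and col: "\<And>c. collinear {z. f z = c}"
    and eq: "f (vs ! i) = f (vs ! nxt vs i)" "f (vs ! nxt vs i) = f (vs ! nxt vs (nxt vs i))"
  shows False
proof -
  let ?n = "length vs" and ?i = "nxt vs i" and ?b = "vs ! nxt vs i"
  have n3: "3 \<le> ?n" by (rule clockwiseD(5)[OF cv])
  have "0 < ?n" using n3 by linarith
  then have i': "?i < ?n" unfolding nxt_def by (rule mod_less_divisor)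
  have ne: "?i \<noteq> i" using i n3 by (auto simp: nxt_eq_iff)
  let ?U = "\<Union>j\<in>{..<?n} - {i, ?i}. seg vs j"
  have "?b \<notin> seg vs j" if j: "j < ?n" "j \<noteq> i" "j \<noteq> ?i" for j
  proof
    assume "?b \<in> seg vs j"
    moreover have "?b \<in> seg vs ?i" by (simp add: seg_def)
    ultimately have "j = nxt vs ?i \<and> ?b = vs ! j \<or> ?i = nxt vs j \<and> ?b = vs ! ?i"
      using segs_meet[OF cv i' j(1)] j by auto
    then show False
    proof
      assume "j = nxt vs ?i \<and> ?b = vs ! j"
      then show False using clockwiseD(1)[OF cv] i' j by (simp add: nth_eq_iff_index_eq)
    next
      assume "?i = nxt vs j \<and> ?b = vs ! ?i"
      then show False using i j by (auto simp: nxt_eq_iff split: if_splits)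
    qed
  qed
  then have "?b \<notin> ?U" by blast
  moreover have "closed ?U" unfolding seg_def by (intro closed_UN) auto
  ultimately obtain \<epsilon> where \<epsilon>: "0 < \<epsilon>" "ball ?b \<epsilon> \<inter> ?U = {}"
    by (metis ComplI open_Compl open_contains_ball disjoint_eq_subset_Compl)
  have line: "f z = f ?b" if "z \<in> seg vs i \<union> seg vs ?i" for z
  proof -
    have "convex {z. f z = f ?b}"
      using convex_linear_vimage[OF f, of "{f ?b}"] by (simp add: vimage_def)
    then have "closed_segment p q \<subseteq> {z. f z = f ?b}" if "f p = f ?b" "f q = f ?b" for p q
      using that by (simp add: closed_segment_subset)
    then show ?thesis using that eq unfolding seg_def by auto
  qed
  have "J = seg vs i \<union> seg vs ?i \<union> ?U" using boundary_segs[OF cv] i i' by auto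
  then have "J \<inter> ball ?b \<epsilon> \<subseteq> {z. f z = f ?b}" using \<epsilon>(2) line by blast
  then have "?b \<notin> vertices J" by (rule no_vertex_on_straight_part[OF f col \<epsilon>(1)])
  then show False using clockwiseD(2)[OF cv] i' nth_mem by blast
qed

section \<open>Winding numbers of rectilinear polygons\<close>

lemma winding_number_linepath_rev:
  "z \<notin> closed_segment a b \<Longrightarrow> winding_number (linepath b a) z = - winding_number (linepath a b) z"
  using winding_number_reversepath[of "linepath a b" z] by simp

lemma winding_number_linepath_point: "z \<noteq> a \<Longrightarrow> winding_number (linepath a a) z = 0"
  using winding_number_linepath_rev[of z a a] by simp

lemma same_Re_notin: "Re z \<noteq> a \<Longrightarrow> z \<notin> closed_segment (Complex a c) (Complex a d)"
  and same_Im_notin: "Im z \<noteq> c \<Longrightarrow> z \<notin> closed_segment (Complex a c) (Complex b c)"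
  by (auto simp: closed_segment_same_Re closed_segment_same_Im)

text \<open>The four terms run around the rectangle between the edge and the line
  \<open>Re z = M\<close>, clockwise if the edge goes up and counterclockwise if it goes
  down.\<close>

lemma vertical_edge_winding:
  assumes "x < M" "Re z < M" "Re z \<noteq> x" "Im z \<noteq> a" "Im z \<noteq> c" "a \<noteq> c"
  shows "winding_number (linepath (Complex x a) (Complex x c)) z + winding_number (linepath (Complex x c) (Complex M c)) z
     - winding_number (linepath (Complex M a) (Complex M c)) z - winding_number (linepath (Complex x a) (Complex M a)) z =
     (if x < Re z \<and> min a c < Im z \<and> Im z < max a c then if a < c then -1 else 1 else 0)" (is "?lhs = _")
proof -
  have nz: "Re z \<noteq> M" using assms by simp
  note rev = winding_number_linepath_rev[OF same_Re_notin] winding_number_linepath_rev[OF same_Im_notin]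
  show ?thesis
  proof (cases "a < c")
    case True
    have "?lhs = - (winding_number (linepath (Complex x a) (Complex M a)) z + winding_number (linepath (Complex M a) (Complex M c)) z
      + winding_number (linepath (Complex M c) (Complex x c)) z + winding_number (linepath (Complex x c) (Complex x a)) z)"
      using rev(1)[of z x a c] rev(2)[of z c x M] assms by simp
    also have "\<dots> = - (if x < Re z \<and> Re z < M \<and> a < Im z \<and> Im z < c then 1 else 0)"
      by (subst rectangle_winding_number) (use assms True nz in auto)
    finally show ?thesis using True assms by auto
  next
    case False
    have "?lhs = winding_number (linepath (Complex x c) (Complex M c)) z + winding_number (linepath (Complex M c) (Complex M a)) z
      + winding_number (linepath (Complex M a) (Complex x a)) z + winding_number (linepath (Complex x a) (Complex x c)) z"
      using rev(1)[of z M a c] rev(2)[of z a x M] assms nz by simp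
    also have "\<dots> = (if x < Re z \<and> Re z < M \<and> c < Im z \<and> Im z < a then 1 else 0)"
      by (subst rectangle_winding_number) (use assms False nz in auto)
    finally show ?thesis using False assms by auto
  qed
qed

lemma horizontal_edge_winding:
  assumes "y < M" "Im z < M" "Im z \<noteq> y" "Re z \<noteq> a" "Re z \<noteq> c" "a \<noteq> c"
  shows "winding_number (linepath (Complex a y) (Complex c y)) z + winding_number (linepath (Complex c y) (Complex c M)) z
     - winding_number (linepath (Complex a M) (Complex c M)) z - winding_number (linepath (Complex a y) (Complex a M)) z =
     (if y < Im z \<and> min a c < Re z \<and> Re z < max a c then if a < c then 1 else -1 else 0)" (is "?lhs = _")
proof -
  have nz: "Im z \<noteq> M" using assms by simp
  note rev = winding_number_linepath_rev[OF same_Re_notin] winding_number_linepath_rev[OF same_Im_notin]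
  show ?thesis
  proof (cases "a < c")
    case True
    have "?lhs = winding_number (linepath (Complex a y) (Complex c y)) z + winding_number (linepath (Complex c y) (Complex c M)) z
      + winding_number (linepath (Complex c M) (Complex a M)) z + winding_number (linepath (Complex a M) (Complex a y)) z"
      using rev(2)[of z M a c] rev(1)[of z a y M] assms nz by simp
    also have "\<dots> = (if a < Re z \<and> Re z < c \<and> y < Im z \<and> Im z < M then 1 else 0)"
      by (subst rectangle_winding_number) (use assms True nz in auto)
    finally show ?thesis using True assms by auto
  next
    case False
    have "?lhs = - (winding_number (linepath (Complex c y) (Complex a y)) z + winding_number (linepath (Complex a y) (Complex a M)) z
      + winding_number (linepath (Complex a M) (Complex c M)) z + winding_number (linepath (Complex c M) (Complex c y)) z)"
      using rev(2)[of z y a c] rev(1)[of z c y M] assms by simp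
    also have "\<dots> = - (if c < Re z \<and> Re z < a \<and> y < Im z \<and> Im z < M then 1 else 0)"
      by (subst rectangle_winding_number) (use assms False nz in auto)
    finally show ?thesis using False assms by auto
  qed
qed

lemma same_Im_edge_winding:
  assumes "Im z \<noteq> y"
  shows "winding_number (linepath (Complex a y) (Complex c y)) z + winding_number (linepath (Complex c y) (Complex M y)) z
     - winding_number (linepath (Complex M y) (Complex M y)) z - winding_number (linepath (Complex a y) (Complex M y)) z = 0"
proof -
  have "convex {z. Im z = y}"
    using convex_linear_vimage[of Im "{y}"] by (simp add: vimage_def linear_iff)
  then have "winding_number (linepath (Complex a y) (Complex c y)) z + winding_number (linepath (Complex c y) (Complex M y)) z =
      winding_number (linepath (Complex a y) (Complex M y)) z"
    by (rule triangle_winding_number) (use assms in auto)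
  moreover have "z \<noteq> Complex M y" using assms by auto
  ultimately show ?thesis using winding_number_linepath_point[of z "Complex M y"] by (simp del: linepath_refl)
qed

lemma same_Re_edge_winding:
  assumes "Re z \<noteq> y"
  shows "winding_number (linepath (Complex y a) (Complex y c)) z + winding_number (linepath (Complex y c) (Complex y M)) z
     - winding_number (linepath (Complex y M) (Complex y M)) z - winding_number (linepath (Complex y a) (Complex y M)) z = 0"
proof -
  have "convex {z. Re z = y}"
    using convex_linear_vimage[of Re "{y}"] by (simp add: vimage_def linear_iff)
  then have "winding_number (linepath (Complex y a) (Complex y c)) z + winding_number (linepath (Complex y c) (Complex y M)) z =
      winding_number (linepath (Complex y a) (Complex y M)) z"
    by (rule triangle_winding_number) (use assms in auto)
  moreover have "z \<noteq> Complex y M" using assms by auto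
  ultimately show ?thesis using winding_number_linepath_point[of z "Complex y M"] by (simp del: linepath_refl)
qed

lemma sum_even_odd: "(\<Sum>j<2 * m. f j) = (\<Sum>k<m. f (2 * k) + f (Suc (2 * k)) :: 'a :: comm_monoid_add)"
  by (induction m) (auto simp: algebra_simps)

lemma sum_cyclic_shift:
  fixes f :: "nat \<Rightarrow> 'a :: comm_monoid_add"
  assumes "0 < n" shows "(\<Sum>j<n. f ((r + j) mod n)) = (\<Sum>i<n. f i)"
proof -
  have inj: "inj_on (\<lambda>j. (r + j) mod n) {..<n}"
  proof (rule linorder_inj_onI)
    fix i j assume ij: "i < j" "i \<in> {..<n}" "j \<in> {..<n}"
    have "\<not> n dvd j - i" using ij by (auto dest: dvd_imp_le)
    then show "(r + i) mod n \<noteq> (r + j) mod n"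
      using ij mod_eq_dvd_iff_nat[of "r + i" "r + j" n] by auto
  qed auto
  have "(\<lambda>j. (r + j) mod n) ` {..<n} = {..<n}"
    by (rule endo_inj_surj) (use inj assms in auto)
  then show ?thesis using sum.reindex[OF inj, of f] by simp
qed

text \<open>Projection to a vertical line on the right makes the quadrilaterals of the horizontal
  edges degenerate; projection to a horizontal line above does the same for the vertical edges. This
  gives the two ways of counting.\<close>

lemma rectilinear_winding:
  fixes x y yp :: "nat \<Rightarrow> real"
  assumes q: "\<And>k. k \<le> m \<Longrightarrow> q (2 * k) = Complex (x k) (yp k)" "\<And>k. k < m \<Longrightarrow> q (Suc (2 * k)) = Complex (x k) (y k)"
    and yp: "\<And>k. k < m \<Longrightarrow> yp (Suc k) = y k" and cl: "q (2 * m) = q 0"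
    and ne: "\<And>k. k < m \<Longrightarrow> x k \<noteq> x (Suc k)" "\<And>k. k < m \<Longrightarrow> yp k \<noteq> y k"
    and z: "\<And>k. k \<le> m \<Longrightarrow> Re z \<noteq> x k" "\<And>k. k \<le> m \<Longrightarrow> Im z \<noteq> yp k" "\<And>k. k < m \<Longrightarrow> Im z \<noteq> y k"
  shows "(\<Sum>j<2 * m. winding_number (linepath (q j) (q (Suc j))) z) =
      (\<Sum>k<m. if x k < Re z \<and> min (yp k) (y k) < Im z \<and> Im z < max (yp k) (y k) then if yp k < y k then -1 else 1 else 0)"
    and "(\<Sum>j<2 * m. winding_number (linepath (q j) (q (Suc j))) z) =
      (\<Sum>k<m. if y k < Im z \<and> min (x k) (x (Suc k)) < Re z \<and> Re z < max (x k) (x (Suc k)) then if x k < x (Suc k) then 1 else -1 else 0)"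
proof -
  have q2: "q (Suc (Suc (2 * k))) = Complex (x (Suc k)) (y k)" if "k < m" for k
    using q(1)[of "Suc k"] yp[of k] that by simp
  let ?L = "\<lambda>a b. winding_number (linepath a b) z"
  have par: "\<exists>k<m. j = 2 * k \<or> j = Suc (2 * k)" if "j < 2 * m" for j
    using that by (intro exI[of _ "j div 2"]) auto
  obtain M where M: "Re z < M" "\<And>k. k \<le> m \<Longrightarrow> x k < M"
  proof
    let ?M = "Max (insert (Re z) (x ` {..m})) + 1"
    have "t \<le> Max (insert (Re z) (x ` {..m}))" if "t \<in> insert (Re z) (x ` {..m})" for t
      using that by (intro Max_ge) auto
    then have *: "Re z \<le> Max (insert (Re z) (x ` {..m}))" "\<And>k. k \<le> m \<Longrightarrow> x k \<le> Max (insert (Re z) (x ` {..m}))" by blast+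
    show "Re z < ?M" using *(1) by linarith
    show "x k < ?M" if "k \<le> m" for k using *(2)[OF that] by linarith
  qed
  define r where "r j = (if even j then let k = j div 2 in if x k < Re z \<and> min (yp k) (y k) < Im z \<and> Im z < max (yp k) (y k)
      then if yp k < y k then -1 else 1 else 0 else (0::complex))" for j
  define p where "p j = Complex M (Im (q j))" for j
  have pc: "convex {u. Re u = M}"
    using convex_linear_vimage[of Re "{M}"] by (simp add: vimage_def linear_iff)
  have "(\<Sum>j<2 * m. ?L (q j) (q (Suc j))) = (\<Sum>j<2 * m. r j)"
  proof (rule telescoping_winding_sum[where p = p and q = q and L = ?L and r = r])
    fix j assume "j < 2 * m"
    then obtain k where k: "k < m" "j = 2 * k \<or> j = Suc (2 * k)" using par by blast
    from k(2) show "?L (q j) (q (Suc j)) + ?L (q (Suc j)) (p (Suc j)) - ?L (p j) (p (Suc j)) - ?L (q j) (p j) = r j"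
    proof
      assume j: "j = 2 * k"
      show ?thesis unfolding j p_def r_def
        using vertical_edge_winding[of "x k" M z "yp k" "y k"] k(1) q[of k] z[of k] M ne(2)[of k]
        by (simp add: Let_def)
    next
      assume j: "j = Suc (2 * k)"
      show ?thesis unfolding j p_def r_def
        using same_Im_edge_winding[of z "y k" "x k" "x (Suc k)" M] k(1) q[of k] q2[of k] z[of k]
        by simp
    qed
  next
    fix j show "?L (p 0) (p j) + ?L (p j) (p (Suc j)) = ?L (p 0) (p (Suc j))"
      by (rule triangle_winding_number[OF pc]) (use M in \<open>auto simp: p_def\<close>)
  qed (use cl in \<open>auto simp: p_def\<close>)
  then show "(\<Sum>j<2 * m. winding_number (linepath (q j) (q (Suc j))) z) =
      (\<Sum>k<m. if x k < Re z \<and> min (yp k) (y k) < Im z \<and> Im z < max (yp k) (y k) then if yp k < y k then -1 else 1 else 0)"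
    unfolding sum_even_odd by (simp add: r_def Let_def)
  obtain M' where M': "Im z < M'" "\<And>k. k < m \<Longrightarrow> y k < M'"
  proof
    let ?M = "Max (insert (Im z) (y ` {..<m})) + 1"
    have "t \<le> Max (insert (Im z) (y ` {..<m}))" if "t \<in> insert (Im z) (y ` {..<m})" for t
      using that by (intro Max_ge) auto
    then have *: "Im z \<le> Max (insert (Im z) (y ` {..<m}))" "\<And>k. k < m \<Longrightarrow> y k \<le> Max (insert (Im z) (y ` {..<m}))" by blast+
    show "Im z < ?M" using *(1) by linarith
    show "y k < ?M" if "k < m" for k using *(2)[OF that] by linarith
  qed
  define r' where "r' j = (if even j then (0::complex) else let k = j div 2 in
      if y k < Im z \<and> min (x k) (x (Suc k)) < Re z \<and> Re z < max (x k) (x (Suc k)) then if x k < x (Suc k) then 1 else -1 else 0)" for j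
  define p' where "p' j = Complex (Re (q j)) M'" for j
  have pc': "convex {u. Im u = M'}"
    using convex_linear_vimage[of Im "{M'}"] by (simp add: vimage_def linear_iff)
  have "(\<Sum>j<2 * m. ?L (q j) (q (Suc j))) = (\<Sum>j<2 * m. r' j)"
  proof (rule telescoping_winding_sum[where p = p' and q = q and L = ?L and r = r'])
    fix j assume "j < 2 * m"
    then obtain k where k: "k < m" "j = 2 * k \<or> j = Suc (2 * k)" using par by blast
    from k(2) show "?L (q j) (q (Suc j)) + ?L (q (Suc j)) (p' (Suc j)) - ?L (p' j) (p' (Suc j)) - ?L (q j) (p' j) = r' j"
    proof
      assume j: "j = 2 * k"
      show ?thesis unfolding j p'_def r'_def
        using same_Re_edge_winding[of z "x k" "yp k" "y k" M'] k(1) q[of k] z[of k]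
        by simp
    next
      assume j: "j = Suc (2 * k)"
      show ?thesis unfolding j p'_def r'_def
        using horizontal_edge_winding[of "y k" M' z "x k" "x (Suc k)"] k(1) q[of k] q2[of k] z[of k] z(1)[of "Suc k"] M' ne(1)[of k]
        by (simp add: Let_def)
    qed
  next
    fix j show "?L (p' 0) (p' j) + ?L (p' j) (p' (Suc j)) = ?L (p' 0) (p' (Suc j))"
      by (rule triangle_winding_number[OF pc']) (use M' in \<open>auto simp: p'_def\<close>)
  qed (use cl in \<open>auto simp: p'_def\<close>)
  then show "(\<Sum>j<2 * m. winding_number (linepath (q j) (q (Suc j))) z) =
      (\<Sum>k<m. if y k < Im z \<and> min (x k) (x (Suc k)) < Re z \<and> Re z < max (x k) (x (Suc k)) then if x k < x (Suc k) then 1 else -1 else 0)"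
    unfolding sum_even_odd by (simp add: r'_def Let_def)
qed

section \<open>The boundary of a BLS-hole\<close>

lemma prv_nxt: "i < length vs \<Longrightarrow> prv vs (nxt vs i) = i"
  by (auto simp: nxt_eq_iff prv_def)

locale bls_instance =
  fixes J H vs k L N R and w h :: int
  assumes bls: "BLS_hole J H vs"
    and ints: "\<forall>v\<in>vertices J. Re v \<in> \<int> \<and> Im v \<in> \<int>"
    and canon: "canonical_ordering J vs k L N R"
    and w0: "0 < w" and h0: "0 < h"
    and wide: "\<forall>i\<in>{2..k}. let Q = upper_vertex vs (N i); QW = first_hit_right J Q
                    in Re QW - Re Q \<ge> of_int w"
begin

definition n where "n = length vs"
text \<open>Positions are counted from the start of the rightmost edge, so vertical edges get even
  and horizontal edges odd positions.\<close>

definition ix where "ix j = (R + j) mod n"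
definition q where "q j = vs ! ix j"
definition m where "m = n div 2"
text \<open>Vertex coordinates are integral, so rounding only changes the type.\<close>

definition x :: "nat \<Rightarrow> int" where "x j = \<lfloor>Re (q (2 * j))\<rfloor>"
definition y :: "nat \<Rightarrow> int" where "y j = \<lfloor>Im (q (Suc (2 * j)))\<rfloor>"
abbreviation yp where "yp \<equiv> prev_height m y"
abbreviation cov where "cov \<equiv> covers x"

lemmas yp_def = prev_height_def
lemmas cov_def = covers_def

text \<open>Both coordinates of a centre are half-integral, so it avoids the boundary and can stand
  for its whole open cell.\<close>

definition centre :: "int \<Rightarrow> int \<Rightarrow> complex" where
  "centre X Y = Complex (real_of_int X + 1/2) (real_of_int Y + 1/2)"
definition cell where "cell X Y \<longleftrightarrow> centre X Y \<in> inside J"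

lemma cv: "clockwise_vertices J vs" and hole: "is_hole J H"
  using bls by (auto simp: BLS_hole_def)

lemma n3: "3 \<le> n"
  using clockwiseD(5)[OF cv] by (simp add: n_def)

lemma R: "R < n" "rightmost_edge J vs R" and R_unique: "i < n \<Longrightarrow> rightmost_edge J vs i \<Longrightarrow> i = R"
proof -
  have *: "{i. i < length vs \<and> rightmost_edge J vs i} = {R}" using canon by (simp add: canonical_ordering_def)
  then have "R \<in> {i. i < length vs \<and> rightmost_edge J vs i}" by simp
  then show "R < n" "rightmost_edge J vs R" by (auto simp: n_def)
  show "i = R" if "i < n" "rightmost_edge J vs i" using * that by (auto simp: n_def)
qed

lemma ix_less: "ix j < n"
  unfolding ix_def using n3 by (intro mod_less_divisor) simp

lemma ix_0: "ix 0 = R" using R by (simp add: ix_def)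

lemma ix_Suc: "nxt vs (ix j) = ix (Suc j)"
  by (simp add: nxt_def ix_def n_def mod_Suc_eq)

lemma prv_ix: "prv vs (ix (Suc j)) = ix j"
  using prv_nxt[of "ix j" vs] ix_less[of j] by (simp add: ix_Suc n_def)

lemma ix_add_n: "ix (j + n) = ix j"
  by (simp add: ix_def add.assoc[symmetric])

lemma ix_inj: "ix i = ix j \<Longrightarrow> i mod n = j mod n"
proof (induction i j rule: linorder_wlog)
  case (le i j)
  then have "n dvd (R + j) - (R + i)" using mod_eq_dvd_iff_nat[of "R + i" "R + j" n] by (simp add: ix_def)
  then show ?case using mod_eq_dvd_iff_nat[of i j n] le by simp
qed auto

lemma ix_surj: "i < n \<Longrightarrow> \<exists>j<n. ix j = i"
proof -
  assume i: "i < n"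
  have "ix ((i + n - R) mod n) = (R + (i + n - R)) mod n" by (simp add: ix_def mod_add_right_eq)
  also have "\<dots> = i" using i R by simp
  finally show ?thesis using n3 by (intro exI[of _ "(i + n - R) mod n"]) simp
qed

lemma seg_ix: "seg vs (ix j) = closed_segment (q j) (q (Suc j))"
  by (simp add: seg_def q_def ix_Suc)

lemma q_mem: "q j \<in> vertices J"
  using clockwiseD(2)[OF cv] ix_less[of j] by (metis n_def nth_mem q_def)

lemma q_int: "real_of_int \<lfloor>Re (q j)\<rfloor> = Re (q j)" "real_of_int \<lfloor>Im (q j)\<rfloor> = Im (q j)"
  using ints q_mem[of j] by auto

lemma J_segs: "J = (\<Union>j<n. closed_segment (q j) (q (Suc j)))"
proof -
  have "{..<n} = ix ` {..<n}" using ix_less ix_surj by (auto simp: image_iff)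
  then have "(\<Union>i<n. seg vs i) = (\<Union>j<n. seg vs (ix j))" by (metis image_image)
  then show ?thesis using boundary_segs[OF cv] by (simp add: n_def seg_ix)
qed

lemma q_sub: "closed_segment (q j) (q (Suc j)) \<subseteq> J"
  using boundary_segs[OF cv] ix_less[of j] by (auto simp: n_def seg_ix[symmetric])

lemma q_ne: "q j \<noteq> q (Suc j)"
proof
  assume "q j = q (Suc j)"
  then have "ix j = ix (Suc j)"
    using clockwiseD(1)[OF cv] ix_less[of j] ix_less[of "Suc j"]
    by (simp add: q_def nth_eq_iff_index_eq n_def)
  then have "ix j = nxt vs (ix j)" by (rule trans[OF _ ix_Suc[symmetric]])
  then show False using ix_less[of j] n3 by (auto simp: nxt_eq_iff n_def split: if_splits)
qed

lemma q_axis: "Re (q j) = Re (q (Suc j)) \<or> Im (q j) = Im (q (Suc j))"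
proof -
  obtain \<S> where "finite \<S>" "J = \<Union>\<S>" "\<forall>S\<in>\<S>. \<exists>a b. S = closed_segment a b \<and> (Re a = Re b \<or> Im a = Im b)"
    using hole unfolding is_hole_def closed_rectilinear_arc_def by blast
  then show ?thesis using q_sub[of j] by (intro axis_parallel_segment[of \<S>]) auto
qed

lemma q_turn: "\<not> (Re (q j) = Re (q (Suc j)) \<and> Re (q (Suc j)) = Re (q (Suc (Suc j))))"
  "\<not> (Im (q j) = Im (q (Suc j)) \<and> Im (q (Suc j)) = Im (q (Suc (Suc j))))"
  using not_straight[OF cv, of "ix j" Re] not_straight[OF cv, of "ix j" Im] ix_less[of j]
    collinear_Re collinear_Im
  by (auto simp: ix_Suc q_def n_def linear_iff)

text \<open>Consecutive edges are axis-parallel and never aligned, so the directions alternate,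
  beginning with the vertical edge \<open>R\<close>.\<close>

lemma q_parity: "(even j \<longrightarrow> Re (q j) = Re (q (Suc j))) \<and> (odd j \<longrightarrow> Im (q j) = Im (q (Suc j)))"
proof (induction j)
  case 0
  have "vertical vs R" using R by (simp add: rightmost_edge_def)
  then show ?case by (simp add: vertical_def q_def ix_0 ix_Suc[symmetric])
next
  case (Suc j)
  then show ?case using q_axis[of "Suc j"] q_turn[of j] by auto
qed

lemma q_add_n: "q (j + n) = q j" by (simp add: q_def ix_add_n)

text \<open>With an odd number of edges, alternation around the cycle would make the rightmost edge
  horizontal as well.\<close>

lemma n_even: "n = 2 * m"
proof (rule ccontr)
  assume "n \<noteq> 2 * m"
  then have "odd n" by (auto simp: m_def)
  then have "Im (q n) = Im (q (Suc n))" using q_parity by blast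
  moreover have "q n = q 0" "q (Suc n) = q (Suc 0)" using q_add_n[of 0] q_add_n[of 1] by auto
  moreover have "Re (q 0) = Re (q (Suc 0))" using q_parity[of 0] by simp
  ultimately show False using q_ne[of 0] by (simp add: complex_eq_iff)
qed

lemma m2: "2 \<le> m" using n3 n_even by simp

lemma Re_even: "Re (q (2 * j)) = x j" and Re_odd: "Re (q (Suc (2 * j))) = x j"
  and Im_odd: "Im (q (Suc (2 * j))) = y j" and Im_even: "Im (q (Suc (Suc (2 * j)))) = y j"
proof -
  show 1: "Re (q (2 * j)) = x j" "Im (q (Suc (2 * j))) = y j" by (simp_all only: x_def y_def q_int)
  show "Re (q (Suc (2 * j))) = x j" "Im (q (Suc (Suc (2 * j)))) = y j"
    using q_parity[of "2 * j"] q_parity[of "Suc (2 * j)"] 1 by auto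
qed

lemma q_odd: "q (Suc (2 * j)) = Complex (x j) (y j)"
  by (simp add: complex_eq_iff Re_odd Im_odd)

lemma q_even: "j \<le> m \<Longrightarrow> q (2 * j) = Complex (x j) (yp j)"
proof (cases j)
  case 0
  have "q 0 = q (Suc (Suc (2 * (m - 1))))" using q_add_n[of 0] n_even m2
    by (metis Suc_1 Suc_diff_1 Suc_le_lessD add_0 mult_Suc_right add_2_eq_Suc less_le_trans pos2)
  then have "Im (q 0) = y (m - 1)" using Im_even by simp
  then show ?thesis using 0 Re_even[of 0] by (simp add: complex_eq_iff yp_def)
next
  case (Suc i)
  then show ?thesis using Re_even[of j] Im_even[of i] by (simp add: complex_eq_iff yp_def)
qed

lemma x_close: "x m = x 0"
  using q_add_n[of 0] n_even by (simp add: x_def)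

lemma x_ne: "x j \<noteq> x (Suc j)"
  using q_ne[of "Suc (2 * j)"] Re_odd[of j] Im_odd[of j] Im_even[of j] Re_even[of "Suc j"]
  by (auto simp: complex_eq_iff)

lemma y_ne: "j \<le> m \<Longrightarrow> yp j \<noteq> y j"
  using q_ne[of "2 * j"] q_even[of j] q_odd[of j] by auto

lemma V_seg: "j \<le> m \<Longrightarrow> closed_segment (q (2 * j)) (q (Suc (2 * j))) =
    {z. Re z = x j \<and> real_of_int (min (yp j) (y j)) \<le> Im z \<and> Im z \<le> real_of_int (max (yp j) (y j))}"
  by (auto simp: q_even q_odd closed_segment_same_Re closed_segment_eq_real_ivl)

lemma H_seg: "closed_segment (q (Suc (2 * j))) (q (Suc (Suc (2 * j)))) =
    {z. Im z = y j \<and> real_of_int (min (x j) (x (Suc j))) \<le> Re z \<and> Re z \<le> real_of_int (max (x j) (x (Suc j)))}"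
proof -
  have "q (Suc (Suc (2 * j))) = Complex (x (Suc j)) (y j)"
    using Re_even[of "Suc j"] Im_even[of j] by (simp add: complex_eq_iff)
  then show ?thesis by (auto simp: q_odd closed_segment_same_Im closed_segment_eq_real_ivl)
qed

lemma J_cases:
  assumes "z \<in> J"
  obtains j where "j < m" "Re z = x j" "real_of_int (min (yp j) (y j)) \<le> Im z" "Im z \<le> real_of_int (max (yp j) (y j))"
  | j where "j < m" "Im z = y j" "real_of_int (min (x j) (x (Suc j))) \<le> Re z" "Re z \<le> real_of_int (max (x j) (x (Suc j)))"
proof -
  obtain i where i: "i < n" "z \<in> closed_segment (q i) (q (Suc i))" using assms J_segs by auto
  show thesis
  proof (cases "even i")
    case True
    then obtain j where j: "i = 2 * j" by blast
    then have "j < m" using i n_even by simp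
    then show ?thesis using i(2) V_seg[of j] that(1)[of j] unfolding j by auto
  next
    case False
    then obtain j where j: "i = Suc (2 * j)" by (auto elim: oddE)
    then have "j < m" using i n_even by simp
    then show ?thesis using i(2) H_seg[of j] that(2)[of j] unfolding j by auto
  qed
qed

lemma V_in_J: "j \<le> m \<Longrightarrow> real_of_int (min (yp j) (y j)) \<le> v \<Longrightarrow> v \<le> real_of_int (max (yp j) (y j)) \<Longrightarrow> Complex (x j) v \<in> J"
  using q_sub[of "2 * j"] V_seg[of j] by auto

lemma q_meet:
  assumes "i < n" "j < n" "i \<noteq> j" "z \<in> closed_segment (q i) (q (Suc i))" "z \<in> closed_segment (q j) (q (Suc j))"
  shows "j = Suc i mod n \<and> z = q j \<or> i = Suc j mod n \<and> z = q i"
proof -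
  have "ix i \<noteq> ix j" using ix_inj[of i j] assms by auto
  then have "ix j = ix (Suc i) \<and> z = q j \<or> ix i = ix (Suc j) \<and> z = q i"
    using segs_meet[OF cv, of "ix i" "ix j" z] ix_less[of i] ix_less[of j] assms
    by (simp add: seg_ix n_def[symmetric] ix_Suc q_def)
  then show ?thesis using ix_inj[of j "Suc i"] ix_inj[of i "Suc j"] assms by auto
qed

text \<open>Edges with a common point are neighbours, but horizontal edges all have odd positions in
  a cycle of even length.\<close>

lemma horizontals_disjoint:
  assumes "i < m" "j < m" "i \<noteq> j" "min (x i) (x (Suc i)) \<le> X" "X \<le> max (x i) (x (Suc i))"
    "min (x j) (x (Suc j)) \<le> X" "X \<le> max (x j) (x (Suc j))"
  shows "y i \<noteq> y j"
proof
  assume "y i = y j"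
  let ?z = "Complex X (y i)"
  have "?z \<in> closed_segment (q (Suc (2 * i))) (q (Suc (Suc (2 * i))))"
    "?z \<in> closed_segment (q (Suc (2 * j))) (q (Suc (Suc (2 * j))))"
    unfolding H_seg using assms \<open>y i = y j\<close> by auto
  then have "Suc (2 * j) = Suc (Suc (2 * i)) mod n \<or> Suc (2 * i) = Suc (Suc (2 * j)) mod n"
    using q_meet[of "Suc (2 * i)" "Suc (2 * j)" ?z] assms n_even by auto
  moreover have "even (Suc (Suc (2 * i)) mod n)" for i unfolding n_even by (simp add: dvd_mod)
  ultimately show False by (metis even_Suc even_mult_iff even_two_times_div_two dvd_triv_left)
qed

lemma verticals_disjoint:
  assumes "i < m" "j < m" "i \<noteq> j" "x i = x j" "min (yp i) (y i) \<le> Y" "Y \<le> max (yp i) (y i)"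
    "min (yp j) (y j) \<le> Y" "Y \<le> max (yp j) (y j)"
  shows False
proof -
  let ?z = "Complex (x i) Y"
  have "?z \<in> closed_segment (q (2 * i)) (q (Suc (2 * i)))"
    "?z \<in> closed_segment (q (2 * j)) (q (Suc (2 * j)))"
    using assms V_seg[of i] V_seg[of j] by auto
  then have "2 * j = Suc (2 * i) mod n \<or> 2 * i = Suc (2 * j) mod n"
    using q_meet[of "2 * i" "2 * j" ?z] assms n_even by auto
  moreover have "Suc (2 * i) mod n = Suc (2 * i)" if "i < m" for i using n_even that by simp
  ultimately have "2 * j = Suc (2 * i) \<or> 2 * i = Suc (2 * j)" using assms by simp
  then show False by presburger
qed

lemma vertical_horizontal_disjoint:
  assumes "i < m" "l < m" "i \<noteq> l" "l \<noteq> Suc i" "l \<noteq> 0 \<or> i \<noteq> m - 1"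
    "min (x i) (x (Suc i)) \<le> x l" "x l \<le> max (x i) (x (Suc i))"
    "min (yp l) (y l) \<le> y i" "y i \<le> max (yp l) (y l)"
  shows False
proof -
  let ?z = "Complex (x l) (y i)"
  have "?z \<in> closed_segment (q (2 * l)) (q (Suc (2 * l)))"
    "?z \<in> closed_segment (q (Suc (2 * i))) (q (Suc (Suc (2 * i))))"
    using assms V_seg[of l] H_seg[of i] by auto
  moreover have "2 * l \<noteq> Suc (2 * i)" by presburger
  ultimately have "Suc (2 * i) = Suc (2 * l) mod n \<or> 2 * l = Suc (Suc (2 * i)) mod n"
    using q_meet[of "2 * l" "Suc (2 * i)" ?z] assms n_even by auto
  moreover have "Suc (2 * l) mod n = Suc (2 * l)" using n_even assms by simp
  moreover have "Suc (Suc (2 * i)) mod n = (if i = m - 1 then 0 else Suc (Suc (2 * i)))"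
  proof (cases "i = m - 1")
    case True
    then have "Suc (Suc (2 * i)) = n" using n_even m2 by simp
    then show ?thesis using True by simp
  next
    case False
    then show ?thesis using n_even assms by auto
  qed
  ultimately show False using assms by (auto split: if_splits)
qed

section \<open>Winding numbers of cell centres\<close>

lemma centre_notin_J: "Re z \<notin> \<int> \<Longrightarrow> Im z \<notin> \<int> \<Longrightarrow> z \<notin> J"
  by (auto elim!: J_cases)

lemma half_notin: "real_of_int X + 1/2 \<noteq> real_of_int Y"
proof
  assume "real_of_int X + 1/2 = real_of_int Y"
  then have "real_of_int (2 * X + 1) = real_of_int (2 * Y)" by simp
  then have "2 * X + 1 = 2 * Y" by (simp only: of_int_eq_iff)
  then show False by presburger
qed

lemma half_less: "real_of_int Y < real_of_int X + 1/2 \<longleftrightarrow> Y \<le> X" "real_of_int X + 1/2 < real_of_int Y \<longleftrightarrow> X < Y"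
  by linarith+

lemma centre_J: "centre X Y \<notin> J"
  using half_notin by (intro centre_notin_J) (auto simp: centre_def elim!: Ints_cases)

definition WN where "WN X Y = winding_number (polygonal_path (vs @ [hd vs])) (centre X Y)"

lemma WN_sum: "WN X Y = (\<Sum>j<2 * m. winding_number (linepath (q j) (q (Suc j))) (centre X Y))"
proof -
  let ?z = "centre X Y"
  let ?ps = "vs @ [hd vs]"
  have "WN X Y = (\<Sum>i<length ?ps - 1. winding_number (linepath (?ps ! i) (?ps ! Suc i)) ?z)"
    unfolding WN_def using clockwiseD(4,5)[OF cv] centre_J by (intro winding_number_polygonal) auto
  also have "\<dots> = (\<Sum>i<n. winding_number (linepath (vs ! i) (vs ! nxt vs i)) ?z)"
    using nth_snoc_nxt by (simp add: n_def)
  also have "\<dots> = (\<Sum>j<n. winding_number (linepath (vs ! ix j) (vs ! nxt vs (ix j))) ?z)"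
    unfolding ix_def using n3 by (intro sum_cyclic_shift[symmetric]) simp
  finally show ?thesis by (simp add: ix_Suc q_def n_even[symmetric])
qed

lemma WN_rows: "WN X Y = (\<Sum>j<m. if x j \<le> X \<and> min (yp j) (y j) \<le> Y \<and> Y < max (yp j) (y j) then if yp j < y j then -1 else 1 else 0)"
  and WN_cols: "WN X Y = (\<Sum>j<m. if y j \<le> Y \<and> cov j X then if x j < x (Suc j) then 1 else -1 else 0)"
proof -
  note rw = rectilinear_winding[of m q "\<lambda>j. real_of_int (x j)" "\<lambda>j. real_of_int (yp j)" "\<lambda>j. real_of_int (y j)" "centre X Y"]
  have *: "q (2 * m) = q 0" using q_add_n[of 0] n_even by simp
  have yps: "real_of_int (yp (Suc j)) = real_of_int (y j)" for j by (simp add: yp_def)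
  show "WN X Y = (\<Sum>j<m. if x j \<le> X \<and> min (yp j) (y j) \<le> Y \<and> Y < max (yp j) (y j) then if yp j < y j then -1 else 1 else 0)"
    unfolding WN_sum
    by (subst rw(1)) (use * yps q_even q_odd x_ne y_ne half_notin in \<open>auto simp: centre_def half_less of_int_min[symmetric] of_int_max[symmetric] simp del: of_int_min of_int_max intro!: sum.cong\<close>)
  show "WN X Y = (\<Sum>j<m. if y j \<le> Y \<and> cov j X then if x j < x (Suc j) then 1 else -1 else 0)"
    unfolding WN_sum
    by (subst rw(2)) (use * yps q_even q_odd x_ne y_ne half_notin in \<open>auto simp: centre_def half_less cov_def of_int_min[symmetric] of_int_max[symmetric] simp del: of_int_min of_int_max intro!: sum.cong\<close>)
qed

lemma WN_cell: "WN X Y = (if cell X Y then -1 else 0)"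
proof (cases "cell X Y")
  case True
  then show ?thesis using clockwiseD(6)[OF cv] by (simp add: WN_def cell_def)
next
  case False
  then have "centre X Y \<in> outside J"
    using centre_J[of X Y] by (metis ComplI UnE cell_def inside_Un_outside)
  then have "WN X Y = 0" unfolding WN_def
    using clockwiseD(3,4,5)[OF cv] by (intro winding_number_zero_in_outside) (auto simp: hd_append)
  then show ?thesis using False by simp
qed

lemma H_same: assumes "\<And>j. j < m \<Longrightarrow> cov j X \<Longrightarrow> y j \<noteq> Y" shows "cell X Y = cell X (Y - 1)"
proof -
  have "WN X Y = WN X (Y - 1)" unfolding WN_cols
    by (intro sum.cong) (use assms in \<open>auto simp: less_le\<close>)
  then show ?thesis unfolding WN_cell by (auto split: if_splits)
qed

lemma sum_single_diff:
  fixes f g :: "nat \<Rightarrow> complex"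
  assumes "i < m" "\<And>j. j < m \<Longrightarrow> j \<noteq> i \<Longrightarrow> f j = g j"
  shows "(\<Sum>j<m. f j) - (\<Sum>j<m. g j) = f i - g i"
proof -
  have "(\<Sum>j<m. f j) - (\<Sum>j<m. g j) = (\<Sum>j<m. f j - g j)" by (simp add: sum_subtractf)
  also have "\<dots> = (\<Sum>j\<in>{i}. f j - g j)"
    by (rule sum.mono_neutral_right) (use assms in auto)
  finally show ?thesis by simp
qed

text \<open>Between the two cells exactly one term of the count changes, by 1 or -1. As only the
  values -1 and 0 occur, the sign of the change determines both.\<close>

lemma H_hor:
  assumes "i < m" "cov i X"
  shows "cell X (y i) = (x (Suc i) < x i) \<and> cell X (y i - 1) = (x i < x (Suc i))"
proof -
  have "y j \<noteq> y i" if "j < m" "j \<noteq> i" "cov j X" for j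
    using horizontals_disjoint[of j i X] that assms by (auto simp: cov_def)
  then have "WN X (y i) - WN X (y i - 1) = (if x i < x (Suc i) then 1 else -1)"
    unfolding WN_cols by (subst sum_single_diff[OF assms(1)]) (use assms in \<open>auto simp: less_le\<close>)
  then show ?thesis unfolding WN_cell using x_ne[of i] by (auto split: if_splits)
qed

lemma H_vert:
  assumes "i < m" "min (yp i) (y i) \<le> Y" "Y < max (yp i) (y i)"
  shows "cell (x i) Y = (yp i < y i) \<and> cell (x i - 1) Y = (y i < yp i)"
proof -
  have "x j \<noteq> x i" if "j < m" "j \<noteq> i" "min (yp j) (y j) \<le> Y" "Y < max (yp j) (y j)" for j
    using verticals_disjoint[of j i Y] that assms by auto
  then have "WN (x i) Y - WN (x i - 1) Y = (if yp i < y i then -1 else 1)"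
    unfolding WN_rows by (subst sum_single_diff[OF assms(1)]) (use assms in \<open>auto simp: less_le\<close>)
  then show ?thesis unfolding WN_cell using y_ne[of i] assms by (auto split: if_splits)
qed

end

section \<open>From cells to points of the plane\<close>

lemma inside_connected:
  assumes "connected S" "S \<inter> J = {}" "a \<in> S" "b \<in> S" "a \<in> inside J"
  shows "b \<in> inside J"
proof -
  have "connected_component (- J) a b"
    using assms by (intro connected_componentI[of S]) auto
  then show ?thesis using assms(5) inside_same_component by blast
qed

lemma strictly_between_not_Int: "real_of_int X < r \<Longrightarrow> r < real_of_int X + 1 \<Longrightarrow> r \<notin> \<int>"
  by (auto elim!: Ints_cases)

context bls_instance
begin

lemma open_cell_notin_J:
  assumes "real_of_int X < Re p" "Re p < real_of_int X + 1" "real_of_int Y < Im p" "Im p < real_of_int Y + 1"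
  shows "p \<notin> J"
  by (rule centre_notin_J[OF strictly_between_not_Int[OF assms(1,2)] strictly_between_not_Int[OF assms(3,4)]])

text \<open>The segment from the centre to \<open>p\<close> stays in the open cell except possibly
  at \<open>p\<close>, so it does not meet the boundary.\<close>

lemma inside_cell:
  assumes "cell X Y" "p \<notin> J" "real_of_int X \<le> Re p" "Re p \<le> real_of_int X + 1" "real_of_int Y \<le> Im p" "Im p \<le> real_of_int Y + 1"
  shows "p \<in> inside J"
proof -
  let ?c = "centre X Y"
  have "z \<notin> J" if z: "z \<in> closed_segment ?c p" for z
  proof (cases "z = p")
    case True
    then show ?thesis using assms by simp
  next
    case False
    obtain u where u: "0 \<le> u" "u \<le> 1" "z = (1 - u) *\<^sub>R ?c + u *\<^sub>R p"
      using z by (auto simp: in_segment)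
    then have u1: "0 < 1 - u" using False by (cases "u = 1") auto
    have Re: "Re z = X + ((1 - u) * (1/2) + u * (Re p - X))" "Im z = Y + ((1 - u) * (1/2) + u * (Im p - Y))"
      unfolding u(3) by (simp_all add: centre_def field_simps)
    have b: "0 < (1 - u) * (1/2) + u * t" "(1 - u) * (1/2) + u * t < 1" if "0 \<le> t" "t \<le> 1" for t
    proof -
      have "0 \<le> u * t" "u * t \<le> u * 1" using that u by (auto intro!: mult_left_mono mult_left_le)
      moreover have "(1 - u) * (1/2) = 1/2 - u/2" by (simp add: field_simps)
      ultimately show "0 < (1 - u) * (1/2) + u * t" "(1 - u) * (1/2) + u * t < 1" using u1 by linarith+
    qed
    have "Re z \<notin> \<int>"
      by (rule strictly_between_not_Int[of X]) (use b[of "Re p - X"] assms Re in linarith)+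
    moreover have "Im z \<notin> \<int>"
      by (rule strictly_between_not_Int[of Y]) (use b[of "Im p - Y"] assms Re in linarith)+
    ultimately show ?thesis by (rule centre_notin_J)
  qed
  then have "closed_segment ?c p \<inter> J = {}" by blast
  then show ?thesis
    by (rule inside_connected[OF connected_segment(1)]) (use assms(1) in \<open>auto simp: cell_def\<close>)
qed

lemma inside_cell_iff:
  assumes "real_of_int X < Re p" "Re p < real_of_int X + 1" "real_of_int Y < Im p" "Im p < real_of_int Y + 1"
  shows "p \<in> inside J \<longleftrightarrow> cell X Y"
proof
  assume "cell X Y"
  moreover have "p \<notin> J"
    using assms by (rule open_cell_notin_J)
  ultimately show "p \<in> inside J" using assms by (intro inside_cell) auto
next
  let ?B = "box (Complex X Y) (Complex (X + 1) (Y + 1))"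
  assume "p \<in> inside J"
  moreover have "?B \<inter> J = {}"
  proof -
    have "z \<notin> J" if "z \<in> ?B" for z
      using that open_cell_notin_J[of X z Y] by (simp add: in_box_complex_iff)
    then show ?thesis by blast
  qed
  moreover have "connected ?B" by (intro convex_connected convex_box)
  ultimately show "cell X Y" unfolding cell_def
    using inside_connected[of ?B J p "centre X Y"] assms by (simp add: in_box_complex_iff centre_def)
qed

text \<open>Such a point has a non-integral abscissa, so it can only lie on a horizontal edge.
  Having integral ends, that edge would extend to \<open>x j\<close> and meet the interior of the
  vertical edge.\<close>

lemma off_vertical_edge:
  assumes "j < m" "real_of_int (min (yp j) (y j)) < v" "v < real_of_int (max (yp j) (y j))"
    and u: "real_of_int (x j) - 1 < u" "u < real_of_int (x j) + 1" "u \<noteq> x j"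
  shows "Complex u v \<notin> J"
proof
  have ui: "u \<noteq> real_of_int X" for X
  proof
    assume "u = real_of_int X"
    then have "x j - 1 < X" "X < x j + 1" "X \<noteq> x j" using u by linarith+
    then show False by linarith
  qed
  assume "Complex u v \<in> J"
  then show False
  proof (cases rule: J_cases)
    case (1 i)
    then show False using ui by simp
  next
    case (2 i)
    have "min (x i) (x (Suc i)) \<le> x j" "x j \<le> max (x i) (x (Suc i))"
      using 2 u by simp_all
    moreover have st: "min (yp j) (y j) < y i" "y i < max (yp j) (y j)" using 2 assms by simp_all
    then have "y i \<noteq> y j" "y i \<noteq> yp j" by linarith+
    then have "i \<noteq> j" "j \<noteq> Suc i" "j \<noteq> 0 \<or> i \<noteq> m - 1" by (auto simp: yp_def)
    ultimately show False using vertical_horizontal_disjoint[of i j] 2(1) assms(1) st by linarith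
  qed
qed

lemma off_horizontal_edge:
  assumes "j < m" "real_of_int (min (x j) (x (Suc j))) < u" "u < real_of_int (max (x j) (x (Suc j)))"
    and v: "real_of_int (y j) - 1 < v" "v < real_of_int (y j) + 1" "v \<noteq> y j"
  shows "Complex u v \<notin> J"
proof
  have vi: "v \<noteq> real_of_int X" for X
  proof
    assume "v = real_of_int X"
    then have "y j - 1 < X" "X < y j + 1" "X \<noteq> y j" using v by linarith+
    then show False by linarith
  qed
  assume "Complex u v \<in> J"
  then show False
  proof (cases rule: J_cases)
    case (1 i)
    have "min (yp i) (y i) \<le> y j" "y j \<le> max (yp i) (y i)"
      using 1 v by simp_all
    moreover have st: "min (x j) (x (Suc j)) < x i" "x i < max (x j) (x (Suc j))" using 1 assms by simp_all
    then have ne: "x i \<noteq> x j" "x i \<noteq> x (Suc j)" by linarith+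
    moreover have "i \<noteq> 0 \<or> j \<noteq> m - 1" using ne(2) x_close m2 by auto
    moreover have "j \<noteq> i" "i \<noteq> Suc j" using ne by auto
    ultimately show False using vertical_horizontal_disjoint[of j i] 1(1) assms(1) st by linarith
  next
    case (2 i)
    then show False using vi by simp
  qed
qed

lemma interior_vertical:
  assumes "j < m"
  shows "yp j < y j \<Longrightarrow> interior_towards J vs (ix (2 * j)) 1"
    and "y j < yp j \<Longrightarrow> interior_towards J vs (ix (2 * j)) (-1)"
proof -
  have *: "\<exists>\<epsilon>>0. \<forall>t\<in>{0<..<\<epsilon>}. z + of_real t * of_real s \<in> inside J"
    if z: "z \<in> open_segment (vs ! ix (2 * j)) (vs ! nxt vs (ix (2 * j)))"
      and s: "s = (if yp j < y j then 1 else -1)" for z s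
  proof -
    have "z \<in> open_segment (Complex (x j) (yp j)) (Complex (x j) (y j))"
      using z q_even[of j] q_odd[of j] assms by (simp add: q_def ix_Suc)
    then have "z \<in> closed_segment (Complex (x j) (yp j)) (Complex (x j) (y j))" "z \<noteq> Complex (x j) (yp j)" "z \<noteq> Complex (x j) (y j)"
      by (auto simp: open_segment_def)
    then have z: "Re z = x j" "real_of_int (min (yp j) (y j)) < Im z" "Im z < real_of_int (max (yp j) (y j))"
      by (auto simp: closed_segment_same_Re closed_segment_eq_real_ivl complex_eq_iff less_le split: if_splits)
    \<comment> \<open>Rounding down gives a row next to the edge even where \<open>z\<close> lies on
      a grid line, as \<open>z\<close> is not an end point.\<close>
    define Y where "Y = \<lfloor>Im z\<rfloor>"
    have Y: "real_of_int Y \<le> Im z" "Im z \<le> real_of_int Y + 1" "min (yp j) (y j) \<le> Y" "Y < max (yp j) (y j)"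
      using z(2,3) unfolding Y_def by linarith+
    have hv: "cell (x j) Y = (yp j < y j)" "cell (x j - 1) Y = (y j < yp j)" using H_vert[OF assms Y(3,4)] by auto
    have "z + of_real t * of_real s \<in> inside J" if t: "t \<in> {0<..<1}" for t
    proof (rule inside_cell[of "if yp j < y j then x j else x j - 1" Y])
      show "cell (if yp j < y j then x j else x j - 1) Y" using hv y_ne[of j] assms by auto
      have "Complex (Re z + t * s) (Im z) \<notin> J"
        by (rule off_vertical_edge[OF assms z(2,3)]) (use z(1) t s in auto)
      moreover have "z + of_real t * of_real s = Complex (Re z + t * s) (Im z)" by (simp add: complex_eq_iff)
      ultimately show "z + of_real t * of_real s \<notin> J" by simp
    qed (use z t s Y in auto)
    then show ?thesis by (intro exI[of _ 1]) auto
  qed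
  show "interior_towards J vs (ix (2 * j)) 1" if "yp j < y j"
    using *[of _ 1] that unfolding interior_towards_def by simp
  show "interior_towards J vs (ix (2 * j)) (-1)" if "y j < yp j"
    using *[of _ "-1"] that unfolding interior_towards_def by simp
qed

lemma interior_horizontal:
  assumes "j < m" "x j < x (Suc j)"
  shows "interior_towards J vs (ix (Suc (2 * j))) (- \<i>)"
  unfolding interior_towards_def
proof
  fix z assume z: "z \<in> open_segment (vs ! ix (Suc (2 * j))) (vs ! nxt vs (ix (Suc (2 * j))))"
  have "q (Suc (Suc (2 * j))) = Complex (x (Suc j)) (y j)"
    using Re_even[of "Suc j"] Im_even[of j] by (simp add: complex_eq_iff)
  then have "z \<in> open_segment (Complex (x j) (y j)) (Complex (x (Suc j)) (y j))"
    using z q_odd[of j] by (simp add: q_def ix_Suc)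
  then have "z \<in> closed_segment (Complex (x j) (y j)) (Complex (x (Suc j)) (y j))" "z \<noteq> Complex (x j) (y j)" "z \<noteq> Complex (x (Suc j)) (y j)"
    by (auto simp: open_segment_def)
  then have z: "Im z = y j" "real_of_int (min (x j) (x (Suc j))) < Re z" "Re z < real_of_int (max (x j) (x (Suc j)))"
    by (auto simp: closed_segment_same_Im closed_segment_eq_real_ivl complex_eq_iff less_le split: if_splits)
  define X where "X = \<lfloor>Re z\<rfloor>"
  have X: "real_of_int X \<le> Re z" "Re z \<le> real_of_int X + 1" "cov j X"
    using z(2,3) unfolding X_def cov_def by linarith+
  have c: "cell X (y j - 1)" using H_hor[OF assms(1) X(3)] assms by simp
  have "z + of_real t * (- \<i>) \<in> inside J" if t: "t \<in> {0<..<1}" for t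
  proof (rule inside_cell[OF c])
    have "Complex (Re z) (Im z - t) \<notin> J"
      by (rule off_horizontal_edge[OF assms(1) z(2,3)]) (use z(1) t in auto)
    moreover have "z + of_real t * (- \<i>) = Complex (Re z) (Im z - t)" by (simp add: complex_eq_iff)
    ultimately show "z + of_real t * (- \<i>) \<notin> J" by simp
  qed (use z t X in auto)
  then show "\<exists>\<epsilon>>0. \<forall>t\<in>{0<..<\<epsilon>}. z + of_real t * (- \<i>) \<in> inside J" by (intro exI[of _ 1]) auto
qed

lemma bounded_J: "bounded J"
  unfolding J_segs by (intro bounded_UN) (auto intro: compact_imp_bounded)

lemma H_bounded: "\<exists>C. \<forall>X Y. cell X Y \<longrightarrow> \<bar>Y\<bar> < C"
proof -
  obtain C where C: "\<And>z. z \<in> inside J \<Longrightarrow> norm z \<le> C"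
    using bounded_inside[OF bounded_J] unfolding bounded_iff by blast
  have "\<bar>Y\<bar> < \<lceil>C\<rceil> + 2" if "cell X Y" for X Y
  proof -
    have "\<bar>real_of_int Y + 1/2\<bar> \<le> C"
      using C[of "centre X Y"] that abs_Im_le_cmod[of "centre X Y"] by (simp add: cell_def centre_def)
    then show ?thesis by linarith
  qed
  then show ?thesis by blast
qed

lemma cell_right:
  assumes "\<And>j. j < m \<Longrightarrow> x j \<le> X"
  shows "\<not> cell X Y"
proof -
  have le: "x j \<le> X" if "j \<le> m" for j using assms[of j] assms[of 0] x_close m2 that by (cases "j = m") auto
  have "\<not> cov j X" if "j < m" for j
    using le[of j] le[of "Suc j"] that by (auto simp: cov_def)
  then have "WN X Y = 0" unfolding WN_cols by simp
  then show ?thesis unfolding WN_cell by (auto split: if_splits)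
qed

section \<open>Turns excluded in a BLS-hole\<close>

lemma vertical_ix: "vertical vs (ix (2 * j))"
  using Re_even[of j] Re_odd[of j] by (simp add: vertical_def ix_Suc q_def)

lemma x_prev: "0 < j \<Longrightarrow> Re (vs ! prv vs (ix (2 * j))) = x (j - 1)"
proof -
  assume "0 < j"
  then have "ix (2 * j) = ix (Suc (Suc (2 * (j - 1))))" by (cases j) auto
  then show ?thesis using prv_ix[of "Suc (2 * (j - 1))"] Re_odd[of "j - 1"] by (simp add: q_def)
qed

lemma Re_vs: "Re (vs ! ix (2 * j)) = x j" "Re (vs ! nxt vs (ix (2 * j))) = x j" "Re (vs ! nxt vs (nxt vs (ix (2 * j)))) = x (Suc j)"
  using Re_even[of j] Re_odd[of j] Re_even[of "Suc j"] by (simp_all add: ix_Suc q_def)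

lemma ix_eq_R: "j < m \<Longrightarrow> ix (2 * j) = R \<Longrightarrow> j = 0"
  using ix_inj[of "2 * j" 0] ix_0 n_even by auto

text \<open>With a descent at this turn the interior is on the left, and the vertical edge would be
  a second rightmost edge.\<close>

lemma right_left_up:
  assumes j: "0 < j" "j < m" "x (j - 1) < x j" "x (Suc j) < x j"
  shows "y (j - 1) < y j"
proof (rule ccontr)
  assume "\<not> ?thesis"
  then have dn: "y j < yp j" using y_ne[of j] j by (auto simp: yp_def)
  have "rightmost_edge J vs (ix (2 * j))"
    unfolding rightmost_edge_def adjacent_extend_left_def
    using vertical_ix interior_vertical(2)[OF j(2) dn] x_prev[OF j(1)] Re_vs[of j] j by simp
  then show False using R_unique[OF ix_less] ix_eq_R[OF j(2)] j(1) by auto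
qed

text \<open>With a descent at this turn the vertical edge would be a right notch.\<close>

lemma left_right_up:
  assumes j: "0 < j" "j < m" "x j < x (j - 1)" "x j < x (Suc j)"
  shows "y (j - 1) < y j"
proof (rule ccontr)
  assume "\<not> ?thesis"
  then have dn: "y j < yp j" using y_ne[of j] j by (auto simp: yp_def)
  have "right_notch J vs (ix (2 * j))"
    unfolding right_notch_def adjacent_extend_right_def
    using vertical_ix interior_vertical(2)[OF j(2) dn] x_prev[OF j(1)] Re_vs[of j] j by simp
  then show False using bls ix_less[of "2 * j"] by (auto simp: BLS_hole_def n_def)
qed

text \<open>A vertical edge of maximal abscissa has both neighbours on its left and no cell of the
  hole on its right. It is thus a rightmost edge, of which there is only one.\<close>

lemma x_max: "0 < j \<Longrightarrow> j < m \<Longrightarrow> x j < x 0" and y_top: "y 0 < y (m - 1)"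
proof -
  have mx: "i = 0 \<and> y 0 < yp 0" if i: "i < m" "\<And>j. j < m \<Longrightarrow> x j \<le> x i" for i
  proof -
    \<comment> \<open>Index 0 is replaced by \<open>m\<close>, so that the preceding horizontal edge
      has index \<open>i' - 1\<close> in all cases.\<close>
    define i' where "i' = (if i = 0 then m else i)"
    have le: "x j \<le> x i" if "j \<le> m" for j using i(2)[of j] i(2)[of 0] x_close m2 that by (cases "j = m") auto
    have dn: "y i < yp i"
    proof (rule ccontr)
      assume "\<not> y i < yp i"
      then have "yp i < y i" using y_ne[of i] i by auto
      then have "cell (x i) (yp i)" using H_vert[of i "yp i"] i by auto
      then show False using cell_right[of "x i"] i by auto
    qed
    have i': "0 < i'" "ix (2 * i') = ix (2 * i)" "x i' = x i" "x (i' - 1) < x i" "x (Suc i) < x i"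
    proof -
      show "0 < i'" "x i' = x i" using i m2 x_close by (auto simp: i'_def)
      show "ix (2 * i') = ix (2 * i)" using ix_add_n[of 0] n_even by (simp add: i'_def)
      show "x (Suc i) < x i" using le[of "Suc i"] x_ne[of i] i by simp
      have "x (i' - 1) \<noteq> x (Suc (i' - 1))" by (rule x_ne)
      then have "x (i' - 1) \<noteq> x i" using \<open>0 < i'\<close> \<open>x i' = x i\<close> by simp
      moreover have "i' - 1 \<le> m" using i by (auto simp: i'_def)
      ultimately show "x (i' - 1) < x i" using le[of "i' - 1"] by simp
    qed
    have "rightmost_edge J vs (ix (2 * i))"
      unfolding rightmost_edge_def adjacent_extend_left_def
      using vertical_ix interior_vertical(2)[OF i(1) dn] x_prev[OF i'(1)] Re_vs[of i] i' by simp
    then have "i = 0" using R_unique[OF ix_less] ix_eq_R[OF i(1)] by auto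
    then show ?thesis using dn by simp
  qed
  have "finite (x ` {..<m})" "x ` {..<m} \<noteq> {}" using m2 by (auto simp: lessThan_empty_iff)
  then have "Max (x ` {..<m}) \<in> x ` {..<m}" by (rule Max_in)
  then obtain i where i: "i < m" "x i = Max (x ` {..<m})" by (metis imageE lessThan_iff)
  then have Max: "x j \<le> x i" if "j < m" for j using that by auto
  then have i0: "i = 0" "y 0 < yp 0" using mx i by auto
  show "x j < x 0" if "0 < j" "j < m"
  proof (rule ccontr)
    assume "\<not> ?thesis"
    then have "\<And>l. l < m \<Longrightarrow> x l \<le> x j" using Max i0 by force
    then show False using mx[of j] that by simp
  qed
  show "y 0 < y (m - 1)" using i0 by (simp add: yp_def)
qed

lemma falling_ix:
  assumes "0 < j" "j < m" "y j < y (j - 1)" "x j < x (Suc j)"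
  shows "falling_corner vs (ix (Suc (2 * j)))"
  unfolding falling_corner_def prv_ix downward_def rightward_def horizontal_def
  using vertical_ix[of j] q_even[of j] q_odd[of j] Re_even[of "Suc j"] Im_even[of j] assms
  by (simp add: ix_Suc q_def yp_def)

text \<open>A drop between two rightward edges is a falling corner. If the boundary rises at the
  next vertical edge there is a top notch; if it descends, the edge after it must again go right,
  which gives a second falling corner.\<close>

lemma right_right_up:
  assumes j: "0 < j" "Suc j < m" "x (j - 1) < x j" "x j < x (Suc j)"
  shows "y (j - 1) < y j"
proof (rule ccontr)
  assume "\<not> ?thesis"
  then have dn: "y j < y (j - 1)" using y_ne[of j] j by (auto simp: yp_def)
  then have f: "falling_corner vs (ix (Suc (2 * j)))" using falling_ix[of j] j by simp
  have dn': "y (Suc j) < y j"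
  proof (rule ccontr)
    assume "\<not> ?thesis"
    then have up: "y j < y (Suc j)" using y_ne[of "Suc j"] j by (auto simp: yp_def)
    have "top_notch J vs (ix (Suc (2 * j)))"
      unfolding top_notch_def horizontal_def adjacent_extend_above_def prv_ix
      using interior_horizontal[of j] j dn up q_even[of j] q_odd[of j] Re_even[of "Suc j"] Im_even[of j] q_odd[of "Suc j"]
      by (simp add: ix_Suc q_def yp_def)
    then show False using bls ix_less[of "Suc (2 * j)"] by (auto simp: BLS_hole_def n_def)
  qed
  have "x (Suc j) < x (Suc (Suc j))"
    using right_left_up[of "Suc j"] x_ne[of "Suc j"] dn' j by force
  then have f': "falling_corner vs (ix (Suc (2 * Suc j)))" using falling_ix[of "Suc j"] j dn' by simp
  have "ix (Suc (2 * j)) \<noteq> ix (Suc (2 * Suc j))"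
    using ix_inj[of "Suc (2 * j)" "Suc (2 * Suc j)"] n_even j by auto
  then have "2 \<le> card {ix (Suc (2 * j)), ix (Suc (2 * Suc j))}" by simp
  also have "\<dots> \<le> card {i. i < length vs \<and> falling_corner vs i}"
    using f f' ix_less by (intro card_mono) (auto simp: n_def[symmetric])
  finally show False using bls by (simp add: BLS_hole_def)
qed

definition xD where "xD = (if y (m - 1) < y (m - 2) then x (m - 1) else x 0)"

text \<open>The turns excluded above leave a descent before a rightward edge only where that edge is
  the last one.\<close>

lemma falling_iff:
  assumes "i < n"
  shows "falling_corner vs i \<longleftrightarrow> y (m - 1) < y (m - 2) \<and> i = ix (Suc (2 * (m - 1)))"
proof
  have m1: "m - 1 - 1 = m - 2" "Suc (m - 1) = m" using m2 by auto
  assume *: "y (m - 1) < y (m - 2) \<and> i = ix (Suc (2 * (m - 1)))"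
  have "y (m - 1) < y (m - 1 - 1)" "x (m - 1) < x (Suc (m - 1))"
    using * x_max[of "m - 1"] x_close m2 unfolding m1 by auto
  then show "falling_corner vs i"
    using falling_ix[of "m - 1"] m2 * by simp
next
  assume f: "falling_corner vs i"
  obtain l where l: "l < n" "ix l = i" using ix_surj assms by blast
  have r: "Im (q l) = Im (q (Suc l))" "Re (q l) < Re (q (Suc l))"
    using f l unfolding falling_corner_def rightward_def horizontal_def by (auto simp: ix_Suc[symmetric] q_def)
  have "odd l"
  proof
    assume "even l"
    then show False using q_parity[of l] r by simp
  qed
  then obtain j where j: "l = Suc (2 * j)" by (auto elim: oddE)
  have jm: "j < m" using l j n_even by simp
  have xx: "x j < x (Suc j)" using r Re_odd[of j] Re_even[of "Suc j"] unfolding j by simp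
  have "j \<noteq> 0" using xx x_max[of 1] m2 by (intro notI) simp
  have "downward vs (ix (2 * j))" using f l j prv_ix[of "2 * j"] by (auto simp: falling_corner_def)
  then have dn: "y j < y (j - 1)"
    using q_even[of j] q_odd[of j] jm \<open>j \<noteq> 0\<close> by (simp add: downward_def ix_Suc q_def yp_def)
  have "x (j - 1) \<noteq> x j" using x_ne[of "j - 1"] \<open>j \<noteq> 0\<close> by simp
  then have "x (j - 1) < x j" using left_right_up[of j] \<open>j \<noteq> 0\<close> jm xx dn by force
  then have "\<not> Suc j < m" using right_right_up[of j] \<open>j \<noteq> 0\<close> xx dn by force
  then have "j = m - 1" using jm by simp
  then show "y (m - 1) < y (m - 2) \<and> i = ix (Suc (2 * (m - 1)))" using dn l j m2 by (simp add: numeral_2_eq_2)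
qed

text \<open>The canonical list contains every left notch. None of them is an \<open>L i\<close>,
  because the neighbours of a leftmost edge extend to the other side.\<close>

lemma notch_canonical:
  assumes j: "0 < j" "j < m" and ln: "left_notch J vs (ix (2 * j))"
  shows "\<exists>i\<in>{2..k}. N i = ix (2 * j)"
proof -
  let ?P = "\<lambda>i. leftmost_edge J vs i \<or> left_notch J vs i"
  define C where "C = concat (map (\<lambda>i. [N i, L i]) [2..<Suc k])"
  define F where "F = filter ?P (map (\<lambda>j. (R + j) mod length vs) [1..<length vs])"
  have "canonical_list k L N R = F @ [R]"
    using canon unfolding canonical_ordering_def F_def by blast
  then have "(L 1 # C) @ [R] = F @ [R]" unfolding canonical_list_def C_def[symmetric] append_Cons .
  then have "L 1 # C = F" unfolding append_same_eq .
  moreover have "ix (2 * j) \<in> set F"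
  proof -
    have "2 * j \<in> set [1..<length vs]" using j n_even by (simp add: n_def[symmetric])
    then have "ix (2 * j) \<in> set (map (\<lambda>j. (R + j) mod length vs) [1..<length vs])"
      unfolding set_map ix_def n_def by (rule imageI)
    then show ?thesis unfolding F_def set_filter using ln by blast
  qed
  moreover have "set C = (\<Union>i\<in>{2..k}. {N i, L i})" unfolding C_def by (simp add: atLeastLessThanSuc_atLeastAtMost del: upt_Suc)
  ultimately have "ix (2 * j) \<in> insert (L 1) (\<Union>i\<in>{2..k}. {N i, L i})" by (metis list.simps(15))
  then consider "ix (2 * j) = L 1" | i where "i \<in> {2..k}" "ix (2 * j) = N i \<or> ix (2 * j) = L i" by blast
  then show ?thesis
  proof cases
    case 1
    have "leftmost_edge J vs (L 1)" using canon by (simp add: canonical_ordering_def)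
    then show ?thesis using 1 ln by (auto simp: leftmost_edge_def left_notch_def adjacent_extend_left_def adjacent_extend_right_def)
  next
    case 2
    have "leftmost_edge J vs (L i)" using canon 2 by (simp add: canonical_ordering_def)
    then have "ix (2 * j) \<noteq> L i"
      using ln by (auto simp: leftmost_edge_def left_notch_def adjacent_extend_left_def adjacent_extend_right_def)
    then show ?thesis using 2 by auto
  qed
qed

text \<open>The vertical edge \<open>l\<close> would contain a boundary point on the ray at distance
  less than \<open>w\<close>, which bounds the infimum in \<open>first_hit_right\<close>.\<close>

lemma QW:
  assumes j: "0 < j" "j < m" "x (j - 1) < x j" "x (Suc j) < x j" and l: "l < m" "x j < x l" "x l < x j + w"
    and "min (yp l) (y l) \<le> y j" "y j \<le> max (yp l) (y l)"
  shows False
proof -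
  have up: "yp j < y j" using right_left_up[OF j] j by (simp add: yp_def)
  have "left_notch J vs (ix (2 * j))"
    unfolding left_notch_def adjacent_extend_left_def
    using vertical_ix interior_vertical(1)[OF j(2) up] x_prev[OF j(1)] Re_vs[of j] j by simp
  then obtain i where i: "i \<in> {2..k}" "N i = ix (2 * j)" using notch_canonical j by blast
  have Q: "upper_vertex vs (N i) = Complex (x j) (y j)"
    using up q_even[of j] q_odd[of j] j by (simp add: i upper_vertex_def ix_Suc q_def)
  let ?S = "{u. real_of_int (x j) < u \<and> Complex u (y j) \<in> J}"
  have "real_of_int w \<le> Inf ?S - x j"
    using bspec[OF wide i(1)] unfolding Q first_hit_right_def Let_def by simp
  moreover have "Inf ?S \<le> x l"
  proof -
    have "real_of_int (x l) \<in> ?S" using l V_in_J[of l "y j"] assms by simp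
  moreover have "bdd_below ?S" by (rule bdd_belowI[of _ "real_of_int (x j)"]) auto
  ultimately show ?thesis by (intro cInf_lower)
  qed
  ultimately show False using l by linarith
qed

lemma chain: "boundary_chain m x y cell w h xD"
proof
  show "2 \<le> m" "0 < w" "0 < h" by (rule m2 w0 h0)+
  show "x m = x 0" by (rule x_close)
  show "x j < x 0" if "0 < j" "j < m" for j using x_max that by blast
  show "x j \<noteq> x (Suc j)" for j by (rule x_ne)
  show "y 0 < y (m - 1)" by (rule y_top)
  show "y (j - 1) < y j" if "0 < j" "j < m" "x j < x (j - 1)" "x j < x (Suc j)" for j by (rule left_right_up[OF that])
  show "y (j - 1) < y j" if "0 < j" "j < m" "x (j - 1) < x j" "x (Suc j) < x j" for j by (rule right_left_up[OF that])
  show "y (j - 1) < y j" if "0 < j" "Suc j < m" "x (j - 1) < x j" "x j < x (Suc j)" for j by (rule right_right_up[OF that])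
  show "xD = (if y (m - 1) < y (m - 2) then x (m - 1) else x 0)" by (rule xD_def)
  show "y (m - 1) \<noteq> y (m - 2)" using y_ne[of "m - 1"] m2 by (auto simp: yp_def numeral_2_eq_2)
  show "cell X (y j) \<and> \<not> cell X (y j - 1)" if "j < m" "x (Suc j) \<le> X" "X < x j" for j X
    using H_hor[of j X] that by (auto simp: cov_def)
  show "\<not> cell X (y j) \<and> cell X (y j - 1)" if "j < m" "x j \<le> X" "X < x (Suc j)" for j X
    using H_hor[of j X] that by (auto simp: cov_def)
  show "cell (x j) Y = (yp j < y j) \<and> cell (x j - 1) Y = (y j < yp j)"
    if "j < m" "min (yp j) (y j) \<le> Y" "Y < max (yp j) (y j)" for j Y
    by (rule H_vert[OF that])
  show "\<exists>C. \<forall>X Y. cell X Y \<longrightarrow> \<bar>Y\<bar> < C" by (rule H_bounded)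
  show "cell X Y = cell X (Y - 1)" if "\<And>j. j < m \<Longrightarrow> cov j X \<Longrightarrow> y j \<noteq> Y" for X Y
    by (rule H_same) (rule that)
  show "y i \<noteq> y j" if "i < m" "j < m" "i \<noteq> j" "min (x i) (x (Suc i)) \<le> X" "X \<le> max (x i) (x (Suc i))"
    "min (x j) (x (Suc j)) \<le> X" "X \<le> max (x j) (x (Suc j))" for i j X
    by (rule horizontals_disjoint[OF that])
  show False if "i < m" "l < m" "i \<noteq> l" "l \<noteq> Suc i" "l \<noteq> 0 \<or> i \<noteq> m - 1"
    "min (x i) (x (Suc i)) \<le> x l" "x l \<le> max (x i) (x (Suc i))"
    "min (yp l) (y l) \<le> y i" "y i \<le> max (yp l) (y l)" for i l
    by (rule vertical_horizontal_disjoint[OF that])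
  show False if "0 < j" "j < m" "x (j - 1) < x j" "x (Suc j) < x j" "l < m" "x j < x l" "x l < x j + w"
    "min (yp l) (y l) \<le> y j" "y j \<le> max (yp l) (y l)" for j l
    by (rule QW[OF that])
qed

end

context bls_instance
begin

sublocale chain: boundary_chain m x y cell w h xD
  by (rule chain)

section \<open>Feasible and stable locations in terms of cells\<close>

lemma hole_eq: "H = J \<union> inside J"
  using hole by (simp add: is_hole_def)

text \<open>The relevant cells are those whose interior meets that of the rectangle. Each such
  overlap contains points off the boundary, and the corresponding closed cells cover the closed
  rectangle.\<close>

lemma feasible_cells:
  "feasible H w h p \<longleftrightarrow> (\<forall>X Y. real_of_int X < Re p + w \<and> Re p < real_of_int X + 1 \<and> real_of_int Y < Im p + h \<and> Im p < real_of_int Y + 1 \<longrightarrow> cell X Y)"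
proof (intro iffI allI impI)
  fix X Y
  assume f: "feasible H w h p"
    and XY: "real_of_int X < Re p + w \<and> Re p < real_of_int X + 1 \<and> real_of_int Y < Im p + h \<and> Im p < real_of_int Y + 1"
  \<comment> \<open>The midpoint of the overlap of the rectangle with the cell.\<close>
  define z where "z = Complex ((max X (Re p) + min (X + 1) (Re p + w)) / 2) ((max Y (Im p) + min (Y + 1) (Im p + h)) / 2)"
  have z: "real_of_int X < Re z" "Re z < real_of_int X + 1" "real_of_int Y < Im z" "Im z < real_of_int Y + 1"
    "Re p \<le> Re z" "Re z \<le> Re p + w" "Im p \<le> Im z" "Im z \<le> Im p + h"
    using XY w0 h0 by (auto simp: z_def max_def min_def field_simps)
  then have "z \<in> H" using f unfolding feasible_def by auto
  moreover have "z \<notin> J" using z(1-4) by (rule open_cell_notin_J)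
  ultimately have "z \<in> inside J" by (simp add: hole_eq)
  then show "cell X Y" using inside_cell_iff z by simp
next
  assume c: "\<forall>X Y. real_of_int X < Re p + w \<and> Re p < real_of_int X + 1 \<and> real_of_int Y < Im p + h \<and> Im p < real_of_int Y + 1 \<longrightarrow> cell X Y"
  show "feasible H w h p" unfolding feasible_def
  proof
    fix z assume z: "z \<in> {z. Re z \<in> {Re p..Re p + w} \<and> Im z \<in> {Im p..Im p + h}}"
    \<comment> \<open>At the lower end \<open>t = a\<close> the unit interval has to begin at or
      before \<open>t\<close> and extend beyond it; elsewhere the one that ends at or after
      \<open>t\<close> and starts strictly before it is taken.\<close>
    have ex: "\<exists>X. real_of_int X < a + d \<and> a < real_of_int X + 1 \<and> real_of_int X \<le> t \<and> t \<le> real_of_int X + 1"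
      if "a \<le> t" "t \<le> a + d" "0 < d" for a t d :: real
    proof (cases "t = a")
      case True
      then show ?thesis using that by (intro exI[of _ "\<lfloor>a\<rfloor>"]) linarith
    next
      case False
      then show ?thesis using that by (intro exI[of _ "\<lceil>t\<rceil> - 1"]) linarith
    qed
    obtain X where X: "real_of_int X < Re p + w" "Re p < real_of_int X + 1" "real_of_int X \<le> Re z" "Re z \<le> real_of_int X + 1"
      using ex[of "Re p" "Re z" w] z w0 by auto
    obtain Y where Y: "real_of_int Y < Im p + h" "Im p < real_of_int Y + 1" "real_of_int Y \<le> Im z" "Im z \<le> real_of_int Y + 1"
      using ex[of "Im p" "Im z" h] z h0 by auto
    have "cell X Y" using c X Y by blast
    then show "z \<in> H" using inside_cell[of X Y z] X Y by (auto simp: hole_eq)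
  qed
qed

lemma int_window: "real_of_int X' < real_of_int X + d \<and> real_of_int X < real_of_int X' + 1 \<longleftrightarrow> X \<le> X' \<and> X' < X + d"
  for X X' d :: int
  by linarith

lemma int_window_shift:
  "0 < t \<Longrightarrow> t < 1 \<Longrightarrow> real_of_int X' < real_of_int X - t + d \<and> real_of_int X - t < real_of_int X' + 1 \<longleftrightarrow> X - 1 \<le> X' \<and> X' < X + d"
  for X X' d :: int
  by linarith

lemma feasible_int:
  "feasible H w h (Complex (real_of_int X) (real_of_int Y)) \<longleftrightarrow>
    (\<forall>X' Y'. X \<le> X' \<and> X' < X + w \<and> Y \<le> Y' \<and> Y' < Y + h \<longrightarrow> cell X' Y')"
  unfolding feasible_cells complex.sel using int_window[of _ X w] int_window[of _ Y h] by blast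

lemma feasible_left:
  assumes "0 < t" "t < 1"
  shows "feasible H w h (Complex (real_of_int X - t) (real_of_int Y)) \<longleftrightarrow>
    (\<forall>X' Y'. X - 1 \<le> X' \<and> X' < X + w \<and> Y \<le> Y' \<and> Y' < Y + h \<longrightarrow> cell X' Y')"
  unfolding feasible_cells complex.sel using int_window_shift[OF assms, of _ X w] int_window[of _ Y h] by blast

lemma feasible_down:
  assumes "0 < t" "t < 1"
  shows "feasible H w h (Complex (real_of_int X) (real_of_int Y - t)) \<longleftrightarrow>
    (\<forall>X' Y'. X \<le> X' \<and> X' < X + w \<and> Y - 1 \<le> Y' \<and> Y' < Y + h \<longrightarrow> cell X' Y')"
  unfolding feasible_cells complex.sel using int_window_shift[OF assms, of _ Y h] int_window[of _ X w] by blast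

text \<open>From an integral location, every shift by less than 1 adds the same cells, namely column
  \<open>X - 1\<close> or row \<open>Y - 1\<close>; so the bound on the shift in
  \<open>BL_stable\<close> is immaterial below 1.\<close>

lemma stable_feasible:
  assumes "feasible H w h (Complex (real_of_int X) (real_of_int Y))" "0 < t" "t < 1"
  shows "chain.stable X Y \<longleftrightarrow> \<not> feasible H w h (Complex (real_of_int X - t) (real_of_int Y)) \<and>
      \<not> feasible H w h (Complex (real_of_int X) (real_of_int Y - t))"
proof -
  have f: "cell X' Y'" if "X \<le> X'" "X' < X + w" "Y \<le> Y'" "Y' < Y + h" for X' Y'
    using assms(1) that unfolding feasible_int by blast
  have "\<not> feasible H w h (Complex (real_of_int X - t) (real_of_int Y)) \<longleftrightarrow> chain.blocked X Y"
  proof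
    assume "\<not> feasible H w h (Complex (real_of_int X - t) (real_of_int Y))"
    then obtain X' Y' where *: "X - 1 \<le> X'" "X' < X + w" "Y \<le> Y'" "Y' < Y + h" "\<not> cell X' Y'"
      unfolding feasible_left[OF assms(2,3)] by blast
    then have "X' = X - 1" using f[of X' Y'] by force
    then show "chain.blocked X Y" using * unfolding chain.blocked_def by blast
  next
    assume "chain.blocked X Y"
    then obtain Y' where "Y \<le> Y'" "Y' < Y + h" "\<not> cell (X - 1) Y'" unfolding chain.blocked_def by blast
    moreover have "X - 1 \<le> X - 1" "X - 1 < X + w" using w0 by auto
    ultimately show "\<not> feasible H w h (Complex (real_of_int X - t) (real_of_int Y))"
      unfolding feasible_left[OF assms(2,3)] by blast
  qed
  moreover have "\<not> feasible H w h (Complex (real_of_int X) (real_of_int Y - t)) \<longleftrightarrow> (\<exists>X'. X \<le> X' \<and> X' < X + w \<and> \<not> cell X' (Y - 1))"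
  proof
    assume "\<not> feasible H w h (Complex (real_of_int X) (real_of_int Y - t))"
    then obtain X' Y' where *: "X \<le> X'" "X' < X + w" "Y - 1 \<le> Y'" "Y' < Y + h" "\<not> cell X' Y'"
      unfolding feasible_down[OF assms(2,3)] by blast
    then have "Y' = Y - 1" using f[of X' Y'] by force
    then show "\<exists>X'. X \<le> X' \<and> X' < X + w \<and> \<not> cell X' (Y - 1)" using * by blast
  next
    assume "\<exists>X'. X \<le> X' \<and> X' < X + w \<and> \<not> cell X' (Y - 1)"
    moreover have "Y - 1 \<le> Y - 1" "Y - 1 < Y + h" using h0 by auto
    ultimately show "\<not> feasible H w h (Complex (real_of_int X) (real_of_int Y - t))"
      unfolding feasible_down[OF assms(2,3)] by blast
  qed
  ultimately show ?thesis unfolding chain.stable_def using f by blast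
qed

text \<open>From a non-integral abscissa a small shift to the left stays between the same grid lines
  and meets no new cell.\<close>

lemma BL_stable_Re_int:
  assumes "BL_stable H w h p" shows "Re p \<in> \<int>"
proof (rule ccontr)
  assume "Re p \<notin> \<int>"
  then have fl: "real_of_int \<lfloor>Re p\<rfloor> < Re p" by (metis Ints_of_int less_le of_int_floor_le)
  obtain \<epsilon> where e: "0 < \<epsilon>" "\<And>t. t \<in> {0<..<\<epsilon>} \<Longrightarrow> \<not> feasible H w h (Complex (Re p - t) (Im p))" and f: "feasible H w h p"
    using assms unfolding BL_stable_def by blast
  define t where "t = min \<epsilon> (Re p - real_of_int \<lfloor>Re p\<rfloor>) / 2"
  have t: "0 < t" "t < \<epsilon>" "t < Re p - real_of_int \<lfloor>Re p\<rfloor>" using e fl unfolding t_def by (auto simp: min_def)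
  have "Re p < real_of_int X + 1" if "Re p - t < real_of_int X + 1" for X
  proof -
    have "real_of_int \<lfloor>Re p\<rfloor> < real_of_int (X + 1)" using that t by simp
    then have "\<lfloor>Re p\<rfloor> < X + 1" by (simp only: of_int_less_iff)
    then show ?thesis by linarith
  qed
  moreover have "real_of_int X < Re p + w" if "real_of_int X < Re p - t + w" for X using that t by linarith
  ultimately have "feasible H w h (Complex (Re p - t) (Im p))"
    using f unfolding feasible_cells complex.sel by blast
  then show False using e(2)[of t] t by simp
qed

lemma BL_stable_Im_int:
  assumes "BL_stable H w h p" shows "Im p \<in> \<int>"
proof (rule ccontr)
  assume "Im p \<notin> \<int>"
  then have fl: "real_of_int \<lfloor>Im p\<rfloor> < Im p" by (metis Ints_of_int less_le of_int_floor_le)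
  obtain \<epsilon> where e: "0 < \<epsilon>" "\<And>t. t \<in> {0<..<\<epsilon>} \<Longrightarrow> \<not> feasible H w h (Complex (Re p) (Im p - t))" and f: "feasible H w h p"
    using assms unfolding BL_stable_def by blast
  define t where "t = min \<epsilon> (Im p - real_of_int \<lfloor>Im p\<rfloor>) / 2"
  have t: "0 < t" "t < \<epsilon>" "t < Im p - real_of_int \<lfloor>Im p\<rfloor>" using e fl unfolding t_def by (auto simp: min_def)
  have "Im p < real_of_int X + 1" if "Im p - t < real_of_int X + 1" for X
  proof -
    have "real_of_int \<lfloor>Im p\<rfloor> < real_of_int (X + 1)" using that t by simp
    then have "\<lfloor>Im p\<rfloor> < X + 1" by (simp only: of_int_less_iff)
    then show ?thesis by linarith
  qed
  moreover have "real_of_int X < Im p + h" if "real_of_int X < Im p - t + h" for X using that t by linarith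
  ultimately have "feasible H w h (Complex (Re p) (Im p - t))"
    using f unfolding feasible_cells complex.sel by blast
  then show False using e(2)[of t] t by simp
qed

lemma BL_stable_set: "{p. BL_stable H w h p} = (\<lambda>(X, Y). Complex (of_int X) (of_int Y)) ` {(X, Y). chain.stable X Y}"
proof (intro subset_antisym subsetI)
  fix p assume "p \<in> {p. BL_stable H w h p}"
  then have BL: "BL_stable H w h p" by simp
  obtain X Y where "Re p = real_of_int X" "Im p = real_of_int Y"
    using BL_stable_Re_int[OF BL] BL_stable_Im_int[OF BL] by (auto elim!: Ints_cases)
  then have p: "p = Complex (real_of_int X) (real_of_int Y)" by (simp add: complex_eq_iff)
  obtain \<epsilon> where e: "0 < \<epsilon>" "\<And>t. t \<in> {0<..<\<epsilon>} \<Longrightarrow> \<not> feasible H w h (Complex (real_of_int X - t) (real_of_int Y)) \<and>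
      \<not> feasible H w h (Complex (real_of_int X) (real_of_int Y - t))" and f: "feasible H w h p"
    using BL unfolding BL_stable_def p by auto
  have t: "0 < min \<epsilon> 1 / 2" "min \<epsilon> 1 / 2 < 1" "min \<epsilon> 1 / 2 < \<epsilon>" using e by (auto simp: min_def)
  have "chain.stable X Y" using stable_feasible[OF f[unfolded p] t(1,2)] e(2)[of "min \<epsilon> 1 / 2"] t by auto
  then show "p \<in> (\<lambda>(X, Y). Complex (of_int X) (of_int Y)) ` {(X, Y). chain.stable X Y}" using p by auto
next
  fix p assume "p \<in> (\<lambda>(X, Y). Complex (of_int X) (of_int Y)) ` {(X, Y). chain.stable X Y}"
  then obtain X Y where p: "p = Complex (real_of_int X) (real_of_int Y)" and s: "chain.stable X Y" by auto
  have f: "feasible H w h p" unfolding p feasible_int using s unfolding chain.stable_def by blast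
  have "BL_stable H w h p" unfolding BL_stable_def
    using f stable_feasible[OF f[unfolded p]] s by (intro conjI exI[of _ 1]) (auto simp: p)
  then show "p \<in> {p. BL_stable H w h p}" by simp
qed

end

section \<open>Program fragments\<close>

text \<open>A weakest precondition for total correctness that also sees the running time. The
  equations below let the simplifier execute loop-free code.\<close>

definition runs :: "com \<Rightarrow> state \<Rightarrow> (nat \<Rightarrow> state \<Rightarrow> bool) \<Rightarrow> bool" where
  "runs c s Q \<longleftrightarrow> (\<exists>t s'. exec c s t s' \<and> Q t s')"

inductive_cases exec_SkipE: "exec Skip s t s'"
inductive_cases exec_AssignE: "exec (Assign x a) s t s'"
inductive_cases exec_StoreE: "exec (Store a b) s t s'"
inductive_cases exec_SeqE: "exec (Seq c d) s t s'"
inductive_cases exec_CondE: "exec (Cond b c d) s t s'"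
inductive_cases exec_WhileE: "exec (While b c) s t s'"

lemma runsI: "exec c s t s' \<Longrightarrow> Q t s' \<Longrightarrow> runs c s Q"
  unfolding runs_def by blast

lemma runsE: assumes "runs c s Q" obtains t s' where "exec c s t s'" "Q t s'"
  using assms unfolding runs_def by blast

lemma runs_Skip [simp]: "runs Skip s Q \<longleftrightarrow> Q 1 s"
  by (intro iffI runsI[OF exec.Skip]) (auto elim!: runsE exec_SkipE)

lemma runs_Assign [simp]: "runs (Assign x a) s Q \<longleftrightarrow> Q (1 + acost a) ((fst s)(x := aval a s), snd s)"
  by (intro iffI runsI[OF exec.Assign]) (auto elim!: runsE exec_AssignE)

lemma runs_Store [simp]: "runs (Store a b) s Q \<longleftrightarrow> Q (1 + acost a + acost b) (fst s, (snd s)(aval a s := aval b s))"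
  by (intro iffI runsI[OF exec.Store]) (auto elim!: runsE exec_StoreE)

lemma runs_Seq [simp]: "runs (Seq c d) s Q \<longleftrightarrow> runs c s (\<lambda>t s'. runs d s' (\<lambda>t'. Q (t + t')))"
  unfolding runs_def by (blast intro: exec.intros elim: exec_SeqE)

lemma runs_Cond [simp]: "runs (Cond b c d) s Q \<longleftrightarrow>
    (if bval b s then runs c s (\<lambda>t. Q (1 + bcost b + t)) else runs d s (\<lambda>t. Q (1 + bcost b + t)))" (is "_ = ?r")
proof
  assume "runs (Cond b c d) s Q"
  then obtain t s' where "exec (Cond b c d) s t s'" "Q t s'" by (rule runsE)
  then show ?r by (cases rule: exec_CondE) (auto intro: runsI)
next
  assume r: ?r
  show "runs (Cond b c d) s Q"
  proof (cases "bval b s")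
    case True
    then obtain t s' where e: "exec c s t s'" and Q: "Q (1 + bcost b + t) s'" using r by (auto elim!: runsE)
    show ?thesis by (rule runsI[where Q = Q, OF exec.CondTrue[OF True e] Q])
  next
    case False
    then obtain t s' where e: "exec d s t s'" and Q: "Q (1 + bcost b + t) s'" using r by (auto elim!: runsE)
    show ?thesis by (rule runsI[where Q = Q, OF exec.CondFalse[OF False e] Q])
  qed
qed

text \<open>Not a simplification rule: the right-hand side contains the loop again.\<close>

lemma runs_While: "runs (While b c) s Q \<longleftrightarrow>
    (if bval b s then runs c s (\<lambda>t s'. runs (While b c) s' (\<lambda>t'. Q (1 + bcost b + t + t'))) else Q (1 + bcost b) s)" (is "_ = ?r")
proof
  assume "runs (While b c) s Q"
  then obtain t s' where "exec (While b c) s t s'" "Q t s'" by (rule runsE)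
  then show ?r by (cases rule: exec_WhileE) (auto intro!: runsI)
next
  assume r: ?r
  show "runs (While b c) s Q"
  proof (cases "bval b s")
    case True
    then obtain t s' t' s'' where e: "exec c s t s'" "exec (While b c) s' t' s''" and Q: "Q (1 + bcost b + t + t') s''"
      using r by (auto elim!: runsE)
    show ?thesis by (rule runsI[where Q = Q, OF exec.WhileTrue[OF True e] Q])
  next
    case False
    then show ?thesis using r by (intro runsI[OF exec.WhileFalse]) auto
  qed
qed

lemma runs_mono: "runs c s Q \<Longrightarrow> (\<And>t s'. Q t s' \<Longrightarrow> Q' t s') \<Longrightarrow> runs c s Q'"
  unfolding runs_def by blast

text \<open>The stack grows upwards from \<open>b\<close>: the head of the list, its top, has the
  highest address. A flag is set if its cell is positive.\<close>

fun stk :: "(int \<Rightarrow> int) \<Rightarrow> int \<Rightarrow> entry list \<Rightarrow> bool" where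
  "stk \<mu> b [] \<longleftrightarrow> True"
| "stk \<mu> b ((a, m, f) # S) \<longleftrightarrow>
     \<mu> (b + 3 * int (length S)) = a \<and> \<mu> (b + 3 * int (length S) + 1) = m \<and>
     (0 < \<mu> (b + 3 * int (length S) + 2)) = f \<and> stk \<mu> b S"

lemma stk_frame: "(\<And>a. b \<le> a \<Longrightarrow> a < b + 3 * int (length S) \<Longrightarrow> \<mu>' a = \<mu> a) \<Longrightarrow> stk \<mu>' b S = stk \<mu> b S"
proof (induction S)
  case (Cons e S)
  obtain a m f where e: "e = (a, m, f)" by (cases e)
  have "stk \<mu>' b S = stk \<mu> b S" by (rule Cons.IH) (use Cons.prems in auto)
  then show ?case using Cons.prems by (simp add: e)
qed simp

definition outs :: "(int \<Rightarrow> int) \<Rightarrow> int \<Rightarrow> (int \<times> int) list \<Rightarrow> bool" where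
  "outs \<mu> b os \<longleftrightarrow> (\<forall>i<length os. \<mu> (b + 2 * int i) = fst (os ! i) \<and> \<mu> (b + 2 * int i + 1) = snd (os ! i))"

lemma outs_frame: "(\<And>a. b \<le> a \<Longrightarrow> a < b + 2 * int (length os) \<Longrightarrow> \<mu>' a = \<mu> a) \<Longrightarrow> outs \<mu>' b os = outs \<mu> b os"
  unfolding outs_def by (intro all_cong) auto

lemma outs_snoc:
  assumes "outs \<mu> b os"
  shows "outs (\<mu>(b + 2 * int (length os) := p, b + 2 * int (length os) + 1 := q)) b (os @ [(p, q)])"
  using assms unfolding outs_def by (auto simp: nth_append less_Suc_eq)

text \<open>The cells below \<open>free\<close> hold the input and keep their contents
  \<open>\<mu>0\<close>; the stack occupies cells from \<open>free\<close> on, below the output at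
  \<open>out\<close>.\<close>

definition Rep :: "(int \<Rightarrow> int) \<Rightarrow> state \<Rightarrow> entry list \<Rightarrow> (int \<times> int) list \<Rightarrow> bool" where
  "Rep \<mu>0 s S os \<longleftrightarrow> fst s ''sp'' = fst s ''free'' + 3 * int (length S) - 3 \<and> stk (snd s) (fst s ''free'') S \<and>
     fst s ''free'' + 3 * int (length S) \<le> fst s ''out'' \<and> fst s ''o'' = fst s ''out'' + 2 * int (length os) \<and>
     fst s ''num'' = int (length os) \<and> outs (snd s) (fst s ''out'') os \<and> (\<forall>a<fst s ''free''. snd s a = \<mu>0 a)"

definition same :: "state \<Rightarrow> state \<Rightarrow> bool" where
  "same s s' \<longleftrightarrow> (\<forall>r. r \<notin> {''sp'', ''o'', ''num''} \<longrightarrow> fst s' r = fst s r)"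

lemma same_refl [simp]: "same s s" and same_trans: "same s s' \<Longrightarrow> same s' s'' \<Longrightarrow> same s s''"
  by (auto simp: same_def)

lemma sameD: "same s s' \<Longrightarrow> r \<notin> {''sp'', ''o'', ''num''} \<Longrightarrow> fst s' r = fst s r"
  by (auto simp: same_def)

text \<open>Register \<open>sp\<close> points to the top entry, \<open>o\<close> to the next free output cell. The fragment \<open>ADV\<close>
  sweeps up to column \<open>X\<close> under a ceiling of height \<open>c\<close>, and \<open>POP\<close> removes the pieces left of \<open>X\<close> that
  are dominated by a floor of height \<open>c\<close>.\<close>

definition EVAL :: com where
  "EVAL = Cond (BAnd (Less (Const 0) (Mem (Plus (Reg ''sp'') (Const 2))))
       (BAnd (BNot (Less (Reg ''c'') (Plus (Mem (Plus (Reg ''sp'') (Const 1))) (Reg ''h''))))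
         (BNot (BAnd (Less (Reg ''xD'') (Plus (Mem (Reg ''sp'')) (Reg ''w'')))
            (Less (Reg ''yD'') (Plus (Mem (Plus (Reg ''sp'') (Const 1))) (Reg ''h'')))))))
     (Seq (Store (Reg ''o'') (Mem (Reg ''sp'')))
       (Seq (Store (Plus (Reg ''o'') (Const 1)) (Mem (Plus (Reg ''sp'') (Const 1))))
         (Seq (Assign ''o'' (Plus (Reg ''o'') (Const 2))) (Assign ''num'' (Plus (Reg ''num'') (Const 1))))))
     Skip"

abbreviation fit :: "state \<Rightarrow> int \<Rightarrow> int \<Rightarrow> bool \<Rightarrow> bool" where
  "fit s \<equiv> fits (fst s ''w'') (fst s ''h'') (fst s ''xD'') (fst s ''yD'') (fst s ''c'')"

lemma runs_EVAL:
  assumes "Rep \<mu>0 s ((a, m, b) # S) os"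
  shows "runs EVAL s (\<lambda>t s'. t \<le> 60 \<and> Rep \<mu>0 s' ((a, m, b) # S) (os @ (if fit s a m b then [(a, m)] else [])) \<and>
     same s s' \<and> fst s' ''sp'' = fst s ''sp'')"
proof -
  obtain \<sigma> \<mu> where s: "s = (\<sigma>, \<mu>)" by (cases s)
  have sp: "\<sigma> ''sp'' = \<sigma> ''free'' + 3 * int (length S)" and st: "stk \<mu> (\<sigma> ''free'') ((a, m, b) # S)"
    and le: "\<sigma> ''free'' + 3 * int (length S) + 3 \<le> \<sigma> ''out''" and o: "\<sigma> ''o'' = \<sigma> ''out'' + 2 * int (length os)"
    and num: "\<sigma> ''num'' = int (length os)" and out: "outs \<mu> (\<sigma> ''out'') os" and low: "\<forall>a<\<sigma> ''free''. \<mu> a = \<mu>0 a"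
    using assms by (auto simp: Rep_def s)
  have mem: "\<mu> (\<sigma> ''sp'') = a" "\<mu> (\<sigma> ''sp'' + 1) = m" "(0 < \<mu> (\<sigma> ''sp'' + 2)) = b" using st sp by auto
  show ?thesis
  proof (cases "fit s a m b")
    case True
    then have f: "b" "m + \<sigma> ''h'' \<le> \<sigma> ''c''" "a + \<sigma> ''w'' \<le> \<sigma> ''xD'' \<or> m + \<sigma> ''h'' \<le> \<sigma> ''yD''" by (auto simp: fits_def s)
    let ?\<mu> = "\<mu>(\<sigma> ''o'' := a, \<sigma> ''o'' + 1 := m)"
    have "stk ?\<mu> (\<sigma> ''free'') ((a, m, b) # S)"
      by (rule iffD2[OF stk_frame st]) (use le o in auto)
    moreover have "outs ?\<mu> (\<sigma> ''out'') (os @ [(a, m)])"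
      using outs_snoc[OF out, of a m] by (simp add: o)
    moreover have "\<forall>a<\<sigma> ''free''. ?\<mu> a = \<mu>0 a" using low le o by auto
    moreover have "\<sigma> ''o'' \<noteq> \<sigma> ''sp'' + 1" using sp le o by auto
    ultimately show ?thesis
      using f mem sp le o num True by (auto simp: EVAL_def s Rep_def same_def)
  next
    case False
    then have "\<not> (b \<and> m + \<sigma> ''h'' \<le> \<sigma> ''c'' \<and> (a + \<sigma> ''w'' \<le> \<sigma> ''xD'' \<or> m + \<sigma> ''h'' \<le> \<sigma> ''yD''))" by (auto simp: fits_def s)
    then show ?thesis
      using mem assms False by (auto simp: EVAL_def s)
  qed
qed

text \<open>This performs the non-recursive cases of \<open>sweep\<close> on the entry at which the
  loop has stopped.\<close>

definition FIN :: com where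
  "FIN = Seq (Cond (Less (Mem (Reg ''sp'')) (Reg ''X''))
       (Seq EVAL (Seq (Store (Reg ''sp'') (Reg ''X'')) (Store (Plus (Reg ''sp'') (Const 2)) (Const 0)))) Skip)
     (Cond (Less (Reg ''c'') (Plus (Mem (Plus (Reg ''sp'') (Const 1))) (Reg ''h'')))
       (Store (Plus (Reg ''sp'') (Const 2)) (Const 1)) Skip)"

definition DROP :: com where "DROP = Assign ''sp'' (Minus (Reg ''sp'') (Const 3))"

text \<open>If only the sentinel remains, the second comparison reads a cell below the stack, but
  the first is false then because the sentinel starts to the right of \<open>X\<close>.\<close>

definition ADVG :: bexp where
  "ADVG = BAnd (Less (Mem (Reg ''sp'')) (Reg ''X'')) (BNot (Less (Reg ''X'') (Mem (Minus (Reg ''sp'') (Const 3)))))"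

definition ADV :: com where
  "ADV = Seq (While ADVG (Seq EVAL DROP)) FIN"

definition POPG :: bexp where
  "POPG = BAnd (BNot (Less (Reg ''c'') (Mem (Plus (Reg ''sp'') (Const 1))))) (BNot (Less (Reg ''X'') (Mem (Minus (Reg ''sp'') (Const 3)))))"

definition POP :: com where
  "POP = Seq (While POPG DROP)
    (Cond (BNot (Less (Reg ''c'') (Mem (Plus (Reg ''sp'') (Const 1)))))
      (Seq (Store (Reg ''sp'') (Reg ''X''))
        (Cond (Less (Mem (Plus (Reg ''sp'') (Const 1))) (Reg ''c''))
          (Store (Plus (Reg ''sp'') (Const 2)) (Const 1)) (Store (Plus (Reg ''sp'') (Const 2)) (Const 0)))) Skip)"

lemma Rep_drop:
  "Rep \<mu>0 s (e # S) os \<Longrightarrow> Rep \<mu>0 ((fst s)(''sp'' := fst s ''sp'' - 3), snd s) S os"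
  by (cases e) (auto simp: Rep_def)

lemma Rep_top:
  assumes "Rep \<mu>0 s ((a, m, b) # S) os"
  shows "snd s (fst s ''sp'') = a" "snd s (fst s ''sp'' + 1) = m" "(0 < snd s (fst s ''sp'' + 2)) = b"
    "S = (a', m', b') # r \<Longrightarrow> snd s (fst s ''sp'' - 3) = a'"
  using assms by (auto simp: Rep_def)

lemma Rep_set_flag:
  assumes "Rep \<mu>0 s ((a, m, b) # S) os"
  shows "Rep \<mu>0 (fst s, (snd s)(fst s ''sp'' + 2 := v)) ((a, m, 0 < v) # S) os"
proof -
  have "stk ((snd s)(fst s ''sp'' + 2 := v)) (fst s ''free'') S = stk (snd s) (fst s ''free'') S"
    by (rule stk_frame) (use assms in \<open>auto simp: Rep_def\<close>)
  moreover have "outs ((snd s)(fst s ''sp'' + 2 := v)) (fst s ''out'') os = outs (snd s) (fst s ''out'') os"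
    by (rule outs_frame) (use assms in \<open>auto simp: Rep_def\<close>)
  ultimately show ?thesis using assms by (auto simp: Rep_def)
qed

lemma Rep_set_start:
  assumes "Rep \<mu>0 s ((a, m, b) # S) os"
  shows "Rep \<mu>0 (fst s, (snd s)(fst s ''sp'' := v)) ((v, m, b) # S) os"
proof -
  have "stk ((snd s)(fst s ''sp'' := v)) (fst s ''free'') S = stk (snd s) (fst s ''free'') S"
    by (rule stk_frame) (use assms in \<open>auto simp: Rep_def\<close>)
  moreover have "outs ((snd s)(fst s ''sp'' := v)) (fst s ''out'') os = outs (snd s) (fst s ''out'') os"
    by (rule outs_frame) (use assms in \<open>auto simp: Rep_def\<close>)
  ultimately show ?thesis using assms by (auto simp: Rep_def)
qed

abbreviation above :: "state \<Rightarrow> int \<Rightarrow> bool" where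
  "above s \<equiv> \<lambda>m. fst s ''c'' < m + fst s ''h''"

lemma runs_FIN_eq:
  assumes "Rep \<mu>0 s ((a, m, b) # S) os" "\<not> a < fst s ''X''"
  shows "runs FIN s (\<lambda>t s'. t \<le> 40 \<and> Rep \<mu>0 s' ((a, m, b \<or> above s m) # S) os \<and> same s s')"
  using assms Rep_top[OF assms(1)] Rep_set_flag[OF assms(1), of 1]
  by (auto simp: FIN_def same_def)

lemma runs_FIN_less:
  assumes R: "Rep \<mu>0 s ((a, m, b) # S) os" and less: "a < fst s ''X''"
  shows "runs FIN s (\<lambda>t s'. t \<le> 120 \<and> Rep \<mu>0 s' ((fst s ''X'', m, above s m) # S) (os @ (if fit s a m b then [(a, m)] else [])) \<and> same s s')"
proof -
  have "runs EVAL s (\<lambda>t s'. runs (Seq (Seq (Store (Reg ''sp'') (Reg ''X'')) (Store (Plus (Reg ''sp'') (Const 2)) (Const 0)))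
      (Cond (Less (Reg ''c'') (Plus (Mem (Plus (Reg ''sp'') (Const 1))) (Reg ''h'')))
       (Store (Plus (Reg ''sp'') (Const 2)) (Const 1)) Skip)) s' (\<lambda>t' s''. t + t' \<le> 110 \<and>
       Rep \<mu>0 s'' ((fst s ''X'', m, above s m) # S) (os @ (if fit s a m b then [(a, m)] else [])) \<and> same s s''))"
  proof (rule runs_mono[OF runs_EVAL[OF R]], elim conjE)
    fix t :: nat and s' assume t: "t \<le> 60" and R': "Rep \<mu>0 s' ((a, m, b) # S) (os @ (if fit s a m b then [(a, m)] else []))" (is "Rep _ _ _ ?os")
      and sm: "same s s'"
    let ?s1 = "(fst s', (snd s')(fst s' ''sp'' := fst s' ''X''))"
    let ?s2 = "(fst s', (snd ?s1)(fst s' ''sp'' + 2 := 0))"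
    have R1: "Rep \<mu>0 ?s1 ((fst s' ''X'', m, b) # S) ?os" by (rule Rep_set_start[OF R'])
    have R2: "Rep \<mu>0 ?s2 ((fst s' ''X'', m, False) # S) ?os" using Rep_set_flag[OF R1, of 0] by simp
    have R3: "Rep \<mu>0 (fst s', (snd ?s2)(fst s' ''sp'' + 2 := 1)) ((fst s' ''X'', m, True) # S) ?os" using Rep_set_flag[OF R2, of 1] by simp
    have eq: "fst s' ''X'' = fst s ''X''" "fst s' ''c'' = fst s ''c''" "fst s' ''h'' = fst s ''h''"
      using sm by (auto simp: same_def)
    have m: "snd ?s2 (fst s' ''sp'' + 1) = m" using Rep_top(2)[OF R2] by simp
    show "runs (Seq (Seq (Store (Reg ''sp'') (Reg ''X'')) (Store (Plus (Reg ''sp'') (Const 2)) (Const 0)))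
      (Cond (Less (Reg ''c'') (Plus (Mem (Plus (Reg ''sp'') (Const 1))) (Reg ''h'')))
       (Store (Plus (Reg ''sp'') (Const 2)) (Const 1)) Skip)) s' (\<lambda>t' s''. t + t' \<le> 110 \<and>
       Rep \<mu>0 s'' ((fst s ''X'', m, above s m) # S) ?os \<and> same s s'')"
      using R2 R3 t sm m unfolding eq by (auto simp: same_def)
  qed
  then have "runs FIN s (\<lambda>t s'. t \<le> 120 \<and> Rep \<mu>0 s' ((fst s ''X'', m, above s m) # S) (os @ (if fit s a m b then [(a, m)] else [])) \<and> same s s')"
    unfolding FIN_def using less Rep_top(1)[OF R]
    by (auto elim!: runs_mono simp: algebra_simps simp del: if_split)
  then show ?thesis .
qed


lemma runs_Seq_While: "runs (Seq (While b c) d) s Q \<longleftrightarrow>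
    (if bval b s then runs c s (\<lambda>t s'. runs (Seq (While b c) d) s' (\<lambda>t'. Q (1 + bcost b + t + t')))
     else runs d s (\<lambda>t. Q (1 + bcost b + t)))"
  unfolding runs_Seq by (subst runs_While) (simp add: add.assoc)

lemma loop_step: "bval b s \<Longrightarrow> runs c s (\<lambda>t s'. runs (Seq (While b c) d) s' (\<lambda>t'. Q (1 + bcost b + t + t'))) \<Longrightarrow> runs (Seq (While b c) d) s Q"
  and loop_exit: "\<not> bval b s \<Longrightarrow> runs d s (\<lambda>t. Q (1 + bcost b + t)) \<Longrightarrow> runs (Seq (While b c) d) s Q"
  by (subst runs_Seq_While, simp only: if_True if_False)+

lemma sweep_length: "length (fst (sweep g q X S)) \<le> length S" "S \<noteq> [] \<Longrightarrow> fst (sweep g q X S) \<noteq> []"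
  by (induction g q X S rule: sweep.induct) (auto simp: Let_def)

text \<open>The term \<open>100 * length\<close> is the potential that pays for the removal of entries.\<close>

abbreviation yields ::
  "(int \<Rightarrow> int) \<Rightarrow> entry list \<Rightarrow> (int \<times> int) list \<Rightarrow> entry list \<times> (int \<times> int) list \<Rightarrow> nat \<Rightarrow> nat \<Rightarrow> state \<Rightarrow> bool" where
  "yields \<mu>0 S os r C t s' \<equiv> t + 100 * length (fst r) \<le> 100 * length S + C \<and> Rep \<mu>0 s' (fst r) (os @ snd r)"

text \<open>Induction along the stack; the hypothesis on the last entry ensures that the loop stops
  at the sentinel at the latest.\<close>

lemma runs_ADV:
  assumes "Rep \<mu>0 s S os" "S \<noteq> []" "fst s ''X'' < fst (last S)"
  shows "runs ADV s (\<lambda>t s'. yields \<mu>0 S os (sweep (fit s) (above s) (fst s ''X'') S) 150 t s' \<and> same s s')"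
  using assms
proof (induction S arbitrary: s os)
  case (Cons e S)
  obtain a m b where e: "e = (a, m, b)" by (cases e)
  have R: "Rep \<mu>0 s ((a, m, b) # S) os" using Cons.prems e by simp
  note top = Rep_top[OF R]
  show ?case
  proof (cases S)
    case Nil
    have ge: "\<not> a < fst s ''X''" using Cons.prems e Nil by simp
    have "runs ADV s (\<lambda>t s'. t \<le> 60 \<and> Rep \<mu>0 s' ((a, m, b \<or> above s m) # S) os \<and> same s s')"
      unfolding ADV_def
      by (rule loop_exit, use top(1) ge in \<open>simp add: ADVG_def\<close>, rule runs_mono[OF runs_FIN_eq[OF R ge]], auto simp: ADVG_def)
    then show ?thesis by (rule runs_mono) (auto simp: e Nil)
  next
    case S: (Cons e' r)
    obtain a' m' b' where e': "e' = (a', m', b')" by (cases e')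
    have nx: "snd s (fst s ''sp'' - 3) = a'" using top(4) S e' by simp
    show ?thesis
    proof (cases "a < fst s ''X''")
      case False
      have "runs ADV s (\<lambda>t s'. t \<le> 60 \<and> Rep \<mu>0 s' ((a, m, b \<or> above s m) # S) os \<and> same s s')"
        unfolding ADV_def
        by (rule loop_exit, use top(1) False in \<open>simp add: ADVG_def\<close>, rule runs_mono[OF runs_FIN_eq[OF R False]], auto simp: ADVG_def)
      then show ?thesis by (rule runs_mono) (use False in \<open>auto simp: e S e'\<close>)
    next
      case less: True
      show ?thesis
      proof (cases "a' \<le> fst s ''X''")
        case False
        have "runs ADV s (\<lambda>t s'. t \<le> 140 \<and> Rep \<mu>0 s' ((fst s ''X'', m, above s m) # S) (os @ (if fit s a m b then [(a, m)] else [])) \<and> same s s')"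
          unfolding ADV_def
          by (rule loop_exit, use top(1) nx False in \<open>simp add: ADVG_def\<close>, rule runs_mono[OF runs_FIN_less[OF R less]], auto simp: ADVG_def)
        then show ?thesis by (rule runs_mono) (use False less in \<open>simp add: e S e' Let_def\<close>)
      next
        case True
        let ?o = "if fit s a m b then [(a, m)] else []"
        let ?A = "sweep (fit s) (above s) (fst s ''X'') S"
        have sweep_eq: "sweep (fit s) (above s) (fst s ''X'') ((a, m, b) # S) = (fst ?A, ?o @ snd ?A)"
          using less True by (simp add: S e' Let_def)
        let ?Q = "\<lambda>t u. t + 100 * length (fst ?A) \<le> 100 * length ((a, m, b) # S) + 150 \<and>
            Rep \<mu>0 u (fst ?A) (os @ ?o @ snd ?A) \<and> same s u"
        have "runs EVAL s (\<lambda>t s'. runs DROP s' (\<lambda>t' s''. runs ADV s'' (\<lambda>t''. ?Q (1 + bcost ADVG + (t + t') + t''))))"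
        proof (rule runs_mono[OF runs_EVAL[OF R]], elim conjE)
          fix t :: nat and s' assume t: "t \<le> 60" and R': "Rep \<mu>0 s' ((a, m, b) # S) (os @ ?o)"
            and sm: "same s s'"
          let ?s = "((fst s')(''sp'' := fst s' ''sp'' - 3), snd s')"
          have R1: "Rep \<mu>0 ?s S (os @ ?o)" by (rule Rep_drop[OF R'])
          have sm1: "same s ?s" using sm by (auto simp: same_def)
          have eq: "fst ?s ''X'' = fst s ''X''" "fit ?s = fit s" "above ?s = above s"
            using sm by (auto simp: same_def)
          have "runs ADV ?s (\<lambda>t s'. yields \<mu>0 S (os @ ?o) (sweep (fit ?s) (above ?s) (fst ?s ''X'') S) 150 t s' \<and> same ?s s')"
            by (rule Cons.IH[OF R1]) (use S Cons.prems(3) eq(1) in auto)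
          then have IH: "runs ADV ?s (\<lambda>t'' u. yields \<mu>0 S (os @ ?o) ?A 150 t'' u \<and> same ?s u)"
            unfolding eq .
          \<comment> \<open>One round with its test costs less than the 100 units released by the
            removed entry.\<close>
          have "runs ADV ?s (\<lambda>t''. ?Q (1 + bcost ADVG + (t + 4) + t''))"
            by (rule runs_mono[OF IH]) (use t same_trans[OF sm1] in \<open>auto simp: ADVG_def\<close>)
          then show "runs DROP s' (\<lambda>t' s''. runs ADV s'' (\<lambda>t''. ?Q (1 + bcost ADVG + (t + t') + t'')))"
            unfolding DROP_def runs_Assign by simp
        qed
        then have "runs (Seq EVAL DROP) s (\<lambda>t s'. runs ADV s' (\<lambda>t'. ?Q (1 + bcost ADVG + t + t')))"
          unfolding runs_Seq .
        then have "runs ADV s ?Q"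
          unfolding ADV_def by (rule loop_step[rotated]) (use less True top(1) nx in \<open>simp add: ADVG_def\<close>)
        then show ?thesis unfolding e sweep_eq by simp
      qed
    qed
  qed
qed simp

lemma pop_length: "length (pop e f S) \<le> length S" "S \<noteq> [] \<Longrightarrow> pop e f S \<noteq> []"
  by (induction e f S rule: pop.induct) auto

text \<open>The guard always inspects the entry below the top. As the last entry starts to the right
  of \<open>X\<close>, at least two entries remain whenever it is evaluated.\<close>

lemma runs_POP:
  assumes "Rep \<mu>0 s S os" "2 \<le> length S" "fst s ''X'' < fst (last S)"
  shows "runs POP s (\<lambda>t s'. t + 100 * length (pop (fst s ''X'') (fst s ''c'') S) \<le> 100 * length S + 150 \<and>
     Rep \<mu>0 s' (pop (fst s ''X'') (fst s ''c'') S) os \<and> same s s')"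
  using assms
proof (induction S arbitrary: s)
  case (Cons e S)
  obtain a m b where e: "e = (a, m, b)" by (cases e)
  have R: "Rep \<mu>0 s ((a, m, b) # S) os" using Cons.prems e by simp
  note top = Rep_top[OF R]
  obtain a' m' b' r where S: "S = (a', m', b') # r" using Cons.prems(2) by (cases S) auto
  have nx: "snd s (fst s ''sp'' - 3) = a'" using top(4) S by simp
  consider "fst s ''c'' < m" | "m \<le> fst s ''c''" "a' \<le> fst s ''X''" | "m \<le> fst s ''c''" "fst s ''X'' < a'" by linarith
  then show ?case
  proof cases
    case 1
    then have "runs POP s (\<lambda>t s'. t \<le> 60 \<and> s' = s)" unfolding POP_def
      by (intro loop_exit) (use top(2) in \<open>simp_all add: POPG_def\<close>)
    then show ?thesis by (rule runs_mono) (use R 1 in \<open>auto simp: e S\<close>)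
  next
    case 2
    let ?s = "((fst s)(''sp'' := fst s ''sp'' - 3), snd s)"
    have R1: "Rep \<mu>0 ?s S os" by (rule Rep_drop[OF R])
    have l: "2 \<le> length S" using 2 Cons.prems(3) S by (cases r) auto
    have "runs POP ?s (\<lambda>t s'. t + 100 * length (pop (fst ?s ''X'') (fst ?s ''c'') S) \<le> 100 * length S + 150 \<and>
     Rep \<mu>0 s' (pop (fst ?s ''X'') (fst ?s ''c'') S) os \<and> same ?s s')"
      by (rule Cons.IH[OF R1 l]) (use Cons.prems(3) S in auto)
    let ?Q = "\<lambda>t s'. t + 100 * length (pop (fst s ''X'') (fst s ''c'') S) \<le> 100 * length ((a, m, b) # S) + 150 \<and>
     Rep \<mu>0 s' (pop (fst s ''X'') (fst s ''c'') S) os \<and> same s s'"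
    have "runs POP ?s (\<lambda>t. ?Q (1 + bcost POPG + 4 + t))"
      by (rule runs_mono[OF \<open>runs POP ?s _\<close>]) (auto simp: same_def POPG_def)
    then have "runs DROP s (\<lambda>t s'. runs POP s' (\<lambda>t'. ?Q (1 + bcost POPG + t + t')))"
      unfolding DROP_def runs_Assign by simp
    then have "runs POP s ?Q"
      unfolding POP_def by (rule loop_step[rotated]) (use 2 top(2) nx in \<open>simp add: POPG_def\<close>)
    then show ?thesis using 2 S e by simp
  next
    case 3
    let ?s1 = "(fst s, (snd s)(fst s ''sp'' := fst s ''X''))"
    have R1: "Rep \<mu>0 ?s1 ((fst s ''X'', m, b) # S) os" by (rule Rep_set_start[OF R])
    have m: "snd ?s1 (fst s ''sp'' + 1) = m" using Rep_top(2)[OF R1] by simp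
    have R2: "Rep \<mu>0 (fst s, (snd ?s1)(fst s ''sp'' + 2 := 1)) ((fst s ''X'', m, True) # S) os"
      "Rep \<mu>0 (fst s, (snd ?s1)(fst s ''sp'' + 2 := 0)) ((fst s ''X'', m, False) # S) os"
      using Rep_set_flag[OF R1, of 1] Rep_set_flag[OF R1, of 0] by auto
    have p: "pop (fst s ''X'') (fst s ''c'') (e # S) = (fst s ''X'', m, m < fst s ''c'') # S" using 3 by (simp add: e S)
    have "runs POP s (\<lambda>t s'. t \<le> 60 \<and> Rep \<mu>0 s' ((fst s ''X'', m, m < fst s ''c'') # S) os \<and> same s s')"
      unfolding POP_def
      by (rule loop_exit) (use top(2) nx 3 R2 m in \<open>auto simp: POPG_def same_def\<close>)
    then show ?thesis by (rule runs_mono) (simp add: p)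
  qed
qed simp

definition NEQ :: "string \<Rightarrow> string \<Rightarrow> bexp" where
  "NEQ a b = BNot (BAnd (BNot (Less (Reg a) (Reg b))) (BNot (Less (Reg b) (Reg a))))"

lemma bval_NEQ [simp]: "bval (NEQ a b) s \<longleftrightarrow> fst s a \<noteq> fst s b" and bcost_NEQ [simp]: "bcost (NEQ a b) = 10"
  by (auto simp: NEQ_def)

definition SETXC :: "aexp \<Rightarrow> aexp \<Rightarrow> com" where
  "SETXC a b = Seq (Assign ''X'' a) (Assign ''c'' b)"

definition PREVLEFT :: bexp where
  "PREVLEFT = Less (Mem (Reg ''v'')) (Mem (Mem (Plus (Reg ''p'') (Const 2))))"

definition RHEAD :: com where
  "RHEAD = Seq (SETXC (Mem (Reg ''v'')) (Mem (Plus (Reg ''p'') (Const 1)))) ADV"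

definition RTAIL :: com where
  "RTAIL = Seq (SETXC (Mem (Reg ''u'')) (Mem (Plus (Reg ''v'') (Const 1)))) ADV"

definition RIGHT :: com where
  "RIGHT = Seq (Cond PREVLEFT RHEAD Skip) RTAIL"

definition PUSH :: com where
  "PUSH = Seq (Assign ''sp'' (Plus (Reg ''sp'') (Const 3)))
     (Seq (Store (Reg ''sp'') (Plus (Minus (Mem (Reg ''u'')) (Reg ''w'')) (Const 1)))
       (Seq (Store (Plus (Reg ''sp'') (Const 1)) (Reg ''c'')) (Store (Plus (Reg ''sp'') (Const 2)) (Const 0))))"

definition LEFT :: com where
  "LEFT = Seq (SETXC (Mem (Reg ''v'')) (Mem (Plus (Reg ''v'') (Const 1)))) (Seq (Cond PREVLEFT POP Skip) PUSH)"

definition BODY :: com where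
  "BODY = Seq (Assign ''v'' (Mem (Plus (Reg ''p'') (Const 3))))
     (Seq (Assign ''u'' (Mem (Plus (Reg ''v'') (Const 3))))
       (Seq (Cond (Less (Mem (Reg ''v'')) (Mem (Reg ''u''))) RIGHT LEFT) (Assign ''p'' (Reg ''u''))))"

definition kept :: "state \<Rightarrow> state \<Rightarrow> bool" where
  "kept s s' \<longleftrightarrow> (\<forall>r. r \<notin> {''sp'', ''o'', ''num'', ''X'', ''c''} \<longrightarrow> fst s' r = fst s r)"

lemma kept_trans: "kept s s' \<Longrightarrow> kept s' s'' \<Longrightarrow> kept s s''"
  and same_kept: "same s s' \<Longrightarrow> kept s s'"
  by (auto simp: kept_def same_def)

lemma Rep_XC: "Rep \<mu>0 ((fst s)(''X'' := a, ''c'' := b), snd s) S os = Rep \<mu>0 s S os"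
  by (simp add: Rep_def)

lemma kept_XC: "kept s ((fst s)(''X'' := a, ''c'' := b), snd s)"
  by (simp add: kept_def)

lemma Rep_low: "Rep \<mu>0 s S os \<Longrightarrow> a < fst s ''free'' \<Longrightarrow> snd s a = \<mu>0 a"
  by (simp add: Rep_def)

lemma runs_SETXC:
  "runs (SETXC a b) s Q \<longleftrightarrow> Q (2 + acost a + acost b) ((fst s)(''X'' := aval a s, ''c'' := aval b ((fst s)(''X'' := aval a s), snd s)), snd s)"
  by (simp add: SETXC_def)

lemma pieces_last: "pieces E P F S \<Longrightarrow> S \<noteq> [] \<and> fst (last S) = E"
  by (induction E P F S rule: pieces.induct) auto

lemma Rep_push:
  assumes "Rep \<mu>0 s S os" "S \<noteq> []" "fst s ''free'' + 3 * int (length S) + 3 \<le> fst s ''out''" "fst s ''free'' > 0"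
  shows "Rep \<mu>0 ((fst s)(''sp'' := fst s ''sp'' + 3), (snd s)(fst s ''sp'' + 3 := a, fst s ''sp'' + 4 := c, fst s ''sp'' + 5 := 0))
     ((a, c, False) # S) os"
proof -
  let ?\<mu> = "(snd s)(fst s ''sp'' + 3 := a, fst s ''sp'' + 4 := c, fst s ''sp'' + 5 := 0)"
  have "stk ?\<mu> (fst s ''free'') S = stk (snd s) (fst s ''free'') S"
    by (rule stk_frame) (use assms in \<open>auto simp: Rep_def\<close>)
  moreover have "outs ?\<mu> (fst s ''out'') os = outs (snd s) (fst s ''out'') os"
    by (rule outs_frame) (use assms in \<open>auto simp: Rep_def\<close>)
  ultimately show ?thesis using assms by (auto simp: Rep_def)
qed

section \<open>The fragments on a hole stored in memory\<close>

locale bls_ram = bls_instance +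
  fixes \<sigma>0 :: "string \<Rightarrow> int" and \<mu>0 :: "int \<Rightarrow> int" and addr :: "nat \<Rightarrow> int"
  assumes recs: "\<And>i. i < length vs \<Longrightarrow> 0 < addr i \<and> addr i + 4 \<le> \<sigma>0 ''free'' \<and>
           real_of_int (\<mu>0 (addr i)) = Re (vs ! i) \<and>
           real_of_int (\<mu>0 (addr i + 1)) = Im (vs ! i) \<and>
           \<mu>0 (addr i + 2) = addr (prv vs i) \<and>
           \<mu>0 (addr i + 3) = addr (nxt vs i)"
    and apart: "\<And>i j. i < length vs \<Longrightarrow> j < length vs \<Longrightarrow> i \<noteq> j \<Longrightarrow> addr i + 4 \<le> addr j \<or> addr j + 4 \<le> addr i"
begin

definition A where "A j = addr (ix j)"

lemma A: "0 < A j" "A j + 4 \<le> \<sigma>0 ''free''" "\<mu>0 (A j + 3) = A (Suc j)" "\<mu>0 (A (Suc j) + 2) = A j"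
  "real_of_int (\<mu>0 (A j)) = Re (q j)" "real_of_int (\<mu>0 (A j + 1)) = Im (q j)"
proof -
  have i: "ix j < length vs" "ix (Suc j) < length vs" using ix_less[of j] ix_less[of "Suc j"] unfolding n_def by auto
  note r = recs[OF i(1), unfolded ix_Suc] recs[OF i(2), unfolded prv_ix]
  show "0 < A j" "A j + 4 \<le> \<sigma>0 ''free''" "\<mu>0 (A j + 3) = A (Suc j)" "\<mu>0 (A (Suc j) + 2) = A j"
    "real_of_int (\<mu>0 (A j)) = Re (q j)" "real_of_int (\<mu>0 (A j + 1)) = Im (q j)"
    unfolding A_def q_def using r by blast+
qed

lemma A_x: "\<mu>0 (A (2 * j)) = x j" "\<mu>0 (A (Suc (2 * j))) = x j"
  using A(5)[of "2 * j"] A(5)[of "Suc (2 * j)"] Re_even[of j] Re_odd[of j] by simp_all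

lemma A_y: "\<mu>0 (A (Suc (2 * j)) + 1) = y j" "\<mu>0 (A (Suc (Suc (2 * j))) + 1) = y j"
  using A(6)[of "Suc (2 * j)"] A(6)[of "Suc (Suc (2 * j))"] Im_odd[of j] Im_even[of j] by simp_all

lemma A_eq: "A i = A j \<Longrightarrow> i mod n = j mod n"
proof -
  assume "A i = A j"
  moreover have "ix i < length vs" "ix j < length vs" using ix_less[of i] ix_less[of j] unfolding n_def by auto
  ultimately have "ix i = ix j" using apart[of "ix i" "ix j"] unfolding A_def by linarith
  then show ?thesis by (rule ix_inj)
qed

lemma A_n: "A n = A 0" using ix_add_n[of 0] by (simp add: A_def)

text \<open>The distance between \<open>free\<close> and \<open>out\<close> leaves room for
  \<open>n + 1\<close> entries of three cells.\<close>

definition regs :: "state \<Rightarrow> bool" where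
  "regs s \<longleftrightarrow> fst s ''w'' = w \<and> fst s ''h'' = h \<and> fst s ''xD'' = xD \<and> fst s ''yD'' = y (m - 1) \<and> fst s ''r'' = A 0 \<and>
     fst s ''free'' = \<sigma>0 ''free'' \<and> fst s ''out'' = \<sigma>0 ''free'' + 3 + 3 * int n"

lemma regs_kept: "regs s \<Longrightarrow> kept s s' \<Longrightarrow> regs s'"
  by (auto simp: regs_def kept_def)

lemma read: "Rep \<mu>0 s S os \<Longrightarrow> regs s \<Longrightarrow> 0 \<le> d \<Longrightarrow> d < 4 \<Longrightarrow> snd s (A j + d) = \<mu>0 (A j + d)"
  using Rep_low[of \<mu>0 s S os "A j + d"] A(2)[of j] by (simp add: regs_def)

definition at_edge :: "nat \<Rightarrow> state \<Rightarrow> bool" where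
  "at_edge j s \<longleftrightarrow> regs s \<and> fst s ''p'' = A (2 * j) \<and> fst s ''v'' = A (Suc (2 * j)) \<and> fst s ''u'' = A (2 * Suc j)"

lemma at_edge_kept: "at_edge j s \<Longrightarrow> kept s s' \<Longrightarrow> at_edge j s'"
  using regs_kept[of s s'] unfolding at_edge_def kept_def by simp

lemma at_edge_read:
  assumes R: "Rep \<mu>0 s S os" and e: "at_edge j s" and j: "0 < j"
  shows "snd s (fst s ''v'') = x j" "snd s (fst s ''u'') = x (Suc j)" "snd s (fst s ''v'' + 1) = y j"
    "snd s (fst s ''p'' + 1) = y (j - 1)" "snd s (snd s (fst s ''p'' + 2)) = x (j - 1)"
proof -
  have rg: "regs s" and p: "fst s ''p'' = A (2 * j)" and v: "fst s ''v'' = A (Suc (2 * j))" and u: "fst s ''u'' = A (2 * Suc j)"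
    using e by (auto simp: at_edge_def)
  have p': "A (2 * j) = A (Suc (Suc (2 * (j - 1))))" using j by (cases j) auto
  show "snd s (fst s ''v'') = x j" using read[OF R rg, of 0 "Suc (2 * j)"] A_x[of j] v by simp
  show "snd s (fst s ''u'') = x (Suc j)" using read[OF R rg, of 0 "2 * Suc j"] A_x[of "Suc j"] u by simp
  show "snd s (fst s ''v'' + 1) = y j" using read[OF R rg, of 1 "Suc (2 * j)"] A_y[of j] v by simp
  show "snd s (fst s ''p'' + 1) = y (j - 1)" using read[OF R rg, of 1 "Suc (Suc (2 * (j - 1)))"] A_y[of "j - 1"] p p' by simp
  have "snd s (fst s ''p'' + 2) = A (Suc (2 * (j - 1)))"
    using read[OF R rg, of 2 "Suc (Suc (2 * (j - 1)))"] A(4)[of "Suc (2 * (j - 1))"] p p' by simp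
  then show "snd s (snd s (fst s ''p'' + 2)) = x (j - 1)"
    using read[OF R rg, of 0 "Suc (2 * (j - 1))"] A_x[of "j - 1"] by simp
qed

lemma runs_SETXC_ADV:
  assumes R: "Rep \<mu>0 s S os" and rg: "regs s" and pc: "pieces (x 0 + 1) P F S" and X: "X \<le> x 0"
    and e: "aval e1 s = X" "aval e2 ((fst s)(''X'' := X), snd s) = c" "acost e1 + acost e2 \<le> 8"
  shows "runs (Seq (SETXC e1 e2) ADV) s
     (\<lambda>t s'. yields \<mu>0 S os (advance w h xD (y (m - 1)) c X S) 160 t s' \<and> kept s s')"
proof -
  let ?s = "((fst s)(''X'' := X, ''c'' := c), snd s)"
  have R': "Rep \<mu>0 ?s S os" using R by (simp add: Rep_XC)
  have l: "S \<noteq> []" "fst ?s ''X'' < fst (last S)" using pieces_last[OF pc] X by auto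
  have f: "fit ?s = fits w h xD (y (m - 1)) c" "above ?s = (\<lambda>m. c < m + h)" "fst ?s ''X'' = X"
    using rg by (auto simp: regs_def)
  have "runs ADV ?s (\<lambda>t s'. yields \<mu>0 S os (advance w h xD (y (m - 1)) c X S) 150 t s' \<and> same ?s s')"
    using runs_ADV[OF R' l] unfolding f by (rule runs_mono) blast
  then have "runs ADV ?s (\<lambda>t s'. yields \<mu>0 S os (advance w h xD (y (m - 1)) c X S) 160 (2 + acost e1 + acost e2 + t) s' \<and> kept s s')"
    by (rule runs_mono) (use e(3) kept_trans[OF kept_XC[of s X c] same_kept] in fastforce)
  then show ?thesis unfolding runs_Seq runs_SETXC e .
qed

lemma runs_RTAIL:
  assumes R: "Rep \<mu>0 s S os" and e: "at_edge j s" and j: "0 < j" "j < m" and pc: "pieces (x 0 + 1) P F S"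
  shows "runs RTAIL s (\<lambda>t s'. yields \<mu>0 S os (advance w h xD (y (m - 1)) (y j) (x (Suc j)) S) 160 t s' \<and> kept s s')"
  unfolding RTAIL_def using at_edge_read[OF R e j(1)] e chain.x_le[of "Suc j"] j
  by (intro runs_SETXC_ADV[OF R _ pc]) (auto simp: at_edge_def)

lemma runs_RHEAD:
  assumes R: "Rep \<mu>0 s S os" and e: "at_edge j s" and j: "0 < j" "j < m" and pc: "pieces (x 0 + 1) P F S"
  shows "runs RHEAD s (\<lambda>t s'. yields \<mu>0 S os (advance w h xD (y (m - 1)) (y (j - 1)) (x j) S) 160 t s' \<and> kept s s')"
  unfolding RHEAD_def using at_edge_read[OF R e j(1)] e chain.x_le[of j] j
  by (intro runs_SETXC_ADV[OF R _ pc]) (auto simp: at_edge_def)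

lemma runs_RIGHT:
  assumes R: "Rep \<mu>0 s S os" and e: "at_edge j s" and j: "0 < j" "j < m" and stack_inv: "chain.stack_inv j S" and r: "x j < x (Suc j)"
  shows "runs RIGHT s (\<lambda>t s'. yields \<mu>0 S os (chain.steps j S) 350 t s' \<and> kept s s')"
proof -
  note rd = at_edge_read[OF R e j(1)]
  have nl: "\<not> chain.lft j" using r by (simp add: chain.lft_def)
  show ?thesis
  proof (cases "x j < x (j - 1)")
    case True
    then have lf: "chain.lft (j - 1)" using j by (simp add: chain.lft_def)
    let ?A = "advance w h xD (y (m - 1)) (y (j - 1)) (x j) S"
    let ?B = "advance w h xD (y (m - 1)) (y j) (x (Suc j)) (fst ?A)"
    have st: "chain.steps j S = (fst ?B, snd ?A @ snd ?B)" using r True by (simp add: chain.steps_def split_beta)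
    have ceiling_inv: "chain.ceiling_inv j (fst ?A)" by (rule chain.ceiling_inv_after_left(1)[OF stack_inv j lf nl])
    have pc: "pieces (x 0 + 1) (chain.P j) (chain.flag_inv j) S" using stack_inv by (simp add: chain.stack_inv_def)
    have "runs RHEAD s (\<lambda>t s'. runs RTAIL s'
      (\<lambda>t' s''. yields \<mu>0 S (os @ snd ?A) ?B 320 (t + t') s'' \<and> kept s s''))"
    proof (rule runs_mono[OF runs_RHEAD[OF R e j pc]], elim conjE)
      fix t :: nat and s'
      assume t: "t + 100 * length (fst ?A) \<le> 100 * length S + 160" and R1: "Rep \<mu>0 s' (fst ?A) (os @ snd ?A)" and kp: "kept s s'"
      have pc': "pieces (x 0 + 1) (chain.P j) (chain.ceiling_flag j) (fst ?A)"
        using ceiling_inv unfolding chain.ceiling_inv_def by (rule conjunct1)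
      show "runs RTAIL s'
      (\<lambda>t' s''. yields \<mu>0 S (os @ snd ?A) ?B 320 (t + t') s'' \<and> kept s s'')"
        by (rule runs_mono[OF runs_RTAIL[OF R1 at_edge_kept[OF e kp] j pc']])
          (use t kept_trans[OF kp] in auto)
    qed
    note h = this
    have b: "bval PREVLEFT s" using rd True by (simp add: PREVLEFT_def)
    show ?thesis unfolding RIGHT_def st runs_Seq runs_Cond if_P[OF b]
      by (rule runs_mono[OF h], erule runs_mono) (auto simp: PREVLEFT_def)
  next
    case False
    have st: "chain.steps j S = advance w h xD (y (m - 1)) (y j) (x (Suc j)) S" using r False by (simp add: chain.steps_def split_beta)
    have "pieces (x 0 + 1) (chain.P j) (chain.flag_inv j) S" using stack_inv by (simp add: chain.stack_inv_def)
    note h = runs_RTAIL[OF R e j this]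
    have b: "\<not> bval PREVLEFT s" using rd False by (simp add: PREVLEFT_def)
    show ?thesis unfolding RIGHT_def st runs_Seq runs_Cond if_not_P[OF b] runs_Skip
      by (rule runs_mono[OF h]) (auto simp: PREVLEFT_def)
  qed
qed

lemma runs_PUSH:
  assumes R: "Rep \<mu>0 s S os" "S \<noteq> []" and e: "at_edge j s" and j: "0 < j" "int (length S) \<le> int n"
    and c: "fst s ''c'' = y j"
  shows "runs PUSH s (\<lambda>t s'. t \<le> 40 \<and> Rep \<mu>0 s' ((x (Suc j) - w + 1, y j, False) # S) os \<and> kept s s')"
proof -
  note rd = at_edge_read[OF R(1) e j(1)]
  have rg: "regs s" using e by (simp add: at_edge_def)
  have "Rep \<mu>0 ((fst s)(''sp'' := fst s ''sp'' + 3), (snd s)(fst s ''sp'' + 3 := x (Suc j) - w + 1, fst s ''sp'' + 4 := y j, fst s ''sp'' + 5 := 0))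
     ((x (Suc j) - w + 1, y j, False) # S) os"
    by (rule Rep_push[OF R]) (use rg j A(1,2)[of 0] in \<open>auto simp: regs_def\<close>)
  then show ?thesis using rd c rg by (auto simp: PUSH_def kept_def regs_def add_ac)
qed

lemma runs_LEFT:
  assumes R: "Rep \<mu>0 s S os" and e: "at_edge j s" and j: "0 < j" "j < m" and stack_inv: "chain.stack_inv j S" and r: "x (Suc j) < x j"
    and len: "int (length S) \<le> int n"
  shows "runs LEFT s (\<lambda>t s'. yields \<mu>0 S os (chain.steps j S) 350 t s' \<and> kept s s')"
proof -
  note rd = at_edge_read[OF R e j(1)]
  have l: "S \<noteq> []" "fst (last S) = x 0 + 1" using stack_inv pieces_last unfolding chain.stack_inv_def by blast+
  have lf: "chain.lft j" using r by (simp add: chain.lft_def)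
  let ?s = "((fst s)(''X'' := x j, ''c'' := y j), snd s)"
  have R': "Rep \<mu>0 ?s S os" using R by (simp add: Rep_XC)
  have e': "at_edge j ?s" by (rule at_edge_kept[OF e kept_XC])
  have le: "fst ?s ''X'' < fst (last S)" using chain.x_le[of j] j l by simp
  show ?thesis
  proof (cases "x j < x (j - 1)")
    case True
    then have lf': "chain.lft (j - 1)" using j by (simp add: chain.lft_def)
    have st: "chain.steps j S = ((x (Suc j) - w + 1, y j, False) # pop (x j) (y j) S, [])" using r True by (simp add: chain.steps_def)
    have "start S = x j - w + 1" using stack_inv lf' by (simp add: chain.stack_inv_def)
    then have "start S \<noteq> x 0 + 1" using chain.x_le[of j] j w0 by simp
    then have l2: "2 \<le> length S" using l by (cases S; cases "tl S") auto
    have "runs POP ?s (\<lambda>t s'. t + 100 * length (pop (fst ?s ''X'') (fst ?s ''c'') S) \<le> 100 * length S + 150 \<and>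
     Rep \<mu>0 s' (pop (fst ?s ''X'') (fst ?s ''c'') S) os \<and> same ?s s')"
      by (rule runs_POP[OF R' l2 le])
    then have h: "runs POP ?s (\<lambda>t s'. runs PUSH s' (\<lambda>t' s''. t + t' + 100 * length (pop (x j) (y j) S) \<le> 100 * length S + 190 \<and>
       Rep \<mu>0 s'' ((x (Suc j) - w + 1, y j, False) # pop (x j) (y j) S) os \<and> kept s s''))"
    proof (rule runs_mono, elim conjE)
      fix t :: nat and s'
      assume t: "t + 100 * length (pop (fst ?s ''X'') (fst ?s ''c'') S) \<le> 100 * length S + 150"
        and R1: "Rep \<mu>0 s' (pop (fst ?s ''X'') (fst ?s ''c'') S) os" and sm: "same ?s s'"
      have kp: "kept s s'" using kept_trans[OF kept_XC same_kept[OF sm]] .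
      have c: "fst s' ''c'' = y j" using sameD[OF sm, of "''c''"] by simp
      have R2: "Rep \<mu>0 s' (pop (x j) (y j) S) os" using R1 by simp
      have ln: "int (length (pop (x j) (y j) S)) \<le> int n" using len pop_length(1)[of "x j" "y j" S] by linarith
      show "runs PUSH s' (\<lambda>t' s''. t + t' + 100 * length (pop (x j) (y j) S) \<le> 100 * length S + 190 \<and>
       Rep \<mu>0 s'' ((x (Suc j) - w + 1, y j, False) # pop (x j) (y j) S) os \<and> kept s s'')"
        by (rule runs_mono[OF runs_PUSH[OF R2 pop_length(2)[OF l(1)] at_edge_kept[OF e kp] j(1) ln c]])
          (use t kept_trans[OF kp] in auto)
    qed
    have b: "bval PREVLEFT ?s" using at_edge_read[OF R' e' j(1)] True by (simp add: PREVLEFT_def)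
    have s: "((fst s)(''X'' := aval (Mem (Reg ''v'')) s, ''c'' := aval (Mem (Plus (Reg ''v'') (Const 1))) ((fst s)(''X'' := aval (Mem (Reg ''v'')) s), snd s)), snd s) = ?s"
      using rd by simp
    show ?thesis unfolding LEFT_def st runs_Seq runs_SETXC s runs_Cond if_P[OF b]
      by (rule runs_mono[OF h], erule runs_mono) (auto simp: PREVLEFT_def)
  next
    case False
    have st: "chain.steps j S = ((x (Suc j) - w + 1, y j, False) # S, [])" using r False by (simp add: chain.steps_def)
    have "runs PUSH ?s (\<lambda>t s'. t \<le> 40 \<and> Rep \<mu>0 s' ((x (Suc j) - w + 1, y j, False) # S) os \<and> kept ?s s')"
      by (rule runs_PUSH[OF R' l(1) e' j(1) len]) simp
    then have h: "runs PUSH ?s (\<lambda>t s'. t \<le> 40 \<and> Rep \<mu>0 s' ((x (Suc j) - w + 1, y j, False) # S) os \<and> kept s s')"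
      by (rule runs_mono) (use kept_trans[OF kept_XC[of s "x j" "y j"]] in blast)
    have b: "\<not> bval PREVLEFT ?s" using at_edge_read[OF R' e' j(1)] False by (simp add: PREVLEFT_def)
    have s: "((fst s)(''X'' := aval (Mem (Reg ''v'')) s, ''c'' := aval (Mem (Plus (Reg ''v'') (Const 1))) ((fst s)(''X'' := aval (Mem (Reg ''v'')) s), snd s)), snd s) = ?s"
      using rd by simp
    show ?thesis unfolding LEFT_def st runs_Seq runs_SETXC s runs_Cond if_not_P[OF b] runs_Skip
      by (rule runs_mono[OF h]) (auto simp: PREVLEFT_def)
  qed
qed

end

section \<open>The program\<close>

definition LOOP :: com where "LOOP = While (NEQ ''p'' ''r'') BODY"

text \<open>The last of the \<open>2 * k\<close> canonical pointers is that of the rightmost edge.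
  The offset 6 and the \<open>n - 1\<close> rounds of \<open>COUNT\<close> together reserve
  \<open>3 * n + 3\<close> cells for the stack.\<close>

definition INIT :: com where
  "INIT = Seq (Assign ''r'' (Mem (Minus (Plus (Plus (Reg ''canon'') (Reg ''k'')) (Reg ''k'')) (Const 1))))
     (Seq (Assign ''yD'' (Mem (Plus (Reg ''r'') (Const 1))))
     (Seq (Cond (Less (Const 0) (Reg ''corner'')) (Assign ''xD'' (Mem (Reg ''corner''))) (Assign ''xD'' (Mem (Reg ''r''))))
     (Seq (Assign ''out'' (Plus (Reg ''free'') (Const 6)))
       (Assign ''v'' (Mem (Plus (Reg ''r'') (Const 3)))))))"

text \<open>The output array is placed behind the stack, whose size is bounded by the number of vertices.\<close>

definition COUNT :: com where
  "COUNT = While (NEQ ''v'' ''r'') (Seq (Assign ''out'' (Plus (Reg ''out'') (Const 3)))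
     (Assign ''v'' (Mem (Plus (Reg ''v'') (Const 3)))))"

definition SETREGS :: com where
  "SETREGS = Seq (Assign ''num'' (Const 0)) (Seq (Assign ''o'' (Reg ''out''))
     (Seq (Assign ''v'' (Mem (Plus (Reg ''r'') (Const 3)))) (Seq (Assign ''p'' (Mem (Plus (Reg ''v'') (Const 3))))
     (Seq (Assign ''X'' (Mem (Reg ''r''))) (Seq (Assign ''c'' (Mem (Plus (Reg ''v'') (Const 1))))
     (Seq (Assign ''u'' (Mem (Reg ''p''))) (Assign ''sp'' (Plus (Reg ''free'') (Const 6)))))))))"

definition SETSTACK :: com where
  "SETSTACK = Seq (Store (Reg ''free'') (Plus (Reg ''X'') (Const 1)))
     (Seq (Store (Plus (Reg ''free'') (Const 1)) (Reg ''yD''))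
     (Seq (Store (Plus (Reg ''free'') (Const 2)) (Const 0))
     (Seq (Store (Plus (Reg ''free'') (Const 3)) (Plus (Minus (Reg ''X'') (Reg ''w'')) (Const 1)))
     (Seq (Store (Plus (Reg ''free'') (Const 4)) (Reg ''yD''))
     (Seq (Store (Plus (Reg ''free'') (Const 5)) (Const 0))
     (Seq (Store (Plus (Reg ''free'') (Const 6)) (Plus (Minus (Reg ''u'') (Reg ''w'')) (Const 1)))
     (Seq (Store (Plus (Reg ''free'') (Const 7)) (Reg ''c''))
       (Store (Plus (Reg ''free'') (Const 8)) (Const 0)))))))))"

definition PROG :: com where
  "PROG = Seq INIT (Seq COUNT (Seq SETREGS (Seq SETSTACK LOOP)))"

lemma output_points_outs:
  assumes "outs \<mu> (\<sigma> ''out'') os" "\<sigma> ''num'' = int (length os)"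
  shows "output_points (\<sigma>, \<mu>) = (\<lambda>(X, Y). Complex (of_int X) (of_int Y)) ` set os"
proof -
  let ?f = "\<lambda>j. Complex (of_int (\<mu> (\<sigma> ''out'' + 2 * j))) (of_int (\<mu> (\<sigma> ''out'' + 2 * j + 1)))"
  have "{0..<\<sigma> ''num''} = int ` {..<length os}"
    unfolding assms(2) by (simp add: image_int_atLeastLessThan lessThan_atLeast0)
  then have "output_points (\<sigma>, \<mu>) = (\<lambda>i. ?f (int i)) ` {..<length os}"
    by (simp add: output_points_def image_image)
  also have "\<dots> = (\<lambda>i. (\<lambda>(X, Y). Complex (of_int X) (of_int Y)) (os ! i)) ` {..<length os}"
    using assms(1) by (intro image_cong) (auto simp: outs_def split_beta)
  also have "\<dots> = (\<lambda>(X, Y). Complex (of_int X) (of_int Y)) ` set os"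
  proof -
    have "set os = (!) os ` {..<length os}" by (auto simp: set_conv_nth)
    then show ?thesis by (simp add: image_image)
  qed
  finally show ?thesis .
qed

lemma canonical_list_last:
  assumes "1 \<le> k" shows "canonical_list k L N R ! (2 * k - 1) = R"
proof -
  have "length (L 1 # concat (map (\<lambda>i. [N i, L i]) [2..<Suc k])) = 2 * k - 1"
    using assms by (simp add: length_concat o_def sum_list_triv del: upt_Suc)
  then show ?thesis unfolding canonical_list_def
    by (metis append_Cons nth_append_length)
qed

section \<open>Correctness and running time of the whole program\<close>

context bls_ram
begin

lemma runs_BODY:
  assumes R: "Rep \<mu>0 s S os" and rg: "regs s" and p: "fst s ''p'' = A (2 * j)" and j: "0 < j" "j < m"
    and stack_inv: "chain.stack_inv j S" and len: "int (length S) \<le> int n"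
  shows "runs BODY s (\<lambda>t s'. yields \<mu>0 S os (chain.steps j S) 400 t s' \<and> regs s' \<and> fst s' ''p'' = A (2 * Suc j))"
proof -
  let ?s = "((fst s)(''v'' := A (Suc (2 * j)), ''u'' := A (2 * Suc j)), snd s)"
  have v: "aval (Mem (Plus (Reg ''p'') (Const 3))) s = A (Suc (2 * j))"
    using read[OF R rg, of 3 "2 * j"] A(3)[of "2 * j"] p by simp
  have u: "aval (Mem (Plus (Reg ''v'') (Const 3))) ((fst s)(''v'' := A (Suc (2 * j))), snd s) = A (2 * Suc j)"
    using read[OF R rg, of 3 "Suc (2 * j)"] A(3)[of "Suc (2 * j)"] by simp
  have R': "Rep \<mu>0 ?s S os" using R by (simp add: Rep_def)
  have e: "at_edge j ?s" using rg p by (simp add: at_edge_def regs_def)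
  note rd = at_edge_read[OF R' e j(1)]
  let ?Q = "\<lambda>t s'. yields \<mu>0 S os (chain.steps j S) 350 t s' \<and> kept ?s s'"
  \<comment> \<open>The subtracted 6 is the cost of evaluating the condition.\<close>
  have "runs (Cond (Less (Mem (Reg ''v'')) (Mem (Reg ''u''))) RIGHT LEFT) ?s (\<lambda>t. ?Q (t - 6))"
  proof (cases "x j < x (Suc j)")
    case True
    have b: "bval (Less (Mem (Reg ''v'')) (Mem (Reg ''u''))) ?s" using rd True by simp
    show ?thesis unfolding runs_Cond if_P[OF b]
      by (rule runs_mono[OF runs_RIGHT[OF R' e j stack_inv True]]) simp
  next
    case False
    then have l: "x (Suc j) < x j" using x_ne[of j] by simp
    have b: "\<not> bval (Less (Mem (Reg ''v'')) (Mem (Reg ''u''))) ?s" using rd False by simp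
    show ?thesis unfolding runs_Cond if_not_P[OF b]
      by (rule runs_mono[OF runs_LEFT[OF R' e j stack_inv l len]]) simp
  qed
  note h = this
  show ?thesis unfolding BODY_def runs_Seq runs_Assign v u fst_conv snd_conv
  proof (rule runs_mono[OF h], elim conjE)
    fix t :: nat and s'
    assume t: "t - 6 + 100 * length (fst (chain.steps j S)) \<le> 100 * length S + 350"
      and R1: "Rep \<mu>0 s' (fst (chain.steps j S)) (os @ snd (chain.steps j S))" and kp: "kept ?s s'"
    have "regs s'" using regs_kept[OF _ kp] e by (simp add: at_edge_def)
    moreover have "fst s' ''u'' = A (2 * Suc j)" using at_edge_kept[OF e kp] by (simp add: at_edge_def)
    ultimately show "yields \<mu>0 S os (chain.steps j S) 400
          (1 + acost (Mem (Plus (Reg ''p'') (Const 3))) + (1 + acost (Mem (Plus (Reg ''v'') (Const 3))) + (t + (1 + acost (Reg ''u'')))))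
          ((fst s')(''p'' := aval (Reg ''u'') s'), snd s') \<and>
        regs ((fst s')(''p'' := aval (Reg ''u'') s'), snd s') \<and>
        ((fst s')(''p'' := aval (Reg ''u'') s')) ''p'' = A (2 * Suc j)"
      using t R1 by (simp add: Rep_def regs_def)
  qed
qed

lemma steps_length: "length (fst (chain.steps j S)) \<le> Suc (length S)"
proof -
  have "length (fst (sweep g q X (fst (sweep g' q' X' S)))) \<le> length S" for g q X g' q' X'
    using sweep_length(1)[of g q X "fst (sweep g' q' X' S)"] sweep_length(1)[of g' q' X' S] by linarith
  then show ?thesis unfolding chain.steps_def
    by (auto simp: split_beta intro!: le_SucI sweep_length(1) pop_length(1))
qed

text \<open>Each step adds at most one entry to the three initial ones. Since
  \<open>n = 2 * m\<close> and \<open>m >= 2\<close>, the reserved cells suffice.\<close>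

lemma run_length: "length (fst (chain.run j)) \<le> j + 3"
proof (induction j)
  case (Suc j)
  then show ?case using steps_length[of "Suc j" "fst (chain.run j)"] by simp
qed simp

text \<open>The stack length enters the bound as potential: one edge costs at most 400 plus the
  decrease of the potential, and the loop test is covered by the remaining 20.\<close>

lemma runs_LOOP:
  assumes "j \<le> m" "0 < j" "Rep \<mu>0 s (fst (chain.run (j - 1))) (snd (chain.run (j - 1)))" "regs s" "fst s ''p'' = A (2 * j)"
  shows "runs LOOP s (\<lambda>t s'. t \<le> 100 * length (fst (chain.run (j - 1))) + 420 * (m - j) + 20 \<and>
     Rep \<mu>0 s' (fst (chain.run (m - 1))) (snd (chain.run (m - 1))))"
  using assms
proof (induction "m - j" arbitrary: j s)
  case 0
  then have "j = m" by simp
  then have "fst s ''p'' = fst s ''r''" using 0 A_n n_even by (simp add: regs_def)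
  then have "\<not> bval (NEQ ''p'' ''r'') s" by simp
  then show ?case unfolding LOOP_def by (subst runs_While) (use 0 \<open>j = m\<close> in simp)
next
  case (Suc d)
  then have j: "0 < j" "j < m" by auto
  have ne: "bval (NEQ ''p'' ''r'') s"
    using Suc.prems A_eq[of "2 * j" 0] j n_even by (auto simp: regs_def)
  let ?S = "fst (chain.run (j - 1))" and ?os = "snd (chain.run (j - 1))"
  have "j - 1 < m" using j by simp
  then have stack_inv: "chain.stack_inv j ?S" using chain.run_inv[of "j - 1"] j(1) by simp
  have "int (length ?S) \<le> int n" using run_length[of "j - 1"] j n_even m2 by linarith
  note body = runs_BODY[OF Suc.prems(3,4,5) j stack_inv this]
  have run: "fst (chain.run j) = fst (chain.steps j ?S)" "snd (chain.run j) = ?os @ snd (chain.steps j ?S)"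
    using chain.run.simps(2)[of "j - 1"] j by simp_all
  let ?Q = "\<lambda>t s'. t \<le> 100 * length ?S + 420 * (m - j) + 20 \<and> Rep \<mu>0 s' (fst (chain.run (m - 1))) (snd (chain.run (m - 1)))"
  have "runs BODY s (\<lambda>t s'. runs LOOP s' (\<lambda>t'. ?Q (1 + bcost (NEQ ''p'' ''r'') + t + t')))"
  proof (rule runs_mono[OF body], elim conjE)
    fix t :: nat and s'
    assume t: "t + 100 * length (fst (chain.steps j ?S)) \<le> 100 * length ?S + 400"
      and R: "Rep \<mu>0 s' (fst (chain.steps j ?S)) (?os @ snd (chain.steps j ?S))" and rg: "regs s'" and p: "fst s' ''p'' = A (2 * Suc j)"
    have "runs LOOP s' (\<lambda>t s'. t \<le> 100 * length (fst (chain.run (Suc j - 1))) + 420 * (m - Suc j) + 20 \<and>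
     Rep \<mu>0 s' (fst (chain.run (m - 1))) (snd (chain.run (m - 1))))"
      by (rule Suc.hyps(1)[OF _ _ _ _ rg p]) (use Suc.hyps(2) j R run in auto)
    then show "runs LOOP s' (\<lambda>t'. ?Q (1 + bcost (NEQ ''p'' ''r'') + t + t'))"
    proof (rule runs_mono)
      fix t' s''
      assume "t' \<le> 100 * length (fst (chain.run (Suc j - 1))) + 420 * (m - Suc j) + 20 \<and>
         Rep \<mu>0 s'' (fst (chain.run (m - 1))) (snd (chain.run (m - 1)))"
      moreover have "m - j = Suc (m - Suc j)" using j by simp
      ultimately show "?Q (1 + bcost (NEQ ''p'' ''r'') + t + t') s''" using t run(1) by simp
    qed
  qed
  then show ?case unfolding LOOP_def by (subst runs_While) (simp only: ne if_True)
qed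

lemma runs_COUNT:
  assumes "j \<le> n" "0 < j" "snd s = \<mu>0" "fst s ''r'' = A 0" "fst s ''v'' = A j" "fst s ''out'' = f + 3 * int j"
  shows "runs COUNT s (\<lambda>t s'. t \<le> 30 * (n - j) + 20 \<and> snd s' = \<mu>0 \<and> fst s' ''out'' = f + 3 * int n \<and>
     (\<forall>r. r \<notin> {''v'', ''out''} \<longrightarrow> fst s' r = fst s r))"
  using assms
proof (induction "n - j" arbitrary: j s)
  case 0
  then have "j = n" by simp
  then have "\<not> bval (NEQ ''v'' ''r'') s" using 0 A_n by simp
  then show ?case unfolding COUNT_def by (subst runs_While) (use 0 \<open>j = n\<close> in simp)
next
  case (Suc d)
  then have j: "0 < j" "j < n" by auto
  have ne: "bval (NEQ ''v'' ''r'') s"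
    using Suc.prems A_eq[of j 0] j by auto
  let ?s = "((fst s)(''out'' := fst s ''out'' + 3, ''v'' := A (Suc j)), snd s)"
  have v: "aval (Mem (Plus (Reg ''v'') (Const 3))) ((fst s)(''out'' := fst s ''out'' + 3), snd s) = A (Suc j)"
    using Suc.prems A(3)[of j] by simp
  have "runs COUNT ?s (\<lambda>t s'. t \<le> 30 * (n - Suc j) + 20 \<and> snd s' = \<mu>0 \<and> fst s' ''out'' = f + 3 * int n \<and>
     (\<forall>r. r \<notin> {''v'', ''out''} \<longrightarrow> fst s' r = fst ?s r))"
    by (rule Suc.hyps(1)) (use Suc.hyps(2) Suc.prems j in auto)
  note IH = this
  let ?Q = "\<lambda>t s'. t \<le> 30 * (n - j) + 20 \<and> snd s' = \<mu>0 \<and> fst s' ''out'' = f + 3 * int n \<and>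
     (\<forall>r. r \<notin> {''v'', ''out''} \<longrightarrow> fst s' r = fst s r)"
  have "runs COUNT ?s (\<lambda>t. ?Q (20 + t))"
  proof (rule runs_mono[OF IH])
    fix t s'
    assume "t \<le> 30 * (n - Suc j) + 20 \<and> snd s' = \<mu>0 \<and> fst s' ''out'' = f + 3 * int n \<and>
     (\<forall>r. r \<notin> {''v'', ''out''} \<longrightarrow> fst s' r = fst ?s r)"
    moreover have "n - j = Suc (n - Suc j)" using j by simp
    ultimately show "?Q (20 + t) s'" by simp
  qed
  then have "runs (Seq (Assign ''out'' (Plus (Reg ''out'') (Const 3))) (Assign ''v'' (Mem (Plus (Reg ''v'') (Const 3))))) s
      (\<lambda>t s'. runs COUNT s' (\<lambda>t'. ?Q (1 + bcost (NEQ ''v'' ''r'') + t + t')))"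
    using v by simp
  then show ?case unfolding COUNT_def by (subst runs_While) (simp only: ne if_True)
qed

lemma init_stack:
  assumes "regs s" "fst s ''sp'' = \<sigma>0 ''free'' + 6" "fst s ''o'' = fst s ''out''" "fst s ''num'' = 0"
    "snd s = \<mu>0(\<sigma>0 ''free'' := x 0 + 1, \<sigma>0 ''free'' + 1 := y (m - 1), \<sigma>0 ''free'' + 2 := 0,
       \<sigma>0 ''free'' + 3 := x 0 - w + 1, \<sigma>0 ''free'' + 4 := y (m - 1), \<sigma>0 ''free'' + 5 := 0,
       \<sigma>0 ''free'' + 6 := x 1 - w + 1, \<sigma>0 ''free'' + 7 := y 0, \<sigma>0 ''free'' + 8 := 0)"
  shows "Rep \<mu>0 s (fst (chain.run 0)) (snd (chain.run 0))"
  using assms n3 by (auto simp: Rep_def regs_def outs_def)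

lemma runs_PROG:
  assumes regs0: "\<sigma>0 ''k'' = int k" "\<sigma>0 ''w'' = w" "\<sigma>0 ''h'' = h"
    and ptrs: "\<And>j. j < 2 * k \<Longrightarrow> \<mu>0 (\<sigma>0 ''canon'' + int j) = addr (canonical_list k L N R ! j)"
    and corner: "\<And>i. i < length vs \<Longrightarrow> falling_corner vs i \<Longrightarrow> \<sigma>0 ''corner'' = addr i"
    and no_corner: "(\<forall>i<length vs. \<not> falling_corner vs i) \<Longrightarrow> \<sigma>0 ''corner'' = 0"
  shows "runs PROG (\<sigma>0, \<mu>0) (\<lambda>t s'. t \<le> 1000 * n \<and> output_points s' = {p. BL_stable H w h p})"
proof -
  have k1: "1 \<le> k" using canon by (simp add: canonical_ordering_def)
  have r: "\<mu>0 (\<sigma>0 ''canon'' + \<sigma>0 ''k'' + \<sigma>0 ''k'' - 1) = A 0"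
  proof -
    have "\<mu>0 (\<sigma>0 ''canon'' + int (2 * k - 1)) = A 0"
      using ptrs[of "2 * k - 1"] canonical_list_last[OF k1] k1 by (simp add: A_def ix_0)
    moreover have "\<sigma>0 ''canon'' + int (2 * k - 1) = \<sigma>0 ''canon'' + \<sigma>0 ''k'' + \<sigma>0 ''k'' - 1"
      using k1 regs0 by simp
    ultimately show ?thesis by (simp only:)
  qed
  have y: "\<mu>0 (A 0 + 1) = y (m - 1)"
  proof -
    have "Im (q 0) = y (m - 1)" using q_even[of 0] by (simp add: prev_height_def)
    then show ?thesis using A(6)[of 0] by simp
  qed
  have x0: "\<mu>0 (A 0) = x 0" using A_x(1)[of 0] by simp
  \<comment> \<open>Addresses of vertices are positive, so the sign of \<open>corner\<close> tells
    whether a falling corner exists, and its abscissa is \<open>x (m - 1)\<close>.\<close>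
  have D: "xD = (if 0 < \<sigma>0 ''corner'' then \<mu>0 (\<sigma>0 ''corner'') else x 0)"
  proof (cases "y (m - 1) < y (m - 2)")
    case True
    have i: "ix (Suc (2 * (m - 1))) < n" by (rule ix_less)
    then have "\<sigma>0 ''corner'' = A (Suc (2 * (m - 1)))"
      using corner[of "ix (Suc (2 * (m - 1)))"] falling_iff[OF i] True by (simp add: A_def n_def)
    then show ?thesis using True A(1) A_x(2)[of "m - 1"] by (simp add: xD_def)
  next
    case False
    then have "\<sigma>0 ''corner'' = 0" using no_corner falling_iff by (simp add: n_def)
    then show ?thesis using False by (simp add: xD_def)
  qed
  let ?f = "\<sigma>0 ''free''"
  define s1 where "s1 = \<sigma>0(''r'' := A 0, ''yD'' := y (m - 1), ''xD'' := xD, ''out'' := ?f + 6, ''v'' := A 1)"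
  have "runs INIT (\<sigma>0, \<mu>0) (\<lambda>t s'. t \<le> 50 \<and> s' = (s1, \<mu>0))"
    using r y x0 D A(3)[of 0] by (simp add: INIT_def s1_def)
  note init = this
  have count: "runs COUNT (s1, \<mu>0) (\<lambda>t s'. t \<le> 30 * (n - 1) + 20 \<and> snd s' = \<mu>0 \<and> fst s' ''out'' = (?f + 3) + 3 * int n \<and>
     (\<forall>r. r \<notin> {''v'', ''out''} \<longrightarrow> fst s' r = fst (s1, \<mu>0) r))"
    by (rule runs_COUNT) (use n3 in \<open>auto simp: s1_def\<close>)
  have x1: "\<mu>0 (A 2) = x 1" using A_x(1)[of 1] by simp
  have y0: "\<mu>0 (A 1 + 1) = y 0" using A_y(1)[of 0] by simp
  have rest: "runs SETREGS s (\<lambda>t s'. runs SETSTACK s' (\<lambda>t' s''. runs LOOP s'' (\<lambda>t'' u.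
      t + (t' + t'') \<le> 420 * m + 420 \<and> Rep \<mu>0 u (fst (chain.run (m - 1))) (snd (chain.run (m - 1))))))"
    if s: "snd s = \<mu>0" "fst s ''out'' = (?f + 3) + 3 * int n" "\<forall>r. r \<notin> {''v'', ''out''} \<longrightarrow> fst s r = fst (s1, \<mu>0) r" for s
  proof -
    have g: "fst s ''r'' = A 0" "fst s ''yD'' = y (m - 1)" "fst s ''xD'' = xD" "fst s ''w'' = w" "fst s ''h'' = h" "fst s ''free'' = ?f"
      using s(3) regs0 by (auto simp: s1_def)
    define u where "u = (fst s)(''num'' := 0, ''o'' := fst s ''out'', ''v'' := A 1, ''p'' := A 2, ''X'' := x 0, ''c'' := y 0, ''u'' := x 1, ''sp'' := ?f + 6)"
    have A1: "\<mu>0 (A 0 + 3) = A 1" "\<mu>0 (A 1 + 3) = A 2" using A(3)[of 0] A(3)[of 1] by (simp_all add: numeral_2_eq_2)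
    have 1: "runs SETREGS s (\<lambda>t s'. t \<le> 60 \<and> s' = (u, \<mu>0))"
      using s g A1 x0 y0 x1 unfolding SETREGS_def by (simp add: u_def)
    define \<mu> where "\<mu> = \<mu>0(?f := x 0 + 1, ?f + 1 := y (m - 1), ?f + 2 := 0,
       ?f + 3 := x 0 - w + 1, ?f + 4 := y (m - 1), ?f + 5 := 0,
       ?f + 6 := x 1 - w + 1, ?f + 7 := y 0, ?f + 8 := 0)"
    have 2: "runs SETSTACK (u, \<mu>0) (\<lambda>t s'. t \<le> 60 \<and> s' = (u, \<mu>))"
      using g unfolding SETSTACK_def by (simp add: u_def \<mu>_def)
    have rg: "regs (u, \<mu>)" using g s(2) by (simp add: regs_def u_def)
    have "Rep \<mu>0 (u, \<mu>) (fst (chain.run 0)) (snd (chain.run 0))"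
      by (rule init_stack[OF rg]) (simp_all add: u_def \<mu>_def)
    then have "runs LOOP (u, \<mu>) (\<lambda>t s'. t \<le> 100 * length (fst (chain.run (1 - 1))) + 420 * (m - 1) + 20 \<and>
       Rep \<mu>0 s' (fst (chain.run (m - 1))) (snd (chain.run (m - 1))))"
      by (intro runs_LOOP rg) (use m2 in \<open>auto simp: u_def\<close>)
    then have 3: "runs LOOP (u, \<mu>) (\<lambda>t s'. t \<le> 420 * m \<and> Rep \<mu>0 s' (fst (chain.run (m - 1))) (snd (chain.run (m - 1))))"
      by (rule runs_mono) (use m2 in auto)
    show ?thesis
      by (rule runs_mono[OF 1], elim conjE, simp only:, rule runs_mono[OF 2], elim conjE, simp only:, rule runs_mono[OF 3]) simp
  qed
  have "runs PROG (\<sigma>0, \<mu>0) (\<lambda>t s'. t \<le> 1000 * n \<and> Rep \<mu>0 s' (fst (chain.run (m - 1))) (snd (chain.run (m - 1))))"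
    unfolding PROG_def runs_Seq[of INIT] runs_Seq[of COUNT] runs_Seq[of SETREGS] runs_Seq[of SETSTACK]
  proof (rule runs_mono[OF init], elim conjE, simp only:, rule runs_mono[OF count], elim conjE)
    fix t t' :: nat and s s'
    assume t: "t \<le> 50" "t' \<le> 30 * (n - 1) + 20" and s': "snd s' = \<mu>0" "fst s' ''out'' = (?f + 3) + 3 * int n"
      "\<forall>r. r \<notin> {''v'', ''out''} \<longrightarrow> fst s' r = fst (s1, \<mu>0) r"
    show "runs SETREGS s' (\<lambda>ta s'. runs SETSTACK s' (\<lambda>t'a s'. runs LOOP s' (\<lambda>t'b s'.
       t + (t' + (ta + (t'a + t'b))) \<le> 1000 * n \<and> Rep \<mu>0 s' (fst (chain.run (m - 1))) (snd (chain.run (m - 1))))))"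
      by (rule runs_mono[OF rest[OF s']], erule runs_mono, erule runs_mono) (use t n3 n_even in auto)
  qed
  then show ?thesis
  proof (rule runs_mono)
    fix t s'
    assume a: "t \<le> 1000 * n \<and> Rep \<mu>0 s' (fst (chain.run (m - 1))) (snd (chain.run (m - 1)))"
    have "output_points s' = (\<lambda>(X, Y). Complex (of_int X) (of_int Y)) ` set (snd (chain.run (m - 1)))"
      using a output_points_outs[of "snd s'" "fst s'" "snd (chain.run (m - 1))"] by (simp add: Rep_def)
    then have "output_points s' = {p. BL_stable H w h p}" unfolding chain.run_correct BL_stable_set .
    then show "t \<le> 1000 * n \<and> output_points s' = {p. BL_stable H w h p}" using a by blast
  qed
qed

end

theorem mainTheorem12:
  "\<exists>(P :: com) (C :: nat).
     \<forall>J H vs k L N R (w :: int) (h :: int) s.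
       BLS_hole J H vs \<longrightarrow>
       (\<forall>v\<in>vertices J. Re v \<in> \<int> \<and> Im v \<in> \<int>) \<longrightarrow>
       canonical_ordering J vs k L N R \<longrightarrow>
       0 < w \<longrightarrow> 0 < h \<longrightarrow>
       (\<forall>i\<in>{2..k}. let Q = upper_vertex vs (N i); QW = first_hit_right J Q
                    in Re QW - Re Q \<ge> of_int w) \<longrightarrow>
       is_input vs k L N R w h s \<longrightarrow>
       (\<exists>t s'. exec P s t s' \<and> t \<le> C * nv J \<and>
               output_points s' = {p. BL_stable H (of_int w) (of_int h) p})"
proof (rule exI[of _ PROG], rule exI[of _ 1000], intro allI impI)
  fix J H vs k L N R and w h :: int and s :: state
  assume a: "BLS_hole J H vs" "\<forall>v\<in>vertices J. Re v \<in> \<int> \<and> Im v \<in> \<int>" "canonical_ordering J vs k L N R" "0 < w" "0 < h"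
    "\<forall>i\<in>{2..k}. let Q = upper_vertex vs (N i); QW = first_hit_right J Q in Re QW - Re Q \<ge> of_int w"
    and inp: "is_input vs k L N R w h s"
  interpret bls_instance J H vs k L N R w h by (rule bls_instance.intro[OF a])
  obtain addr where recs: "\<forall>i<length vs. 0 < addr i \<and> addr i + 4 \<le> fst s ''free'' \<and>
           real_of_int (snd s (addr i)) = Re (vs ! i) \<and>
           real_of_int (snd s (addr i + 1)) = Im (vs ! i) \<and>
           snd s (addr i + 2) = addr (prv vs i) \<and>
           snd s (addr i + 3) = addr (nxt vs i)"
    and apart: "\<forall>i<length vs. \<forall>j<length vs. i \<noteq> j \<longrightarrow> addr i + 4 \<le> addr j \<or> addr j + 4 \<le> addr i"
    and regs0: "fst s ''k'' = int k" "fst s ''w'' = w" "fst s ''h'' = h"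
    and ptrs: "\<forall>j<2 * k. snd s (fst s ''canon'' + int j) = addr (canonical_list k L N R ! j)"
    and corner: "\<forall>i<length vs. falling_corner vs i \<longrightarrow> fst s ''corner'' = addr i"
    and no_corner: "(\<forall>i<length vs. \<not> falling_corner vs i) \<longrightarrow> fst s ''corner'' = 0"
    using inp unfolding is_input_def by blast
  interpret bls_ram J H vs k L N R w h "fst s" "snd s" addr
    by unfold_locales (use recs apart in blast)+
  have "runs PROG (fst s, snd s) (\<lambda>t s'. t \<le> 1000 * n \<and> output_points s' = {p. BL_stable H w h p})"
    by (rule runs_PROG) (use regs0 ptrs corner no_corner in blast)+
  moreover have "nv J = n"
    using clockwiseD(1,2)[OF cv] distinct_card[of vs] by (simp add: nv_def n_def)
  ultimately show "\<exists>t s'. exec PROG s t s' \<and> t \<le> 1000 * nv J \<and> output_points s' = {p. BL_stable H (of_int w) (of_int h) p}"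
    by (simp add: runs_def)
qed

end
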